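(* Let $(R,\mathfrak m)$ be an $F$-finite noetherian local domain of characteristic $p>0$ and Krull dimension $d\ge1$, let $J$ be an ideal generated by a system of parameters, and let $I$ be an $\mathfrak m$-primary ideal. The following are equivalent. (1) $$e(I,R)\ge\frac{d^d}{c^J(I)^d}\,e(J,R).$$ (2) There exists $x_0\in(0,c^J(I)]$ such that $$\frac{e(I,R)}{d^d}\ge\frac{h_{R,I,J}(x_0)}{x_0^d}.$$
   Context: $F$-finite means the Frobenius endomorphism is finite. $e(-,R)$ is the Hilbert–Samuel multiplicity. $J^{[p^n]}$ is the ideal generated by $p^n$-th powers of elements of $J$. The $F$-threshold is $c^J(I)=\lim_{n\to\infty}\frac1{p^n}\sup\{t\in\mathbb N: I^t\nsubseteq J^{[p^n]}\}$. The $h$-function is $h_{R,I,J}(s)=\lim_{n\to\infty}\frac1{p^{nd}}l\big(R/(I^{\lceil sp^n\rceil}+J^{[p^n]})\big)$ for $s\in\mathbb R$, where $l$ is length and nonpositive powers of $I$ are the unit ideal; the limit exists for all $s$. *)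

theory Defs
  imports Complex_Main "HOL-Library.Extended_Nat" "HOL-Algebra.Ring_Divisibility"
    "HOL-Algebra.Ideal_Product" "HOL-Algebra.QuotRing" "HOL-Algebra.Module"
begin

definition local_ring :: "('a, 'b) ring_scheme \<Rightarrow> 'a set \<Rightarrow> bool"
  where "local_ring R m \<longleftrightarrow>
    cring R \<and> maximalideal m R \<and> (\<forall>n. maximalideal n R \<longrightarrow> n = m)"

definition has_characteristic :: "('a, 'b) ring_scheme \<Rightarrow> nat \<Rightarrow> bool"
  where "has_characteristic R p \<longleftrightarrow>
    (\<forall>n::nat. [n] \<cdot>\<^bsub>R\<^esub> \<one>\<^bsub>R\<^esub> = \<zero>\<^bsub>R\<^esub> \<longleftrightarrow> p dvd n)"

definition krull_dim :: "('a, 'b) ring_scheme \<Rightarrow> enat"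
  where "krull_dim R =
    Sup {enat n | n. \<exists>P :: nat \<Rightarrow> 'a set.
      (\<forall>i\<le>n. primeideal (P i) R) \<and> (\<forall>i<n. P i \<subset> P (Suc i))}"

text \<open>A ring homomorphism \<open>f\<close> is finite if it makes the target a finitely generated
  module over the source.\<close>

definition finite_ring_hom ::
    "('a, 'c) ring_scheme \<Rightarrow> ('b, 'd) ring_scheme \<Rightarrow> ('a \<Rightarrow> 'b) \<Rightarrow> bool"
  where "finite_ring_hom R S f \<longleftrightarrow>
    f \<in> ring_hom R S \<and>
    (\<exists>B. finite B \<and> B \<subseteq> carrier S \<and>
      (\<forall>x\<in>carrier S. \<exists>c\<in>B \<rightarrow> carrier R. x = (\<Oplus>\<^bsub>S\<^esub>b\<in>B. f (c b) \<otimes>\<^bsub>S\<^esub> b)))"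

definition F_finite :: "('a, 'b) ring_scheme \<Rightarrow> nat \<Rightarrow> bool"
  where "F_finite R p \<longleftrightarrow> finite_ring_hom R R (\<lambda>x. x [^]\<^bsub>R\<^esub> p)"

definition radical :: "('a, 'b) ring_scheme \<Rightarrow> 'a set \<Rightarrow> 'a set"
  where "radical R Q = {x \<in> carrier R. \<exists>n::nat. x [^]\<^bsub>R\<^esub> n \<in> Q}"

definition primary_ideal :: "('a, 'b) ring_scheme \<Rightarrow> 'a set \<Rightarrow> bool"
  where "primary_ideal R Q \<longleftrightarrow>
    ideal Q R \<and> Q \<noteq> carrier R \<and>
    (\<forall>x\<in>carrier R. \<forall>y\<in>carrier R.
      x \<otimes>\<^bsub>R\<^esub> y \<in> Q \<longrightarrow> x \<in> Q \<or> (\<exists>n::nat. y [^]\<^bsub>R\<^esub> n \<in> Q))"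

definition primary_to :: "('a, 'b) ring_scheme \<Rightarrow> 'a set \<Rightarrow> 'a set \<Rightarrow> bool"
  where "primary_to R m Q \<longleftrightarrow> primary_ideal R Q \<and> radical R Q = m"

definition system_of_parameters :: "('a, 'b) ring_scheme \<Rightarrow> 'a set \<Rightarrow> 'a list \<Rightarrow> bool"
  where "system_of_parameters R m xs \<longleftrightarrow>
    enat (length xs) = krull_dim R \<and> set xs \<subseteq> m \<and> primary_to R m (Idl\<^bsub>R\<^esub> (set xs))"

text \<open>The multiplicative monoid of \<^const>\<open>ideals_set\<close> has unit \<^term>\<open>carrier R\<close>, so the zeroth
  power is the unit ideal.\<close>

abbreviation ideal_power :: "('a, 'b) ring_scheme \<Rightarrow> 'a set \<Rightarrow> nat \<Rightarrow> 'a set"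
  where "ideal_power R I n \<equiv> I [^]\<^bsub>ideals_set R\<^esub> n"

definition frobenius_power :: "('a, 'b) ring_scheme \<Rightarrow> 'a set \<Rightarrow> nat \<Rightarrow> 'a set"
  where "frobenius_power R J q = Idl\<^bsub>R\<^esub> ((\<lambda>x. x [^]\<^bsub>R\<^esub> q) ` J)"

definition module_length :: "('a, 'c) ring_scheme \<Rightarrow> ('a, 'b, 'd) module_scheme \<Rightarrow> enat"
  where "module_length R M =
    Sup {enat n | n. \<exists>N :: nat \<Rightarrow> 'b set.
      (\<forall>i\<le>n. submodule (N i) R M) \<and> (\<forall>i<n. N i \<subset> N (Suc i))}"

definition quot_module :: "('a, 'b) ring_scheme \<Rightarrow> 'a set \<Rightarrow> ('a, 'a set) module"
  where "quot_module R I =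
    \<lparr>carrier = carrier (R Quot I), mult = mult (R Quot I), one = one (R Quot I),
     zero = zero (R Quot I), add = add (R Quot I),
     smult = (\<lambda>a C. (I +>\<^bsub>R\<^esub> a) \<otimes>\<^bsub>R Quot I\<^esub> C)\<rparr>"

text \<open>\<open>l(R/I)\<close> as a real number; meaningful only when the length is finite.\<close>

definition quot_length :: "('a, 'b) ring_scheme \<Rightarrow> 'a set \<Rightarrow> real"
  where "quot_length R I = real (the_enat (module_length R (quot_module R I)))"

definition multiplicity :: "('a, 'b) ring_scheme \<Rightarrow> 'a set \<Rightarrow> real"
  where "multiplicity R I =
    (let d = the_enat (krull_dim R)
     in lim (\<lambda>n. fact d * quot_length R (ideal_power R I n) / real n ^ d))"

text \<open>For proper \<open>J\<close> and \<open>I\<close> contained in the radical of \<open>J\<close> (\<open>R\<close> noetherian) the set below is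
  nonempty and bounded, so the supremum in the naturals is the genuine one.\<close>

definition F_threshold :: "('a, 'b) ring_scheme \<Rightarrow> nat \<Rightarrow> 'a set \<Rightarrow> 'a set \<Rightarrow> real"
  where "F_threshold R p J I =
    lim (\<lambda>n. real (Sup {t::nat. \<not> ideal_power R I t \<subseteq> frobenius_power R J (p ^ n)}) / real (p ^ n))"

text \<open>The truncation \<^const>\<open>nat\<close> turns nonpositive exponents of \<open>I\<close> into \<open>0\<close>,
  i.e. into the unit ideal.\<close>

definition h_function ::
    "('a, 'b) ring_scheme \<Rightarrow> nat \<Rightarrow> 'a set \<Rightarrow> 'a set \<Rightarrow> real \<Rightarrow> real"
  where "h_function R p I J s =
    (let d = the_enat (krull_dim R)
     in lim (\<lambda>n. quot_length R
          (ideal_power R I (nat \<lceil>s * real (p ^ n)\<rceil>) <+>\<^bsub>R\<^esub> frobenius_power R J (p ^ n))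
          / real (p ^ (n * d))))"

end

theory Submission
  imports "HOL-Computational_Algebra.Primes" "HOL-Library.List_Lexorder" "HOL-Library.Disjoint_Sets" Defs
begin

text \<open>
  Write \<open>q = p\<^sup>n\<close>, \<open>c = c\<^sup>J(I)\<close> and \<open>h = h\<^bsub>R,I,J\<^esub>\<close>. The equivalence holds with an arbitrary real number
  in place of \<open>e(I,R)\<close>, because on \<open>(0, c]\<close> the function \<open>h(x)/x\<^sup>d\<close> attains its minimum at \<open>c\<close>, and the
  minimum is \<open>e(J,R)/c\<^sup>d\<close>.

  Let \<open>y\<^sub>1, \<dots>, y\<^sub>\<mu>\<close> generate \<open>I\<close>. Filtering by graded lexicographic leading terms gives
  \<open>l(R/(I\<^sup>N + A)) = \<Sum> \<psi>(u)\<close>, the sum over \<open>u \<in> \<nat>\<^sup>\<mu>\<close> with \<open>|u| < N\<close>, where \<open>\<psi>\<close> is bounded and decreasing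
  in each coordinate. For \<open>I = J\<close> and \<open>\<mu> = d\<close> such a function is constant far away from the
  coordinate hyperplanes, and its value there is \<open>e(J,R)\<close>; the same sums over boxes yield
  \<open>l(R/J\<^bsup>[q]\<^esup>)/q\<^sup>d \<longlonglongrightarrow> e(J,R)\<close>. For general \<open>I\<close> the support of \<open>\<psi>\<close> is a finite disjoint union of translates
  of \<open>\<nat>\<^sup>k\<close> with \<open>k \<le> d\<close>, and on each of them the sum over \<open>|w| < M\<close> of a decreasing function, divided by
  \<open>M\<^sup>k\<close>, decreases with \<open>M\<close>; so \<open>h(y)/y\<^sup>d \<le> h(x)/x\<^sup>d\<close> for \<open>x \<le> y\<close>. For \<open>y > c\<close> the power \<open>I\<^bsup>\<lceil>yq\<rceil>\<^esup>\<close> is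
  eventually contained in \<open>J\<^bsup>[q]\<^esup>\<close>, whence \<open>h(y) = e(J,R)\<close>; let \<open>y\<close> tend to \<open>c\<close>.

  The limit defining \<open>h(x)\<close> exists because \<open>a\<^sub>n = l(R/(I\<^bsup>\<lceil>xq\<rceil>\<^esup> + J\<^bsup>[q]\<^esup>))\<close> satisfies
  \<open>f a\<^bsub>n+1\<^esub> = r a\<^sub>n + O(q\<^bsup>d-1\<^esup>)\<close>, where \<open>r\<close> is the rank of \<open>R\<close> over its subring of \<open>p\<close>-th powers and \<open>f\<close>
  is the degree of the corresponding extension of residue fields. As \<open>a\<^sub>n = O(q\<^sup>d)\<close>, this implies
  convergence of \<open>a\<^sub>n/q\<^sup>d\<close> whatever the value of \<open>r/f\<close> is.
\<close>

section \<open>Length via chains of submodules\<close>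

text \<open>The functions h, c and e(J,R) are given by \<open>lim\<close>, so their limits have to
  be shown to exist, and J^[q] changes with q while the estimates must be uniform in q. Uniformity
  comes from comparing psi for A = J^[q] with psi for A = 0: the latter dominates, so one support,
  one decomposition of it and one bound serve all q. The pieces have dimension at most d because
  some J^k lies in I and J has d generators, whence l(R/I^n) = O(n^d). In the recursion, R is
  replaced by a free module G of rank r over the subring S of p-th powers, with a nonzero c such
  that c^p R lies in G. The loss is measured by colengths of ideals that contain c or c^p together
  with J^[q]. As J^[q] contains J^(dq+1), the loss grows at most like R/c along powers of J; this is
  of order q^(d-1), because the zero ideal can be put below any chain of primes containing c.
  Modules over R and over S are all subsets of R itself. A length is therefore the length of an
  interval of additive subgroups, and apart from the link to \<open>quot_length\<close> no quotient
  is formed.\<close>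

definition chain_len :: "('a set \<Rightarrow> bool) \<Rightarrow> 'a set \<Rightarrow> 'a set \<Rightarrow> enat"
  where "chain_len P A B = Sup {enat n | n. \<exists>N::nat \<Rightarrow> 'a set.
    (\<forall>i\<le>n. P (N i) \<and> A \<subseteq> N i \<and> N i \<subseteq> B) \<and> (\<forall>i<n. N i \<subset> N (Suc i))}"

lemma chain_len_ge:
  assumes "\<And>i. i \<le> n \<Longrightarrow> P (N i)" "\<And>i. i \<le> n \<Longrightarrow> A \<subseteq> N i" "\<And>i. i \<le> n \<Longrightarrow> N i \<subseteq> B"
    and "\<And>i. i < n \<Longrightarrow> N i \<subset> N (Suc i)"
  shows "enat n \<le> chain_len P A B"
  unfolding chain_len_def by (rule Sup_upper) (use assms in blast)

lemma chain_len_le: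
  assumes "\<And>n N. \<lbrakk>\<And>i. i \<le> n \<Longrightarrow> P (N i); \<And>i. i \<le> n \<Longrightarrow> A \<subseteq> N i; \<And>i. i \<le> n \<Longrightarrow> N i \<subseteq> B;
    \<And>i. i < n \<Longrightarrow> N i \<subset> N (Suc i)\<rbrakk> \<Longrightarrow> enat n \<le> k"
  shows "chain_len P A B \<le> k"
  unfolding chain_len_def
proof (rule Sup_least, clarify)
  fix n and N :: "nat \<Rightarrow> 'a set"
  assume "\<forall>i\<le>n. P (N i) \<and> A \<subseteq> N i \<and> N i \<subseteq> B" "\<forall>i<n. N i \<subset> N (Suc i)"
  then show "enat n \<le> k" by (intro assms[of n N]) auto
qed

text \<open>Most comparisons of lengths below go through this: a strictly monotone map between two
  intervals carries chains to chains.\<close>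

lemma chain_len_transfer:
  assumes "\<And>N. P N \<Longrightarrow> A \<subseteq> N \<Longrightarrow> N \<subseteq> B \<Longrightarrow> P' (\<Phi> N) \<and> A' \<subseteq> \<Phi> N \<and> \<Phi> N \<subseteq> B'"
    and "\<And>N N'. P N \<Longrightarrow> A \<subseteq> N \<Longrightarrow> P N' \<Longrightarrow> N' \<subseteq> B \<Longrightarrow> N \<subset> N' \<Longrightarrow> \<Phi> N \<subset> \<Phi> N'"
  shows "chain_len P A B \<le> chain_len P' A' B'"
proof (rule chain_len_le)
  fix n N
  assume N: "\<And>i. i \<le> n \<Longrightarrow> P (N i)" "\<And>i. i \<le> n \<Longrightarrow> A \<subseteq> N i" "\<And>i. i \<le> n \<Longrightarrow> N i \<subseteq> B"
    "\<And>i. i < n \<Longrightarrow> N i \<subset> N (Suc i)"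
  show "enat n \<le> chain_len P' A' B'"
    by (rule chain_len_ge[where N = "\<lambda>i. \<Phi> (N i)"]) (use N assms Suc_leI less_imp_le in auto)
qed

lemma chain_len_mono:
  assumes "A' \<subseteq> A" "B \<subseteq> B'"
  shows "chain_len P A B \<le> chain_len P A' B'"
  by (rule chain_len_transfer[where \<Phi> = "\<lambda>N. N"]) (use assms in auto)

lemma chain_len_self [simp]: "chain_len P A A = 0"
proof -
  have "chain_len P A A \<le> 0"
  proof (rule chain_len_le)
    fix n and N :: "nat \<Rightarrow> 'a set"
    assume N: "\<And>i. i \<le> n \<Longrightarrow> A \<subseteq> N i" "\<And>i. i \<le> n \<Longrightarrow> N i \<subseteq> A"
      "\<And>i. i < n \<Longrightarrow> N i \<subset> N (Suc i)"
    show "enat n \<le> 0"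
    proof (cases n)
      case (Suc k)
      then show ?thesis using N(1)[of 0] N(2)[of 1] N(3)[of 0] by auto
    qed (simp add: zero_enat_def)
  qed
  then show ?thesis by simp
qed

lemma chain_len_superadd:
  assumes "A \<subseteq> B" "B \<subseteq> C" "P B"
  shows "chain_len P A B + chain_len P B C \<le> chain_len P A C"
proof -
  define X where "X A B = {enat n | n. \<exists>N::nat \<Rightarrow> 'a set.
    (\<forall>i\<le>n. P (N i) \<and> A \<subseteq> N i \<and> N i \<subseteq> B) \<and> (\<forall>i<n. N i \<subset> N (Suc i))}" for A B
  have c: "chain_len P A B = Sup (X A B)" for A B
    unfolding chain_len_def X_def ..
  have *: "enat a + enat b \<le> chain_len P A C" if a: "enat a \<in> X A B" and b: "enat b \<in> X B C" for a b
  proof -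
    from a obtain N where N: "\<And>i. i \<le> a \<Longrightarrow> P (N i) \<and> A \<subseteq> N i \<and> N i \<subseteq> B"
      "\<And>i. i < a \<Longrightarrow> N i \<subset> N (Suc i)" unfolding X_def by auto
    from b obtain M where M: "\<And>i. i \<le> b \<Longrightarrow> P (M i) \<and> B \<subseteq> M i \<and> M i \<subseteq> C"
      "\<And>i. i < b \<Longrightarrow> M i \<subset> M (Suc i)" unfolding X_def by auto
    \<comment> \<open>\<open>M 0\<close> is skipped at the joint:
      \<open>N a \<subseteq> B \<subseteq> M 0 \<subset> M 1\<close>, so the joined chain stays
      strict and has a + b steps.\<close>
    define K where "K i = (if i \<le> a then N i else M (i - a))" for i
    have "enat (a + b) \<le> chain_len P A C"
    proof (rule chain_len_ge[where N = K])
      fix i assume "i \<le> a + b"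
      then have "P (K i) \<and> A \<subseteq> K i \<and> K i \<subseteq> C"
      proof (cases "i \<le> a")
        case True
        then show ?thesis using N(1)[of i] assms(2) by (auto simp: K_def)
      next
        case False
        then have "i - a \<le> b" using \<open>i \<le> a + b\<close> by auto
        then show ?thesis using M(1)[of "i - a"] assms(1) False by (auto simp: K_def)
      qed
      then show "P (K i)" "A \<subseteq> K i" "K i \<subseteq> C" by auto
    next
      fix i assume i: "i < a + b"
      show "K i \<subset> K (Suc i)"
      proof (cases "i < a")
        case True then show ?thesis using N(2) by (simp add: K_def)
      next
        case False
        show ?thesis
        proof (cases "i = a")
          case True
          then have "0 < b" using i by auto
          then have "M 0 \<subset> M 1" using M(2) by auto
          then show ?thesis using N(1)[of a] M(1)[of 0] True by (auto simp: K_def)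
        next
          case F: False
          then have "Suc i - a = Suc (i - a)" using False by auto
          then show ?thesis using F False i M(2)[of "i - a"] by (auto simp: K_def)
        qed
      qed
    qed
    then show ?thesis by simp
  qed
  have z: "0 \<in> X A B" "0 \<in> X B C" unfolding X_def zero_enat_def using assms by auto
  have fin: "\<exists>a. x = enat a" if "x \<in> X A B" for x A B using that unfolding X_def by auto
  show ?thesis
  \<comment> \<open>A finite value makes both sets of chain lengths finite; they contain 0, so both
    suprema are attained and two actual chains can be joined.\<close>
  proof (cases "chain_len P A C")
    case (enat k)
    have "X A B \<subseteq> enat ` {..k}" "X B C \<subseteq> enat ` {..k}"
    proof -
      show "X A B \<subseteq> enat ` {..k}"
      proof
        fix x assume x: "x \<in> X A B"
        then obtain a where "x = enat a" using fin by blast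
        then show "x \<in> enat ` {..k}" using *[of a 0] x z enat by (simp add: zero_enat_def)
      qed
      show "X B C \<subseteq> enat ` {..k}"
      proof
        fix x assume x: "x \<in> X B C"
        then obtain a where "x = enat a" using fin by blast
        then show "x \<in> enat ` {..k}" using *[of 0 a] x z enat by (simp add: zero_enat_def)
      qed
    qed
    then have "finite (X A B)" "finite (X B C)" by (meson finite_atMost finite_imageI finite_subset)+
    then have "Sup (X A B) \<in> X A B" "Sup (X B C) \<in> X B C"
      using z by (auto simp: Sup_enat_def intro: Max_in)
    then obtain a b where ab: "Sup (X A B) = enat a" "Sup (X B C) = enat b" using fin by blast
    then show ?thesis using *[of a b] \<open>Sup (X A B) \<in> X A B\<close> \<open>Sup (X B C) \<in> X B C\<close>
      unfolding c[of A B] c[of B C] by simp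
  qed simp
qed

lemma chain_len_extend:
  assumes "X \<subset> Y" "P Y" "A \<subseteq> X" "P X"
  shows "chain_len P A X + 1 \<le> chain_len P A Y"
proof -
  have "enat 1 \<le> chain_len P X Y"
    by (rule chain_len_ge[where N = "\<lambda>i. if i = 0 then X else Y"]) (use assms in auto)
  then show ?thesis using chain_len_superadd[of A X Y P] assms
    by (metis (no_types, lifting) add_left_mono dual_order.trans one_enat_def psubset_imp_subset)
qed

context cring
begin

text \<open>The scalars are a parameter because the same subsets of R are measured over two rings:
  over R, where they are the ideals, and over the subring of p-th powers.\<close>

definition smod :: "'a set \<Rightarrow> 'a set \<Rightarrow> bool"
  where "smod S N \<longleftrightarrow> N \<subseteq> carrier R \<and> \<zero> \<in> N \<and> (\<forall>x\<in>N. \<forall>y\<in>N. x \<oplus> y \<in> N) \<and>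
    (\<forall>x\<in>N. \<ominus> x \<in> N) \<and> (\<forall>s\<in>S. \<forall>x\<in>N. s \<otimes> x \<in> N)"

lemma smodD:
  assumes "smod S N"
  shows "N \<subseteq> carrier R" "\<zero> \<in> N" "x \<in> N \<Longrightarrow> y \<in> N \<Longrightarrow> x \<oplus> y \<in> N"
    "x \<in> N \<Longrightarrow> \<ominus> x \<in> N" "x \<in> N \<Longrightarrow> y \<in> N \<Longrightarrow> x \<ominus> y \<in> N" "s \<in> S \<Longrightarrow> x \<in> N \<Longrightarrow> s \<otimes> x \<in> N"
    "x \<in> N \<Longrightarrow> x \<in> carrier R"
  using assms unfolding smod_def a_minus_def by auto

lemma ideal_iff_smod: "ideal N R \<longleftrightarrow> smod (carrier R) N"
proof
  assume "ideal N R"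
  then interpret ideal N R .
  show "smod (carrier R) N" unfolding smod_def using a_subset by (auto intro: I_l_closed)
next
  assume N: "smod (carrier R) N"
  show "ideal N R"
  proof (rule idealI)
    show "ring R" by (rule ring_axioms)
    show "subgroup N (add_monoid R)"
      using N by unfold_locales (auto simp: smod_def simp flip: a_inv_def)
    fix a x assume "a \<in> N" "x \<in> carrier R"
    then show "x \<otimes> a \<in> N" "a \<otimes> x \<in> N"
      using N m_comm[of a x] by (auto simp: smod_def)
  qed
qed

lemma ideal_imp_smod: "ideal N R \<Longrightarrow> S \<subseteq> carrier R \<Longrightarrow> smod S N"
  unfolding ideal_iff_smod smod_def by blast

lemma set_add_iff: "x \<in> A <+>\<^bsub>R\<^esub> B \<longleftrightarrow> (\<exists>a\<in>A. \<exists>b\<in>B. x = a \<oplus> b)"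
  unfolding set_add_def' by auto

lemma smod_Int: "smod S A \<Longrightarrow> smod S B \<Longrightarrow> smod S (A \<inter> B)"
  unfolding smod_def by blast

lemma smod_add:
  assumes "smod S A" "smod S B" "S \<subseteq> carrier R"
  shows "smod S (A <+>\<^bsub>R\<^esub> B)"
proof -
  note A = smodD[OF assms(1)] and B = smodD[OF assms(2)]
  have "x \<oplus> y \<in> A <+>\<^bsub>R\<^esub> B" if "x \<in> A <+>\<^bsub>R\<^esub> B" "y \<in> A <+>\<^bsub>R\<^esub> B" for x y
  proof -
    from that obtain a b a' b' where "a \<in> A" "b \<in> B" "a' \<in> A" "b' \<in> B" "x = a \<oplus> b" "y = a' \<oplus> b'"
      unfolding set_add_iff by blast
    moreover then have "x \<oplus> y = (a \<oplus> a') \<oplus> (b \<oplus> b')"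
      using A(7) B(7) by (simp add: a_ac)
    ultimately show ?thesis unfolding set_add_iff using A(3) B(3) by blast
  qed
  moreover have "\<ominus> x \<in> A <+>\<^bsub>R\<^esub> B" if "x \<in> A <+>\<^bsub>R\<^esub> B" for x
  proof -
    from that obtain a b where "a \<in> A" "b \<in> B" "x = a \<oplus> b" unfolding set_add_iff by blast
    moreover then have "\<ominus> x = \<ominus> a \<oplus> \<ominus> b" using A(7) B(7) by (simp add: minus_add)
    ultimately show ?thesis unfolding set_add_iff using A(4) B(4) by blast
  qed
  moreover have "s \<otimes> x \<in> A <+>\<^bsub>R\<^esub> B" if "s \<in> S" "x \<in> A <+>\<^bsub>R\<^esub> B" for s x
  proof -
    from that obtain a b where "a \<in> A" "b \<in> B" "x = a \<oplus> b" unfolding set_add_iff by blast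
    moreover then have "s \<otimes> x = s \<otimes> a \<oplus> s \<otimes> b"
      using A(7) B(7) assms(3) that by (auto simp: r_distr)
    ultimately show ?thesis unfolding set_add_iff using A(6) B(6) that by blast
  qed
  moreover have "\<zero> \<in> A <+>\<^bsub>R\<^esub> B" unfolding set_add_iff using A(2) B(2) l_zero[OF zero_closed] by metis
  moreover have "A <+>\<^bsub>R\<^esub> B \<subseteq> carrier R" using A(7) B(7) by (auto simp: set_add_iff)
  ultimately show ?thesis unfolding smod_def by blast
qed

lemma set_add_upper:
  assumes "smod S A" "smod S B"
  shows "A \<subseteq> A <+>\<^bsub>R\<^esub> B" "B \<subseteq> A <+>\<^bsub>R\<^esub> B"
proof -
  show "A \<subseteq> A <+>\<^bsub>R\<^esub> B"
  proof
    fix x assume "x \<in> A"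
    then show "x \<in> A <+>\<^bsub>R\<^esub> B" unfolding set_add_iff
      using smodD(7)[OF assms(1)] smodD(2)[OF assms(2)] by (intro bexI[of _ x] bexI[of _ \<zero>]) auto
  qed
  show "B \<subseteq> A <+>\<^bsub>R\<^esub> B"
  proof
    fix x assume "x \<in> B"
    then show "x \<in> A <+>\<^bsub>R\<^esub> B" unfolding set_add_iff
      using smodD(7)[OF assms(2)] smodD(2)[OF assms(1)] by (intro bexI[of _ \<zero>] bexI[of _ x]) auto
  qed
qed

lemma set_add_least:
  assumes "smod S N" "A \<subseteq> N" "B \<subseteq> N"
  shows "A <+>\<^bsub>R\<^esub> B \<subseteq> N"
proof
  fix x assume "x \<in> A <+>\<^bsub>R\<^esub> B"
  then obtain a b where "a \<in> A" "b \<in> B" "x = a \<oplus> b" unfolding set_add_iff by blast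
  then show "x \<in> N" using smodD(3)[OF assms(1), of a b] assms(2,3) by blast
qed

abbreviation len :: "'a set \<Rightarrow> 'a set \<Rightarrow> 'a set \<Rightarrow> enat"
  where "len S \<equiv> chain_len (smod S)"

text \<open>A chain from A to C is projected to the two intervals by intersecting with B and by
  adding B. By the modular law no strict inclusion collapses under both projections, so each step of
  the chain is counted at least once.\<close>

lemma len_add:
  assumes S: "S \<subseteq> carrier R" and "smod S A" "smod S B" "smod S C" "A \<subseteq> B" "B \<subseteq> C"
  shows "len S A C = len S A B + len S B C"
proof (rule antisym)
  show "len S A B + len S B C \<le> len S A C" by (rule chain_len_superadd) (use assms in auto)
  show "len S A C \<le> len S A B + len S B C"
  proof (rule chain_len_le)
    fix n N
    assume N: "\<And>i. i \<le> n \<Longrightarrow> smod S (N i)" "\<And>i. i \<le> n \<Longrightarrow> A \<subseteq> N i" "\<And>i. i \<le> n \<Longrightarrow> N i \<subseteq> C"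
      "\<And>i. i < n \<Longrightarrow> N i \<subset> N (Suc i)"
    have "j \<le> n \<Longrightarrow> enat j \<le> len S A (N j \<inter> B) + len S B (N j <+>\<^bsub>R\<^esub> B)" for j
    proof (induction j)
      case 0
      then show ?case by (simp flip: zero_enat_def)
    next
      case (Suc j)
      note m = N(1)[of j] N(1)[of "Suc j"] \<open>smod S B\<close>
      have lt: "N j \<subset> N (Suc j)" using N(4) Suc.prems by simp
      have sub: "N j \<inter> B \<subseteq> N (Suc j) \<inter> B" "N j <+>\<^bsub>R\<^esub> B \<subseteq> N (Suc j) <+>\<^bsub>R\<^esub> B"
        using lt unfolding set_add_def' by auto
      have m1: "smod S (N j \<inter> B)" "smod S (N (Suc j) \<inter> B)" "smod S (N j <+>\<^bsub>R\<^esub> B)" "smod S (N (Suc j) <+>\<^bsub>R\<^esub> B)"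
        using m Suc.prems S by (auto intro: smod_Int smod_add)
      have s1: "A \<subseteq> N j \<inter> B" "B \<subseteq> N j <+>\<^bsub>R\<^esub> B"
        using N(2)[of j] assms Suc.prems set_add_upper[OF m(1,3)] by auto
      have IH: "enat j \<le> len S A (N j \<inter> B) + len S B (N j <+>\<^bsub>R\<^esub> B)" using Suc by simp
      have mono: "len S A (N j \<inter> B) \<le> len S A (N (Suc j) \<inter> B)"
        "len S B (N j <+>\<^bsub>R\<^esub> B) \<le> len S B (N (Suc j) <+>\<^bsub>R\<^esub> B)"
        using sub by (auto intro: chain_len_mono)
      consider "N j \<inter> B \<subset> N (Suc j) \<inter> B" | "N j <+>\<^bsub>R\<^esub> B \<subset> N (Suc j) <+>\<^bsub>R\<^esub> B"
      proof -
        have "False" if e: "N j \<inter> B = N (Suc j) \<inter> B" "N j <+>\<^bsub>R\<^esub> B = N (Suc j) <+>\<^bsub>R\<^esub> B"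
        proof -
          obtain x where x: "x \<in> N (Suc j)" "x \<notin> N j" using lt by blast
          then have "x \<in> N j <+>\<^bsub>R\<^esub> B" using e(2) set_add_upper[OF m(2,3)] Suc.prems by blast
          then obtain a b where ab: "a \<in> N j" "b \<in> B" "x = a \<oplus> b" unfolding set_add_iff by blast
          have c: "a \<in> carrier R" "b \<in> carrier R" using ab smodD(7) m Suc.prems by auto
          have "b = x \<ominus> a" using c ab(3) by (simp add: a_minus_def a_comm r_neg1)
          then have "b \<in> N (Suc j)" using smodD(5)[OF m(2)] x(1) ab(1) lt Suc.prems by auto
          then have "b \<in> N j" using e(1) ab by blast
          then show False using smodD(3)[OF m(1)] ab x(2) Suc.prems by auto
        qed
        then show ?thesis using that sub by blast
      qed
      then show ?case
      proof cases
        case 1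
        then have a1: "len S A (N j \<inter> B) + 1 \<le> len S A (N (Suc j) \<inter> B)"
          using chain_len_extend m1 s1 by metis
        have "enat j + 1 \<le> (len S A (N j \<inter> B) + 1) + len S B (N j <+>\<^bsub>R\<^esub> B)"
          using add_right_mono[OF IH, of 1] by (simp add: ac_simps)
        also have "\<dots> \<le> len S A (N (Suc j) \<inter> B) + len S B (N (Suc j) <+>\<^bsub>R\<^esub> B)"
          by (intro add_mono mono) fact
        finally have "enat j + 1 \<le> len S A (N (Suc j) \<inter> B) + len S B (N (Suc j) <+>\<^bsub>R\<^esub> B)" .
        then show ?thesis by (simp add: one_enat_def)
      next
        case 2
        then have a1: "len S B (N j <+>\<^bsub>R\<^esub> B) + 1 \<le> len S B (N (Suc j) <+>\<^bsub>R\<^esub> B)"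
          using chain_len_extend m1 s1 by metis
        have "enat j + 1 \<le> len S A (N j \<inter> B) + (len S B (N j <+>\<^bsub>R\<^esub> B) + 1)"
          using add_right_mono[OF IH, of 1] by (simp add: ac_simps)
        also have "\<dots> \<le> len S A (N (Suc j) \<inter> B) + len S B (N (Suc j) <+>\<^bsub>R\<^esub> B)"
          by (intro add_mono mono) fact
        finally have "enat j + 1 \<le> len S A (N (Suc j) \<inter> B) + len S B (N (Suc j) <+>\<^bsub>R\<^esub> B)" .
        then show ?thesis by (simp add: one_enat_def)
      qed
    qed
    then have "enat n \<le> len S A (N n \<inter> B) + len S B (N n <+>\<^bsub>R\<^esub> B)" by simp
    also have "\<dots> \<le> len S A B + len S B C"
    proof (intro add_mono chain_len_mono)
      show "N n <+>\<^bsub>R\<^esub> B \<subseteq> C" by (rule set_add_least[OF \<open>smod S C\<close> N(3)]) (use assms in auto)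
    qed auto
    finally show "enat n \<le> len S A B + len S B C" .
  qed
qed

lemma additive_on_zero:
  assumes "smod S B" "f \<in> B \<rightarrow> carrier R" "\<And>x y. x \<in> B \<Longrightarrow> y \<in> B \<Longrightarrow> f (x \<oplus> y) = f x \<oplus> f y"
  shows "f \<zero> = \<zero>" "x \<in> B \<Longrightarrow> f (\<ominus> x) = \<ominus> f x"
proof -
  have z: "\<zero> \<in> B" by (rule smodD(2)[OF assms(1)])
  then have c: "f \<zero> \<in> carrier R" using assms(2) by blast
  have "f \<zero> \<oplus> f \<zero> = f \<zero> \<oplus> \<zero>" using assms(3)[OF z z] c by simp
  then show f0: "f \<zero> = \<zero>" using c by (simp only: add.l_cancel zero_closed)
  assume x: "x \<in> B"
  then have mx: "\<ominus> x \<in> B" by (rule smodD(4)[OF assms(1)])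
  have fc: "f x \<in> carrier R" "f (\<ominus> x) \<in> carrier R" using x mx assms(2) by auto
  have "f (\<ominus> x) \<oplus> f x = \<zero>" using assms(3)[OF mx x] f0 smodD(7)[OF assms(1) x] by (simp add: l_neg)
  then show "f (\<ominus> x) = \<ominus> f x" using fc by (simp add: minus_equality)
qed

text \<open>Chains are pulled back along a map inducing a surjection from B/A to B'/A'. The scalars
  may change with the map, which admits Frobenius-semilinear maps and so turns lengths over R into
  lengths over p-th powers.\<close>

lemma len_surj:
  assumes A: "smod S A" and B: "smod S B" and "smod S' A'" and "smod S' B'"
    and fB: "\<And>x. x \<in> B \<Longrightarrow> f x \<in> B'" and add: "\<And>x y. x \<in> B \<Longrightarrow> y \<in> B \<Longrightarrow> f (x \<oplus> y) = f x \<oplus> f y"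
    and sc: "\<And>s x. s \<in> S \<Longrightarrow> x \<in> B \<Longrightarrow> \<exists>s'\<in>S'. f (s \<otimes> x) = s' \<otimes> f x"
    and AB: "A \<subseteq> B" and fA: "\<And>x. x \<in> A \<Longrightarrow> f x \<in> A'"
    and onto: "\<And>y. y \<in> B' \<Longrightarrow> \<exists>x\<in>B. \<exists>a\<in>A'. y = f x \<oplus> a"
  shows "len S' A' B' \<le> len S A B"
proof (rule chain_len_transfer[where \<Phi> = "\<lambda>N. {x \<in> B. f x \<in> N}"])
  have fB': "f \<in> B \<rightarrow> carrier R" using fB smodD(7)[OF \<open>smod S' B'\<close>] by blast
  have z: "f \<zero> = \<zero>" "\<And>x. x \<in> B \<Longrightarrow> f (\<ominus> x) = \<ominus> f x"
    using additive_on_zero[OF B fB'] add by auto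
  show "smod S {x \<in> B. f x \<in> N} \<and> A \<subseteq> {x \<in> B. f x \<in> N} \<and> {x \<in> B. f x \<in> N} \<subseteq> B"
    if N: "smod S' N" "A' \<subseteq> N" "N \<subseteq> B'" for N
  proof -
    note Nd = smodD[OF N(1)] and Bd = smodD[OF B]
    have "smod S {x \<in> B. f x \<in> N}"
      unfolding smod_def
    proof (intro conjI ballI)
      fix s x assume sx: "s \<in> S" "x \<in> {x \<in> B. f x \<in> N}"
      then obtain s' where "s' \<in> S'" "f (s \<otimes> x) = s' \<otimes> f x" using sc by blast
      then show "s \<otimes> x \<in> {x \<in> B. f x \<in> N}" using sx Nd Bd by auto
    qed (use Nd(2,3,4) Bd(1,2,3,4) z add in auto)
    then show ?thesis using AB fA N by auto
  qed
  show "{x \<in> B. f x \<in> N} \<subset> {x \<in> B. f x \<in> N'}"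
    if N: "smod S' N" "A' \<subseteq> N" "smod S' N'" "N' \<subseteq> B'" "N \<subset> N'" for N N'
  proof -
    obtain y where y: "y \<in> N'" "y \<notin> N" using N by blast
    then obtain x a where x: "x \<in> B" "a \<in> A'" "y = f x \<oplus> a" using onto N by blast
    have c: "f x \<in> carrier R" "a \<in> carrier R" using x fB' N smodD(7)[OF \<open>smod S' A'\<close>] by auto
    have "f x = y \<ominus> a" using c x(3) by (simp add: a_minus_def a_assoc r_neg)
    have aN: "a \<in> N" "a \<in> N'" using subsetD[OF N(2) x(2)] N(5) by auto
    from \<open>f x = y \<ominus> a\<close> have "f x \<in> N'" using smodD(5)[OF N(3) y(1) aN(2)] by simp
    moreover have "f x \<notin> N" using smodD(3)[OF N(1) _ aN(1), of "f x"] y x(3) by auto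
    ultimately show ?thesis using x N by blast
  qed
qed

text \<open>The counterpart for a map inducing an injection from B/A to B'/A': a chain is pushed
  forward by sending N to f(N) + A'.\<close>

lemma len_inj:
  assumes A: "smod S A" and B: "smod S B" and A': "smod S' A'" and B': "smod S' B'" and "S' \<subseteq> carrier R"
    and fB: "\<And>x. x \<in> B \<Longrightarrow> f x \<in> B'" and add: "\<And>x y. x \<in> B \<Longrightarrow> y \<in> B \<Longrightarrow> f (x \<oplus> y) = f x \<oplus> f y"
    and sc: "\<And>s x. s \<in> S' \<Longrightarrow> x \<in> B \<Longrightarrow> \<exists>s'\<in>S. f (s' \<otimes> x) = s \<otimes> f x"
    and AB: "A' \<subseteq> B'" and fA: "\<And>x. x \<in> B \<Longrightarrow> f x \<in> A' \<Longrightarrow> x \<in> A"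
  shows "len S A B \<le> len S' A' B'"
proof (rule chain_len_transfer[where \<Phi> = "\<lambda>N. f ` N <+>\<^bsub>R\<^esub> A'"])
  have fB': "f \<in> B \<rightarrow> carrier R" using fB smodD(7)[OF \<open>smod S' B'\<close>] by blast
  have z: "f \<zero> = \<zero>" "\<And>x. x \<in> B \<Longrightarrow> f (\<ominus> x) = \<ominus> f x"
    using additive_on_zero[OF B fB'] add by auto
  have sm: "smod S' (f ` N)" if N: "smod S N" "A \<subseteq> N" "N \<subseteq> B" for N
  proof -
    note Nd = smodD[OF N(1)]
    have 1: "f ` N \<subseteq> carrier R" using fB' N by auto
    have 2: "\<zero> \<in> f ` N" using z(1) Nd(2) by force
    have 3: "x \<oplus> y \<in> f ` N" if "x \<in> f ` N" "y \<in> f ` N" for x y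
    proof -
      from that obtain x0 y0 where "x0 \<in> N" "y0 \<in> N" "x = f x0" "y = f y0" by blast
      then have "x \<oplus> y = f (x0 \<oplus> y0)" "x0 \<oplus> y0 \<in> N" using add[of x0 y0] subsetD[OF N(3)] Nd(3)[of x0 y0] by simp_all
      then show ?thesis by blast
    qed
    have 4: "\<ominus> x \<in> f ` N" if "x \<in> f ` N" for x
    proof -
      from that obtain x0 where "x0 \<in> N" "x = f x0" by blast
      then have "\<ominus> x = f (\<ominus> x0)" "\<ominus> x0 \<in> N" using z(2)[of x0] subsetD[OF N(3)] Nd(4)[of x0] by simp_all
      then show ?thesis by blast
    qed
    have 5: "s \<otimes> x \<in> f ` N" if sx: "s \<in> S'" "x \<in> f ` N" for x s
    proof -
      from sx(2) obtain x0 where x0: "x0 \<in> N" "x = f x0" by blast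
      then obtain s' where "s' \<in> S" "f (s' \<otimes> x0) = s \<otimes> f x0"
        using sc[OF sx(1), of x0] subsetD[OF N(3)] by auto
      then show ?thesis using x0 Nd(6)[of s' x0] by (metis imageI)
    qed
    show ?thesis unfolding smod_def using 1 2 3 4 5 by blast
  qed
  show "smod S' (f ` N <+>\<^bsub>R\<^esub> A') \<and> A' \<subseteq> f ` N <+>\<^bsub>R\<^esub> A' \<and> f ` N <+>\<^bsub>R\<^esub> A' \<subseteq> B'"
    if N: "smod S N" "A \<subseteq> N" "N \<subseteq> B" for N
  proof -
    have "f ` N \<subseteq> B'" using fB N by auto
    then show ?thesis using smod_add[OF sm[OF N] A' \<open>S' \<subseteq> carrier R\<close>] set_add_upper[OF sm[OF N] A']
      set_add_least[OF B' _ AB] by blast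
  qed
  show "f ` N <+>\<^bsub>R\<^esub> A' \<subset> f ` N' <+>\<^bsub>R\<^esub> A'"
    if N: "smod S N" "A \<subseteq> N" "smod S N'" "N' \<subseteq> B" "N \<subset> N'" for N N'
  proof -
    obtain y where y: "y \<in> N'" "y \<notin> N" using N by blast
    have "A \<subseteq> N'" using N by auto
    then have "f y \<in> f ` N' <+>\<^bsub>R\<^esub> A'" using set_add_upper(1)[OF sm[OF N(3) _ N(4)] A'] y by blast
    moreover have False if "f y \<in> f ` N <+>\<^bsub>R\<^esub> A'"
    proof -
      from that obtain x a where x: "x \<in> N" "a \<in> A'" "f y = f x \<oplus> a" unfolding set_add_iff by blast
      have xB: "x \<in> B" "y \<in> B" using x y N by auto
      then have c: "f x \<in> carrier R" "a \<in> carrier R" using x fB' smodD(7)[OF A'] by auto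
      have mx: "\<ominus> x \<in> B" using smodD(4)[OF B xB(1)] .
      have yx: "y \<ominus> x \<in> B" using smodD(5)[OF B xB(2,1)] .
      have "f (y \<ominus> x) = a" unfolding a_minus_def
        using add[OF xB(2) mx] z(2)[OF xB(1)] x(3) c
        by (metis a_assoc a_comm r_neg a_inv_closed r_zero)
      then have "y \<ominus> x \<in> N" using fA[OF yx] x(2) N by auto
      then have "(y \<ominus> x) \<oplus> x \<in> N" using smodD(3)[OF N(1) _ x(1)] by blast
      moreover have "(y \<ominus> x) \<oplus> x = y" using xB smodD(7)[OF B] by (simp add: a_minus_def a_assoc l_neg)
      ultimately show False using y by simp
    qed
    moreover have "f ` N <+>\<^bsub>R\<^esub> A' \<subseteq> f ` N' <+>\<^bsub>R\<^esub> A'" using N unfolding set_add_def' by auto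
    ultimately show ?thesis by blast
  qed
qed

text \<open>The identity of R induces a map from B/A to B'/A', which is onto because B' lies in B +
  A'.\<close>

lemma len_quotient:
  assumes "smod S A" "smod S B" "smod S A'" "smod S B'" "A \<subseteq> A'" "A \<subseteq> B" "B \<subseteq> B'" "B' \<subseteq> B <+>\<^bsub>R\<^esub> A'"
  shows "len S A' B' \<le> len S A B"
  by (rule len_surj[where f = "\<lambda>x. x"]) (use assms in \<open>auto simp: set_add_iff subset_iff\<close>)

lemma len_mult_surj:
  assumes "S \<subseteq> carrier R" "smod S A" "smod S B" "smod S A'" "smod S B'" "A \<subseteq> B" "a \<in> carrier R"
    and "\<And>x. x \<in> A \<Longrightarrow> a \<otimes> x \<in> A'" "\<And>x. x \<in> B \<Longrightarrow> a \<otimes> x \<in> B'"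
    and "\<And>y. y \<in> B' \<Longrightarrow> \<exists>x\<in>B. \<exists>z\<in>A'. y = a \<otimes> x \<oplus> z"
  shows "len S A' B' \<le> len S A B"
proof (rule len_surj[where f = "\<lambda>x. a \<otimes> x"])
  fix s x assume sx: "s \<in> S" "x \<in> B"
  then have "a \<otimes> (s \<otimes> x) = s \<otimes> (a \<otimes> x)"
    using assms(1,7) smodD(7)[OF assms(3)] m_lcomm by auto
  then show "\<exists>s'\<in>S. a \<otimes> (s \<otimes> x) = s' \<otimes> (a \<otimes> x)" using sx by blast
qed (use assms smodD(7)[OF assms(3)] r_distr in auto)

lemma len_mult_inj:
  assumes "S \<subseteq> carrier R" "smod S A" "smod S B" "smod S A'" "smod S B'" "A' \<subseteq> B'" "a \<in> carrier R"
    and "\<And>x. x \<in> B \<Longrightarrow> a \<otimes> x \<in> A' \<Longrightarrow> x \<in> A" "\<And>x. x \<in> B \<Longrightarrow> a \<otimes> x \<in> B'"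
  shows "len S A B \<le> len S A' B'"
proof (rule len_inj[where f = "\<lambda>x. a \<otimes> x"])
  fix s x assume sx: "s \<in> S" "x \<in> B"
  then have "a \<otimes> (s \<otimes> x) = s \<otimes> (a \<otimes> x)"
    using assms(1,7) smodD(7)[OF assms(3)] m_lcomm by auto
  then show "\<exists>s'\<in>S. a \<otimes> (s' \<otimes> x) = s \<otimes> (a \<otimes> x)" using sx by blast
qed (use assms smodD(7)[OF assms(3)] r_distr in auto)

end

section \<open>Colength of an ideal and length of its quotient\<close>

context cring
begin

abbreviation colen :: "'a set \<Rightarrow> enat"
  where "colen A \<equiv> len (carrier R) A (carrier R)"

lemma coset_eq_iff:
  assumes "ideal I R" "x \<in> carrier R" "y \<in> carrier R"
  shows "I +> x = I +> y \<longleftrightarrow> x \<ominus> y \<in> I"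
  using quotient_eq_iff_same_a_r_cos[OF assms(1), of x y] assms by blast

text \<open>The bridge from the definitions to chains of ideals: preimages and images under the
  projection to R/I translate between submodules of \<open>quot_module R I\<close> and ideals
  containing I.\<close>

lemma quot_length_eq:
  assumes I: "ideal I R"
  shows "quot_length R I = real (the_enat (colen I))"
proof -
  interpret I: ideal I R by (rule I)
  let ?M = "quot_module R I"
  define \<Phi> where "\<Phi> N = {x \<in> carrier R. I +> x \<in> N}" for N
  define \<Psi> where "\<Psi> N = (\<lambda>x. I +> x) ` N" for N
  have carr: "carrier ?M = (\<lambda>x. I +> x) ` carrier R"
    unfolding quot_module_def FactRing_def A_RCOSETS_def' by auto
  have addM: "add ?M (I +> x) (I +> y) = I +> (x \<oplus> y)" if "x \<in> carrier R" "y \<in> carrier R" for x y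
    using that by (simp add: quot_module_def FactRing_def I.a_rcos_sum)
  have zeroM: "zero ?M = I +> \<zero>"
    using a_rcos_zero[OF I, of \<zero>] by (simp add: quot_module_def FactRing_def)
  have smultM: "smult ?M a (I +> x) = I +> (a \<otimes> x)" if "a \<in> carrier R" "x \<in> carrier R" for a x
    using that by (simp add: quot_module_def FactRing_def I.rcoset_mult_add)
  have invM: "inv\<^bsub>add_monoid ?M\<^esub> (I +> x) = I +> (\<ominus> x)" if "x \<in> carrier R" for x
  proof -
    interpret Q: ring "R Quot I" by (rule I.quotient_is_ring)
    have 1: "\<ominus>\<^bsub>R Quot I\<^esub> (I +> x) = I +> (\<ominus> x)"
      using that I.a_rcos_sum[of "\<ominus> x" x] a_rcos_zero[OF I, of \<zero>]
      by (intro Q.minus_equality) (auto simp: FactRing_def A_RCOSETS_def' l_neg)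
    have "inv\<^bsub>add_monoid ?M\<^esub> (I +> x) = inv\<^bsub>add_monoid (R Quot I)\<^esub> (I +> x)"
      by (simp add: m_inv_def quot_module_def)
    then show ?thesis using 1 by (simp add: a_inv_def)
  qed
  have sub_iff: "submodule N R ?M \<longleftrightarrow> N \<subseteq> carrier ?M \<and> zero ?M \<in> N \<and>
    (\<forall>x\<in>N. \<forall>y\<in>N. add ?M x y \<in> N) \<and> (\<forall>x\<in>N. inv\<^bsub>add_monoid ?M\<^esub> x \<in> N) \<and>
    (\<forall>a\<in>carrier R. \<forall>x\<in>N. smult ?M a x \<in> N)" for N
    unfolding submodule_def submodule_axioms_def subgroup_def by auto
  have \<Phi>: "smod (carrier R) (\<Phi> N) \<and> I \<subseteq> \<Phi> N \<and> \<Phi> N \<subseteq> carrier R" if "submodule N R ?M" for N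
  proof -
    note N = that[unfolded sub_iff]
    have "smod (carrier R) (\<Phi> N)"
      unfolding smod_def \<Phi>_def
    proof (intro conjI ballI)
      fix x y assume "x \<in> {x \<in> carrier R. I +> x \<in> N}" "y \<in> {x \<in> carrier R. I +> x \<in> N}"
      then show "x \<oplus> y \<in> {x \<in> carrier R. I +> x \<in> N}" using N addM[of x y] by (auto; metis)
    next
      fix x assume x: "x \<in> {x \<in> carrier R. I +> x \<in> N}"
      then show "\<ominus> x \<in> {x \<in> carrier R. I +> x \<in> N}" using N invM[of x] by (auto; metis)
      fix s assume "s \<in> carrier R"
      then show "s \<otimes> x \<in> {x \<in> carrier R. I +> x \<in> N}" using x N smultM[of s x] by (auto; metis)
    qed (use N zeroM in auto)
    moreover have "I \<subseteq> \<Phi> N"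
    proof
      fix x assume x: "x \<in> I"
      then have "I +> x = I +> \<zero>" using coset_eq_iff[OF I, of x \<zero>] I.Icarr by (simp add: a_minus_def)
      then show "x \<in> \<Phi> N" using N zeroM x I.Icarr by (simp add: \<Phi>_def)
    qed
    ultimately show ?thesis by (auto simp: \<Phi>_def)
  qed
  have \<Psi>: "submodule (\<Psi> N) R ?M" if "smod (carrier R) N" "N \<subseteq> carrier R" for N
    unfolding sub_iff
  proof (intro conjI ballI)
    note N = smodD[OF that(1)]
    show "\<Psi> N \<subseteq> carrier ?M" using that(2) unfolding carr \<Psi>_def by auto
    show "zero ?M \<in> \<Psi> N" unfolding zeroM \<Psi>_def using N(2) by auto
    fix x assume "x \<in> \<Psi> N"
    then obtain x0 where x: "x0 \<in> N" "x = I +> x0" unfolding \<Psi>_def by auto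
    then show "inv\<^bsub>add_monoid ?M\<^esub> x \<in> \<Psi> N" using invM[OF N(7)] N(4) unfolding \<Psi>_def by auto
    show "smult ?M a x \<in> \<Psi> N" if "a \<in> carrier R" for a
      using smultM[OF that N(7), of x0] N(6)[OF that, of x0] x unfolding \<Psi>_def by auto
    fix y assume "y \<in> \<Psi> N"
    then obtain y0 where y: "y0 \<in> N" "y = I +> y0" unfolding \<Psi>_def by auto
    then show "add ?M x y \<in> \<Psi> N" using addM[OF N(7) N(7), of x0 y0] N(3)[of x0 y0] x unfolding \<Psi>_def by auto
  qed
  \<comment> \<open>The bounds {} and UNIV admit every submodule, so \<open>module_length\<close>
    becomes an instance of \<open>chain_len\<close>.\<close>
  have "module_length R ?M = chain_len (\<lambda>N. submodule N R ?M) {} UNIV"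
    unfolding module_length_def chain_len_def by simp
  also have "\<dots> = colen I"
  proof (rule antisym)
    show "chain_len (\<lambda>N. submodule N R ?M) {} UNIV \<le> colen I"
    proof (rule chain_len_transfer[where \<Phi> = \<Phi>])
      fix N N' assume "submodule N R ?M" "submodule N' R ?M" "N \<subset> N'"
      then obtain y where y: "y \<in> N'" "y \<notin> N" by blast
      have "N' \<subseteq> carrier ?M" using \<open>submodule N' R ?M\<close> unfolding sub_iff by simp
      then obtain x where "x \<in> carrier R" "y = I +> x" using y(1) carr by auto
      then have "x \<in> \<Phi> N'" "x \<notin> \<Phi> N" using y by (simp_all add: \<Phi>_def)
      moreover have "\<Phi> N \<subseteq> \<Phi> N'" using \<open>N \<subset> N'\<close> by (auto simp: \<Phi>_def)
      ultimately show "\<Phi> N \<subset> \<Phi> N'" by blast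
    qed (use \<Phi> in auto)
    show "colen I \<le> chain_len (\<lambda>N. submodule N R ?M) {} UNIV"
    proof (rule chain_len_transfer[where \<Phi> = \<Psi>])
      fix N N' assume N: "smod (carrier R) N" "I \<subseteq> N" "smod (carrier R) N'" "N' \<subseteq> carrier R" "N \<subset> N'"
      then obtain y where y: "y \<in> N'" "y \<notin> N" by blast
      have "I +> y \<notin> \<Psi> N"
      proof
        assume "I +> y \<in> \<Psi> N"
        then obtain x where x: "x \<in> N" "I +> y = I +> x" unfolding \<Psi>_def by auto
        have c: "x \<in> carrier R" "y \<in> carrier R" using x y N by auto
        then have "y \<ominus> x \<in> N" using coset_eq_iff[OF I c(2,1)] x N by auto
        then have "(y \<ominus> x) \<oplus> x \<in> N" using smodD(3)[OF N(1) _ x(1)] by auto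
        moreover have "(y \<ominus> x) \<oplus> x = y" using c by (simp add: a_minus_def a_assoc l_neg)
        ultimately show False using y by simp
      qed
      moreover have "I +> y \<in> \<Psi> N'" using y unfolding \<Psi>_def by blast
      moreover have "\<Psi> N \<subseteq> \<Psi> N'" using N unfolding \<Psi>_def by auto
      ultimately show "\<Psi> N \<subset> \<Psi> N'" by blast
    qed (use \<Psi> in auto)
  qed
  finally show ?thesis unfolding quot_length_def by simp
qed

lemma ideal_subset_carrier: "ideal I R \<Longrightarrow> I \<subseteq> carrier R"
  unfolding ideal_iff_smod by (rule smodD(1))

lemma ideal_colon:
  assumes "ideal C R" "a \<in> carrier R"
  shows "ideal {r \<in> carrier R. a \<otimes> r \<in> C} R"
  unfolding ideal_iff_smod smod_def
proof (intro conjI ballI)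
  note C = smodD[OF assms(1)[unfolded ideal_iff_smod]]
  show "\<zero> \<in> {r \<in> carrier R. a \<otimes> r \<in> C}" using assms C by auto
  fix x assume x: "x \<in> {r \<in> carrier R. a \<otimes> r \<in> C}"
  then show "\<ominus> x \<in> {r \<in> carrier R. a \<otimes> r \<in> C}" using assms C(4)[of "a \<otimes> x"] by (simp add: r_minus)
  show "s \<otimes> x \<in> {r \<in> carrier R. a \<otimes> r \<in> C}" if "s \<in> carrier R" for s
    using x assms that C(6)[of s "a \<otimes> x"] by (simp add: m_lcomm)
  show "x \<oplus> y \<in> {r \<in> carrier R. a \<otimes> r \<in> C}" if "y \<in> {r \<in> carrier R. a \<otimes> r \<in> C}" for y
    using x assms that C(3)[of "a \<otimes> x" "a \<otimes> y"] by (simp add: r_distr)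
qed auto

lemma Idl_mono: "A \<subseteq> B \<Longrightarrow> B \<subseteq> carrier R \<Longrightarrow> Idl A \<subseteq> Idl B"
  by (rule genideal_minimal[OF genideal_ideal]) (use genideal_self[of B] in auto)

lemma Idl_add_principal:
  assumes A: "ideal A R" and a: "a \<in> carrier R"
  shows "Idl (insert a A) = A <+>\<^bsub>R\<^esub> (\<lambda>x. a \<otimes> x) ` carrier R"
proof -
  have Ac: "A \<subseteq> carrier R" using A by (simp add: ideal_iff_smod smodD)
  have P: "ideal ((\<lambda>x. a \<otimes> x) ` carrier R) R"
  proof -
    have "PIdl a = (\<lambda>x. a \<otimes> x) ` carrier R" unfolding cgenideal_def using a m_comm by auto
    then show ?thesis using cgenideal_ideal[OF a] by simp
  qed
  have S: "ideal (A <+>\<^bsub>R\<^esub> (\<lambda>x. a \<otimes> x) ` carrier R) R" by (rule add_ideals[OF A P])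
  have up: "A \<subseteq> A <+>\<^bsub>R\<^esub> (\<lambda>x. a \<otimes> x) ` carrier R" "(\<lambda>x. a \<otimes> x) ` carrier R \<subseteq> A <+>\<^bsub>R\<^esub> (\<lambda>x. a \<otimes> x) ` carrier R"
    using set_add_upper A P by (auto simp: ideal_iff_smod)
  have G: "ideal (Idl (insert a A)) R" by (rule genideal_ideal) (use Ac a in auto)
  have sG: "insert a A \<subseteq> Idl (insert a A)" by (rule genideal_self) (use Ac a in auto)
  show ?thesis
  proof
    have "a \<in> (\<lambda>x. a \<otimes> x) ` carrier R" using a by (intro image_eqI[of _ _ \<one>]) auto
    then show "Idl (insert a A) \<subseteq> A <+>\<^bsub>R\<^esub> (\<lambda>x. a \<otimes> x) ` carrier R"
      using up by (intro genideal_minimal S) auto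
    show "A <+>\<^bsub>R\<^esub> (\<lambda>x. a \<otimes> x) ` carrier R \<subseteq> Idl (insert a A)"
      by (rule set_add_least[OF G[unfolded ideal_iff_smod]])
        (use sG ideal.I_r_closed[OF G] in auto)
  qed
qed

end

section \<open>Lattice points and downsets\<close>

abbreviation ladd :: "nat list \<Rightarrow> nat list \<Rightarrow> nat list"
  where "ladd u v \<equiv> map2 (+) u v"

abbreviation lle :: "nat list \<Rightarrow> nat list \<Rightarrow> bool"
  where "lle \<equiv> list_all2 (\<le>)"

definition exps :: "nat \<Rightarrow> nat \<Rightarrow> nat list set"
  where "exps k n = {u. length u = k \<and> sum_list u = n}"

lemma finite_exps: "finite (exps k n)"
proof (rule finite_subset)
  show "exps k n \<subseteq> {u. set u \<subseteq> {..n} \<and> length u = k}"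
    unfolding exps_def using member_le_sum_list by fastforce
  show "finite {u. set u \<subseteq> {..n} \<and> length u = k}" by (rule finite_lists_length_eq) simp
qed

lemma sum_list_ladd: "length u = length v \<Longrightarrow> sum_list (ladd u v) = sum_list u + sum_list v"
  by (induction u v rule: list_induct2) auto

lemma lle_iff_ladd: "lle u v \<longleftrightarrow> (\<exists>w. length w = length u \<and> v = ladd u w)"
proof
  show "lle u v \<Longrightarrow> \<exists>w. length w = length u \<and> v = ladd u w"
  proof (induction rule: list_all2_induct)
    case (Cons x xs y ys)
    then obtain w where "length w = length xs" "ys = ladd xs w" by auto
    then show ?case using Cons by (intro exI[of _ "(y - x) # w"]) auto
  qed auto
  show "\<exists>w. length w = length u \<and> v = ladd u w \<Longrightarrow> lle u v"
    by (auto simp: list_all2_conv_all_nth)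
qed

lemma ladd_less_mono:
  "length u = length v \<Longrightarrow> length w = length v \<Longrightarrow> u < v \<Longrightarrow> ladd u w < ladd v w"
proof (induction u v arbitrary: w rule: list_induct2)
  case (Cons x xs y ys)
  then obtain z zs where "w = z # zs" by (cases w) auto
  then show ?case using Cons by auto
qed simp

lemma exps_0: "exps 0 n = (if n = 0 then {[]} else {})"
  unfolding exps_def by auto

lemma exps_Suc: "exps (Suc k) n = (\<Union>b\<le>n. (\<lambda>w. b # w) ` exps k (n - b))"
proof -
  have "u \<in> exps (Suc k) n \<longleftrightarrow> u \<in> (\<Union>b\<le>n. (\<lambda>w. b # w) ` exps k (n - b))" for u
    unfolding exps_def by (cases u) (auto simp: image_iff)
  then show ?thesis by blast
qed

lemma sum_exps_Suc: "(\<Sum>u\<in>exps (Suc k) n. g u) = (\<Sum>b\<le>n. \<Sum>w\<in>exps k (n - b). g (b # w))"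
proof -
  have "(\<Sum>u\<in>exps (Suc k) n. g u) = (\<Sum>b\<le>n. sum g ((\<lambda>w. b # w) ` exps k (n - b)))"
    unfolding exps_Suc by (rule sum.UNION_disjoint) (auto simp: finite_exps)
  also have "\<dots> = (\<Sum>b\<le>n. \<Sum>w\<in>exps k (n - b). g (b # w))"
    by (simp add: sum.reindex inj_on_def)
  finally show ?thesis .
qed

definition expsl :: "nat \<Rightarrow> nat \<Rightarrow> nat list set"
  where "expsl k n = {u. length u = k \<and> sum_list u < n}"

lemma expsl_UN: "expsl k n = (\<Union>i<n. exps k i)"
  unfolding expsl_def exps_def by auto

lemma finite_expsl: "finite (expsl k n)"
  unfolding expsl_UN by (simp add: finite_exps)

lemma sum_expsl: "(\<Sum>u\<in>expsl k n. g u) = (\<Sum>i<n. \<Sum>u\<in>exps k i. g u)"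
  unfolding expsl_UN by (rule sum.UNION_disjoint) (use finite_exps in \<open>auto simp: exps_def\<close>)

definition decr :: "nat \<Rightarrow> (nat list \<Rightarrow> nat) \<Rightarrow> bool"
  where "decr k g \<longleftrightarrow> (\<forall>u v. length u = k \<longrightarrow> lle u v \<longrightarrow> g v \<le> g u)"

text \<open>Splitting off the first coordinate \<open>b\<close>, write the factor \<open>M\<close> as \<open>(M - b) + b\<close>; the first
  part is the induction hypothesis, and monotonicity in \<open>b\<close> bounds the second.\<close>

lemma decr_layer: "decr k g \<Longrightarrow> M * (\<Sum>u\<in>exps k M. g u) \<le> k * (\<Sum>u\<in>expsl k M. g u)"
proof (induction k arbitrary: g M)
  case 0
  then show ?case by (simp add: exps_0)
next
  case (Suc k)
  define h where "h b i = (\<Sum>w\<in>exps k i. g (b # w))" for b i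
  have dec: "decr k (\<lambda>w. g (b # w))" for b
    using Suc.prems unfolding decr_def by (auto simp: list_all2_Cons1)
  have IH: "i * h b i \<le> k * (\<Sum>j<i. h b j)" for b i
    using Suc.IH[OF dec, of i b] by (simp add: h_def sum_expsl)
  have mono: "h b i \<le> h b' i" if "b' \<le> b" for b b' i
    unfolding h_def
  proof (rule sum_mono)
    fix w assume "w \<in> exps k i"
    then show "g (b # w) \<le> g (b' # w)"
      using Suc.prems that unfolding decr_def exps_def by (auto simp: list_all2_refl)
  qed
  \<comment> \<open>The simplex is sorted by the first coordinate b; the remaining coordinates have
    degree i with b + i < M.\<close>
  have G: "(\<Sum>u\<in>expsl (Suc k) M. g u) = (\<Sum>b<M. \<Sum>i<M - b. h b i)"
  proof -
    have "(\<Sum>u\<in>expsl (Suc k) M. g u) = (\<Sum>n<M. \<Sum>b\<le>n. h b (n - b))"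
      by (simp add: sum_expsl sum_exps_Suc h_def)
    also have "\<dots> = (\<Sum>(n, b)\<in>(SIGMA n:{..<M}. {..n}). h b (n - b))"
      by (subst sum.Sigma) auto
    also have "\<dots> = (\<Sum>(b, i)\<in>(SIGMA b:{..<M}. {..<M - b}). h b i)"
      by (rule sum.reindex_bij_witness[of _ "\<lambda>(b, i). (b + i, b)" "\<lambda>(n, b). (b, n - b)"]) auto
    also have "\<dots> = (\<Sum>b<M. \<Sum>i<M - b. h b i)"
      by (subst sum.Sigma) auto
    finally show ?thesis .
  qed
  have "M * (\<Sum>u\<in>exps (Suc k) M. g u) = (\<Sum>b\<le>M. M * h b (M - b))"
    by (simp add: sum_exps_Suc h_def sum_distrib_left)
  also have "\<dots> = (\<Sum>b\<le>M. (M - b) * h b (M - b)) + (\<Sum>b\<le>M. b * h b (M - b))"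
    unfolding sum.distrib[symmetric] by (intro sum.cong) (auto simp flip: add_mult_distrib)
  also have "(\<Sum>b\<le>M. (M - b) * h b (M - b)) \<le> (\<Sum>b\<le>M. k * (\<Sum>j<M - b. h b j))"
    by (intro sum_mono IH)
  also have "\<dots> = k * (\<Sum>b<M. \<Sum>i<M - b. h b i)"
    by (simp add: sum_distrib_left flip: lessThan_Suc_atMost)
  also have "(\<Sum>b\<le>M. b * h b (M - b)) \<le> (\<Sum>b\<le>M. \<Sum>b'<b. h b' (M - b))"
  proof (rule sum_mono)
    fix b assume "b \<in> {..M}"
    have "(\<Sum>b'<b. h b (M - b)) \<le> (\<Sum>b'<b. h b' (M - b))" by (intro sum_mono mono) auto
    then show "b * h b (M - b) \<le> (\<Sum>b'<b. h b' (M - b))" by simp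
  qed
  also have "\<dots> = (\<Sum>(b, b')\<in>(SIGMA b:{..M}. {..<b}). h b' (M - b))"
    by (subst sum.Sigma) auto
  \<comment> \<open>With b' as first coordinate and M - b as remaining degree this is the simplex
    sum once more; together with the k copies from the induction hypothesis there are k + 1.\<close>
  also have "\<dots> = (\<Sum>(b, i)\<in>(SIGMA b:{..<M}. {..<M - b}). h b i)"
    by (rule sum.reindex_bij_witness[of _ "\<lambda>(b, i). (M - i, b)" "\<lambda>(b, b'). (b', M - b)"]) auto
  also have "\<dots> = (\<Sum>b<M. \<Sum>i<M - b. h b i)"
    by (subst sum.Sigma) auto
  finally show ?case by (simp add: G)
qed

text \<open>The layer estimate bounds the quotient of consecutive simplex sums by 1 + k/M, and
  Bernoulli's inequality bounds this by ((M + 1)/M)^k. Hence the sum divided by M^k does not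
  increase.\<close>

lemma decr_growth:
  assumes g: "decr k g" and pos: "0 < M1" and M: "M1 \<le> M2"
  shows "(\<Sum>u\<in>expsl k M2. g u) * M1 ^ k \<le> (\<Sum>u\<in>expsl k M1. g u) * M2 ^ k"
  using M
proof (induction rule: dec_induct)
  case (step M)
  define G where "G M = (\<Sum>u\<in>expsl k M. g u)" for M
  have False: "M \<noteq> 0" using step pos by simp
  show ?case
  proof -
    have bern: "(real M + k) * real M ^ k \<le> real M * (real M + 1) ^ k"
    proof -
      have "1 + real k * (1 / real M) \<le> (1 + 1 / real M) ^ k" by (rule Bernoulli_inequality, rule order_trans[of _ 0]) simp_all
      then have le: "(1 + real k * (1 / real M)) * real M ^ Suc k \<le> (1 + 1 / real M) ^ k * real M ^ Suc k"
        by (intro mult_right_mono) auto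
      have "(real M + k) * real M ^ k = (1 + real k * (1 / real M)) * real M ^ Suc k"
        using False by (simp add: field_simps)
      also note le
      also have "(1 + 1 / real M) ^ k * real M ^ Suc k = real M * ((1 + 1 / real M) * real M) ^ k"
        by (simp add: power_mult_distrib)
      also have "(1 + 1 / real M) * real M = real M + 1" using False by (simp add: field_simps)
      finally show ?thesis .
    qed
    have "G (Suc M) = G M + (\<Sum>u\<in>exps k M. g u)" by (simp add: G_def sum_expsl)
    then have "M * G (Suc M) \<le> (M + k) * G M"
      using decr_layer[OF g, of M] by (simp add: G_def algebra_simps)
    then have "real M * real (G (Suc M)) \<le> (real M + k) * real (G M)"
      by (metis of_nat_add of_nat_le_iff of_nat_mult)
    then have "real M * real (G (Suc M)) * real M ^ k \<le> (real M + k) * real (G M) * real M ^ k"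
      by (rule mult_right_mono) simp
    also have "\<dots> \<le> real M * (real M + 1) ^ k * real (G M)"
      using mult_right_mono[OF bern, of "real (G M)"] by (simp add: ac_simps)
    finally have "real (G (Suc M)) * real M ^ k \<le> (real M + 1) ^ k * real (G M)"
      using False by simp
    then have s: "G (Suc M) * M ^ k \<le> Suc M ^ k * G M"
      by (metis (no_types, lifting) of_nat_Suc of_nat_le_iff of_nat_mult of_nat_power add.commute)
    have "(G (Suc M) * M1 ^ k) * M ^ k = (G (Suc M) * M ^ k) * M1 ^ k" by simp
    also have "\<dots> \<le> (Suc M ^ k * G M) * M1 ^ k" by (intro mult_right_mono s) simp
    also have "\<dots> = Suc M ^ k * (G M * M1 ^ k)" by simp
    also have "\<dots> \<le> Suc M ^ k * (G M1 * M ^ k)" using step.IH by (intro mult_left_mono) (auto simp: G_def)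
    also have "\<dots> = (G M1 * Suc M ^ k) * M ^ k" by simp
    finally show ?thesis using False by (simp add: G_def)
  qed
qed simp

lemma card_expsl_le: "card (expsl k M) \<le> M ^ k"
proof -
  have "expsl k M \<subseteq> {u. set u \<subseteq> {..<M} \<and> length u = k}"
    unfolding expsl_def using member_le_sum_list by fastforce
  then have "card (expsl k M) \<le> card {u. set u \<subseteq> {..<M} \<and> length u = k}"
    by (intro card_mono finite_lists_length_eq) auto
  then show ?thesis by (simp add: card_lists_length_eq)
qed

lemma card_expsl_ge: "M ^ k \<le> card (expsl k (k * M + 1))"
proof -
  have "{u. set u \<subseteq> {..<M} \<and> length u = k} \<subseteq> expsl k (k * M + 1)"
  proof
    fix u assume u: "u \<in> {u. set u \<subseteq> {..<M} \<and> length u = k}"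
    have "sum_list u \<le> length u * M" if "set u \<subseteq> {..<M}" for u using that by (induction u) auto
    then show "u \<in> expsl k (k * M + 1)" using u by (auto simp: expsl_def less_Suc_eq_le)
  qed
  then have "card {u. set u \<subseteq> {..<M} \<and> length u = k} \<le> card (expsl k (k * M + 1))"
    by (intro card_mono finite_expsl)
  then show ?thesis by (simp add: card_lists_length_eq)
qed

text \<open>The first entry is determined by the remaining k - 1. For k = 0 the truncated exponent
  gives the bound 1, which still holds.\<close>

lemma card_exps_le: "card (exps k n) \<le> (n + 1) ^ (k - 1)"
proof (cases k)
  case 0
  then show ?thesis by (simp add: exps_0)
next
  case (Suc j)
  have "inj_on tl (exps k n)"
  proof (rule inj_onI)
    fix u v assume "u \<in> exps k n" "v \<in> exps k n" "tl u = tl v"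
    then show "u = v" using Suc unfolding exps_def by (cases u; cases v) auto
  qed
  moreover have "tl ` exps k n \<subseteq> {u. set u \<subseteq> {..<n + 1} \<and> length u = j}"
  proof
    fix w assume "w \<in> tl ` exps k n"
    then obtain b where "b # w \<in> exps k n" using Suc unfolding exps_def by (auto simp: length_Suc_conv)
    then show "w \<in> {u. set u \<subseteq> {..<n + 1} \<and> length u = j}"
      using Suc member_le_sum_list[of _ w] unfolding exps_def by fastforce
  qed
  ultimately have "card (exps k n) \<le> card {u. set u \<subseteq> {..<n + 1} \<and> length u = j}"
    by (intro card_inj_on_le finite_lists_length_eq) auto
  then show ?thesis using Suc by (simp add: card_lists_length_eq)
qed

text \<open>The case n = 0 is singled out because for k = 0 truncated subtraction would count 1 in
  the empty set.\<close>

lemma card_expsl_eq: "card (expsl k n) = (if n = 0 then 0 else (n + k - 1) choose k)"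
proof (induction n)
  case 0
  then show ?case by (simp add: expsl_def)
next
  case (Suc n)
  have "card (expsl k (Suc n)) = card (expsl k n) + card (exps k n)"
    using sum_expsl[of "\<lambda>_. 1::nat" k "Suc n"] sum_expsl[of "\<lambda>_. 1::nat" k n] by simp
  moreover have "card (exps k n) = (n + k - 1) choose n"
    unfolding exps_def by (rule card_length_sum_list)
  moreover have "(n + k - 1 choose k) + (n + k - 1 choose n) = (n + k choose k)" if "n > 0" "k > 0"
  proof -
    have "(n + k - 1 choose n) = (n + k - 1 choose (k - 1))"
      using binomial_symmetric[of n "n + k - 1"] that by auto
    moreover have "(n + k choose k) = (n + k - 1 choose k) + (n + k - 1 choose (k - 1))"
      using choose_reduce_nat[of "n + k" k] that by simp
    ultimately show ?thesis by simp
  qed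
  ultimately show ?case using Suc by (cases "n = 0"; cases "k = 0") auto
qed

text \<open>Dickson's lemma in sequence form, obtained by refining a subsequence one coordinate at a
  time.\<close>

lemma dickson_subseq:
  fixes s :: "nat \<Rightarrow> nat list"
  assumes "\<And>n. length (s n) = k"
  shows "\<exists>f::nat \<Rightarrow> nat. strict_mono f \<and> (\<forall>i j. i \<le> j \<longrightarrow> lle (s (f i)) (s (f j)))"
  using assms
proof (induction k arbitrary: s)
  case 0
  have "s n = []" for n using 0[of n] by simp
  then show ?case by (auto intro: exI[of _ "\<lambda>n. n"] simp: strict_mono_def)
next
  case (Suc k)
  obtain f :: "nat \<Rightarrow> nat" where f: "strict_mono f" "\<forall>i j. i \<le> j \<longrightarrow> lle (tl (s (f i))) (tl (s (f j)))"
    using Suc.IH[of "\<lambda>n. tl (s n)"] Suc.prems by auto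
  \<comment> \<open>A decreasing sequence of naturals reaches its minimum and is constant from there
    on.\<close>
  have inc: "\<exists>g::nat \<Rightarrow> nat. strict_mono g \<and> (\<forall>i j. i \<le> j \<longrightarrow> h (g i) \<le> h (g j))" for h :: "nat \<Rightarrow> nat"
  proof -
    obtain g :: "nat \<Rightarrow> nat" where g: "strict_mono g" "monoseq (\<lambda>n. h (g n))" using seq_monosub by blast
    show ?thesis
    proof (cases "\<forall>m n. m \<le> n \<longrightarrow> h (g m) \<le> h (g n)")
      case True
      then show ?thesis using g by blast
    next
      case False
      then have dec: "\<forall>m n. m \<le> n \<longrightarrow> h (g n) \<le> h (g m)" using g unfolding monoseq_def by auto
      define m where "m = (LEAST x. x \<in> range (\<lambda>n. h (g n)))"
      have "m \<in> range (\<lambda>n. h (g n))" unfolding m_def by (rule LeastI[of _ "h (g 0)"]) auto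
      then obtain N where N: "h (g N) = m" by auto
      have ge: "m \<le> h (g n)" for n unfolding m_def by (rule Least_le) auto
      have "h (g (N + i)) = m" for i using dec N ge[of "N + i"] by (metis le_add1 le_antisym)
      then show ?thesis
        using g by (intro exI[of _ "\<lambda>i. g (N + i)"]) (auto simp: strict_mono_def)
    qed
  qed
  obtain g :: "nat \<Rightarrow> nat" where g: "strict_mono g" "\<forall>i j. i \<le> j \<longrightarrow> hd (s (f (g i))) \<le> hd (s (f (g j)))"
    using inc[of "\<lambda>n. hd (s (f n))"] by auto
  have "lle (s (f (g i))) (s (f (g j)))" if "i \<le> j" for i j
  proof -
    have "g i \<le> g j" using g(1) that by (simp add: strict_mono_less_eq)
    then have "lle (tl (s (f (g i)))) (tl (s (f (g j))))" using f by blast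
    moreover have "s n = hd (s n) # tl (s n)" for n using Suc.prems[of n] by (cases "s n") auto
    ultimately show ?thesis using g(2) that by (metis list_all2_Cons)
  qed
  then show ?case using f(1) g(1) by (intro exI[of _ "\<lambda>i. f (g i)"]) (auto simp: strict_mono_def)
qed

definition downset :: "nat \<Rightarrow> nat list set \<Rightarrow> bool"
  where "downset k D \<longleftrightarrow> (\<forall>v\<in>D. length v = k) \<and> (\<forall>u v. v \<in> D \<longrightarrow> lle u v \<longrightarrow> u \<in> D)"

text \<open>Otherwise points would leave the chain infinitely often. By Dickson's lemma an earlier
  such point lies below a later one, which still belongs to a set that the earlier one has left,
  against downward closure.\<close>

lemma downset_stable:
  assumes D: "\<And>j. downset k (D j)" and dec: "\<And>j. D (Suc j) \<subseteq> D j"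
  shows "\<exists>s. \<forall>j\<ge>s. D j = D s"
proof (rule ccontr)
  assume "\<not> ?thesis"
  then have n: "\<exists>j\<ge>s. D j \<noteq> D s" for s by blast
  have anti: "D j \<subseteq> D i" if "i \<le> j" for i j using dec that by (rule lift_Suc_antimono_le)
  have "\<exists>t u. s < t \<and> u \<in> D s \<and> u \<notin> D t" for s
    using n[of s] anti by (metis le_neq_implies_less subsetI subset_antisym)
  then obtain T U where TU: "\<And>s. s < T s" "\<And>s. U s \<in> D s" "\<And>s. U s \<notin> D (T s)" by metis
  \<comment> \<open>Iterating \<open>T\<close> makes \<open>U (r n)\<close> absent from
    \<open>D (r (Suc n))\<close>, hence from all later sets.\<close>
  define r where "r n = (T ^^ n) 0" for n
  have rm: "strict_mono r" by (simp add: strict_mono_Suc_iff r_def TU(1))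
  have "length (U (r n)) = k" for n using D TU(2) unfolding downset_def by blast
  then obtain f :: "nat \<Rightarrow> nat" where f: "strict_mono f" "\<forall>i j. i \<le> j \<longrightarrow> lle (U (r (f i))) (U (r (f j)))"
    using dickson_subseq[of "\<lambda>n. U (r n)" k] by auto
  have "lle (U (r (f 0))) (U (r (f 1)))" using f by auto
  moreover have "U (r (f 1)) \<in> D (r (Suc (f 0)))"
  proof -
    have "Suc (f 0) \<le> f 1" using f(1) by (simp add: strict_mono_def Suc_leI)
    then have "r (Suc (f 0)) \<le> r (f 1)" using rm by (simp add: strict_mono_less_eq)
    then show ?thesis using anti TU(2) by blast
  qed
  ultimately have "U (r (f 0)) \<in> D (r (Suc (f 0)))" using D unfolding downset_def by blast
  then show False using TU(3)[of "r (f 0)"] by (simp add: r_def)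
qed

text \<open>A copy of N^k inside the lattice, with the other coordinates frozen. Only the shift of
  the degree and monotonicity are recorded, because these suffice for summing decreasing functions
  by degree.\<close>

definition cylinder :: "nat \<Rightarrow> nat \<Rightarrow> nat list set \<Rightarrow> bool"
  where "cylinder k s X \<longleftrightarrow> (\<exists>\<gamma>. bij_betw \<gamma> {w. length w = k} X \<and>
    (\<forall>w. length w = k \<longrightarrow> sum_list (\<gamma> w) = s + sum_list w) \<and>
    (\<forall>w w'. length w = k \<longrightarrow> lle w w' \<longrightarrow> lle (\<gamma> w) (\<gamma> w')))"

lemma cylinder_Cons: "cylinder k s X \<Longrightarrow> cylinder k (j + s) ((#) j ` X)"
  unfolding cylinder_def
proof (elim exE conjE)
  fix \<gamma> assume \<gamma>: "bij_betw \<gamma> {w. length w = k} X" "\<forall>w. length w = k \<longrightarrow> sum_list (\<gamma> w) = s + sum_list w"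
    "\<forall>w w'. length w = k \<longrightarrow> lle w w' \<longrightarrow> lle (\<gamma> w) (\<gamma> w')"
  have "bij_betw ((#) j) X ((#) j ` X)" by (auto simp: bij_betw_def inj_on_def)
  then have "bij_betw ((#) j \<circ> \<gamma>) {w. length w = k} ((#) j ` X)" using \<gamma>(1) by (rule bij_betw_trans[rotated])
  then show "\<exists>\<gamma>. bij_betw \<gamma> {w. length w = k} ((#) j ` X) \<and>
    (\<forall>w. length w = k \<longrightarrow> sum_list (\<gamma> w) = j + s + sum_list w) \<and>
    (\<forall>w w'. length w = k \<longrightarrow> lle w w' \<longrightarrow> lle (\<gamma> w) (\<gamma> w'))"
    using \<gamma> by (intro exI[of _ "(#) j \<circ> \<gamma>"]) auto
qed

lemma cylinder_ray: "cylinder k s X \<Longrightarrow> cylinder (Suc k) (a + s) {b # x | b x. a \<le> b \<and> x \<in> X}"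
  unfolding cylinder_def
proof (elim exE conjE)
  fix \<gamma> assume \<gamma>: "bij_betw \<gamma> {w. length w = k} X" "\<forall>w. length w = k \<longrightarrow> sum_list (\<gamma> w) = s + sum_list w"
    "\<forall>w w'. length w = k \<longrightarrow> lle w w' \<longrightarrow> lle (\<gamma> w) (\<gamma> w')"
  define \<delta> where "\<delta> w = (a + hd w) # \<gamma> (tl w)" for w
  have "bij_betw \<delta> {w. length w = Suc k} {b # x | b x. a \<le> b \<and> x \<in> X}"
    unfolding bij_betw_def
  proof
    show "inj_on \<delta> {w. length w = Suc k}"
    proof (rule inj_onI)
      fix v w assume "v \<in> {w. length w = Suc k}" "w \<in> {w. length w = Suc k}" "\<delta> v = \<delta> w"
      then show "v = w" using bij_betw_imp_inj_on[OF \<gamma>(1)] unfolding \<delta>_def inj_on_def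
        by (cases v; cases w) auto
    qed
    show "\<delta> ` {w. length w = Suc k} = {b # x | b x. a \<le> b \<and> x \<in> X}"
    proof (intro equalityI subsetI)
      fix y assume "y \<in> \<delta> ` {w. length w = Suc k}"
      then show "y \<in> {b # x | b x. a \<le> b \<and> x \<in> X}"
        using bij_betw_imp_surj_on[OF \<gamma>(1)] by (auto simp: \<delta>_def)
    next
      fix y assume "y \<in> {b # x | b x. a \<le> b \<and> x \<in> X}"
      then obtain b x where y: "y = b # x" "a \<le> b" "x \<in> X" by blast
      then obtain w where "length w = k" "x = \<gamma> w" using bij_betw_imp_surj_on[OF \<gamma>(1)] by auto
      then show "y \<in> \<delta> ` {w. length w = Suc k}" using y
        by (intro image_eqI[of _ _ "(b - a) # w"]) (auto simp: \<delta>_def)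
    qed
  qed
  moreover have "\<forall>w. length w = Suc k \<longrightarrow> sum_list (\<delta> w) = a + s + sum_list w"
    using \<gamma>(2) by (auto simp: \<delta>_def length_Suc_conv)
  moreover have "\<forall>w w'. length w = Suc k \<longrightarrow> lle w w' \<longrightarrow> lle (\<delta> w) (\<delta> w')"
    using \<gamma>(3) by (auto simp: \<delta>_def length_Suc_conv list_all2_Cons1)
  ultimately show "\<exists>\<gamma>. bij_betw \<gamma> {w. length w = Suc k} {b # x | b x. a \<le> b \<and> x \<in> X} \<and>
    (\<forall>w. length w = Suc k \<longrightarrow> sum_list (\<gamma> w) = a + s + sum_list w) \<and>
    (\<forall>w w'. length w = Suc k \<longrightarrow> lle w w' \<longrightarrow> lle (\<gamma> w) (\<gamma> w'))"
    by blast
qed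

text \<open>A Stanley decomposition of the standard monomials, by induction on the number of
  variables. The slices at first coordinate j shrink as j grows, so they are constant from some s
  on; finitely many slices and a ray over the slice at s make up D.\<close>

lemma downset_cylinders:
  "downset m D \<Longrightarrow> \<exists>\<X>. finite \<X> \<and> disjoint \<X> \<and> \<Union>\<X> = D \<and> (\<forall>X\<in>\<X>. \<exists>k s. cylinder k s X)"
proof (induction m arbitrary: D)
  case 0
  show ?case
  proof (cases "D = {}")
    case True
    then show ?thesis by (intro exI[of _ "{}"]) (auto simp: disjoint_def)
  next
    case False
    then have "D = {[]}" using 0 unfolding downset_def by auto
    moreover have "cylinder 0 0 {[]}"
      unfolding cylinder_def by (intro exI[of _ id]) (auto simp: bij_betw_def)
    ultimately show ?thesis by (intro exI[of _ "{{[]}}"]) (auto simp: disjoint_def)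
  qed
next
  case (Suc m)
  define E where "E j = {u. j # u \<in> D}" for j
  have E: "downset m (E j)" for j
    using Suc.prems unfolding downset_def E_def by (auto simp: list_all2_Cons1)
  have dec: "E (Suc j) \<subseteq> E j" for j
  proof
    fix u assume "u \<in> E (Suc j)"
    then have "Suc j # u \<in> D" by (simp add: E_def)
    moreover have "lle (j # u) (Suc j # u)" by (auto simp: list_all2_refl)
    ultimately show "u \<in> E j" using Suc.prems unfolding downset_def E_def by blast
  qed
  obtain s where s: "\<forall>j\<ge>s. E j = E s" using downset_stable[of m E, OF E dec] by blast
  have "\<forall>j. \<exists>\<X>. finite \<X> \<and> disjoint \<X> \<and> \<Union>\<X> = E j \<and> (\<forall>X\<in>\<X>. \<exists>k s. cylinder k s X)"
    using Suc.IH[OF E] by blast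
  then obtain \<X> where \<X>: "\<And>j. finite (\<X> j)" "\<And>j. disjoint (\<X> j)" "\<And>j. \<Union>(\<X> j) = E j"
    "\<And>j X. X \<in> \<X> j \<Longrightarrow> \<exists>k s. cylinder k s X"
    by metis
  define ray where "ray X = {b # x | b x. s \<le> b \<and> x \<in> X}" for X
  define \<Y> where "\<Y> = (\<Union>j<s. (\<lambda>X. (#) j ` X) ` \<X> j) \<union> ray ` \<X> s"
  have "finite \<Y>" unfolding \<Y>_def using \<X>(1) by auto
  moreover have "disjoint \<Y>"
  proof (rule disjointI)
    fix A B assume AB: "A \<in> \<Y>" "B \<in> \<Y>" "A \<noteq> B"
    have int: "X = Y" if "X \<in> \<X> j" "Y \<in> \<X> j" "x \<in> X" "x \<in> Y" for X Y x j
      using \<X>(2)[of j] that unfolding disjoint_def by blast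
    from AB(1) consider (a) j X where "j < s" "X \<in> \<X> j" "A = (#) j ` X" | (b) X where "X \<in> \<X> s" "A = ray X"
      unfolding \<Y>_def by blast
    note cA = this
    from AB(2) consider (a) j X where "j < s" "X \<in> \<X> j" "B = (#) j ` X" | (b) X where "X \<in> \<X> s" "B = ray X"
      unfolding \<Y>_def by blast
    note cB = this
    show "A \<inter> B = {}"
      using cA
    proof cases
      case A: (a j X)
      show ?thesis using cB
      proof cases
        case (a j' Y)
        then show ?thesis using A int[of X j Y] AB(3) by auto
      next
        case (b Y)
        then show ?thesis using A by (auto simp: ray_def)
      qed
    next
      case A: (b X)
      show ?thesis using cB
      proof cases
        case (a j' Y)
        then show ?thesis using A by (auto simp: ray_def)
      next
        case (b Y)
        have "X \<inter> Y = {}" using A b int[of X s Y] AB(3) by auto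
        then show ?thesis using A b by (auto simp: ray_def)
      qed
    qed
  qed
  moreover have "\<Union>\<Y> = D"
  proof (intro equalityI subsetI)
    fix u assume "u \<in> \<Union>\<Y>"
    then consider (a) j X x where "X \<in> \<X> j" "x \<in> X" "u = j # x" | (b) X b x where "X \<in> \<X> s" "s \<le> b" "x \<in> X" "u = b # x"
      unfolding \<Y>_def ray_def by blast
    then show "u \<in> D"
    proof cases
      case a
      then have "x \<in> E j" using \<X>(3) by blast
      then show ?thesis using a by (simp add: E_def)
    next
      case b
      then have "x \<in> E b" using \<X>(3) s by blast
      then show ?thesis using b by (simp add: E_def)
    qed
  next
    fix u assume u: "u \<in> D"
    then have "length u = Suc m" using Suc.prems unfolding downset_def by blast
    then obtain j x where jx: "u = j # x" by (cases u) auto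
    then have x: "x \<in> E j" using u by (simp add: E_def)
    show "u \<in> \<Union>\<Y>"
    proof (cases "j < s")
      case True
      then obtain X where "X \<in> \<X> j" "x \<in> X" using x \<X>(3) by blast
      then show ?thesis using True jx unfolding \<Y>_def by blast
    next
      case False
      then have "x \<in> E s" using x s by (metis not_less)
      then obtain X where "X \<in> \<X> s" "x \<in> X" using \<X>(3) by blast
      then show ?thesis using False jx unfolding \<Y>_def ray_def by force
    qed
  qed
  moreover have "\<forall>X\<in>\<Y>. \<exists>k s. cylinder k s X"
  proof
    fix X assume "X \<in> \<Y>"
    then consider (a) j Z where "Z \<in> \<X> j" "X = (#) j ` Z" | (b) Z where "Z \<in> \<X> s" "X = ray Z"
      unfolding \<Y>_def by blast
    then show "\<exists>k s. cylinder k s X"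
    proof cases
      case a
      then show ?thesis using \<X>(4) cylinder_Cons by blast
    next
      case b
      then show ?thesis using \<X>(4) cylinder_ray unfolding ray_def by blast
    qed
  qed
  ultimately show ?case by blast
qed

section \<open>Monomials and leading terms\<close>

lemma ladd_commute: "ladd u v = ladd v u"
  by (induction u arbitrary: v) (auto simp: zip_Cons1 split: list.splits)

definition uvec :: "nat \<Rightarrow> nat \<Rightarrow> nat list"
  where "uvec m k = (replicate m 0)[k := 1]"

lemma length_uvec [simp]: "length (uvec m k) = m"
  by (simp add: uvec_def)

lemma sum_uvec: "k < m \<Longrightarrow> sum_list (uvec m k) = 1"
  unfolding uvec_def by (subst sum_list_update) auto

lemma exps_Suc_uvec:
  assumes "u \<in> exps m (Suc n)"
  shows "\<exists>v\<in>exps m n. \<exists>k<m. u = ladd v (uvec m k)"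
proof -
  have u: "length u = m" "sum_list u = Suc n" using assms by (auto simp: exps_def)
  then obtain x where "x \<in> set u" "x \<noteq> 0" using sum_list_eq_0_iff[of u] by auto
  then obtain k where k: "k < m" "u ! k \<noteq> 0" using u by (auto simp: in_set_conv_nth)
  then have "lle (uvec m k) u" using u by (auto simp: list_all2_conv_all_nth uvec_def nth_list_update)
  then obtain v where v: "length v = m" "u = ladd (uvec m k) v" by (auto simp: lle_iff_ladd)
  then have "sum_list v = n" using u(2) sum_list_ladd[of "uvec m k" v] sum_uvec[OF k(1)] by auto
  then show ?thesis using v k ladd_commute[of "uvec m k" v] unfolding exps_def by blast
qed

lemma exps_zero: "exps m 0 = {replicate m 0}"
  unfolding exps_def by (auto simp: replicate_eqI)

text \<open>The successors of u in the graded lexicographic order. Compatibility of this order with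
  addition lets multiplication by a monomial act on the filtration by leading exponents.\<close>

definition above :: "nat list \<Rightarrow> nat list set"
  where "above u = {v. length v = length u \<and>
    (sum_list u < sum_list v \<or> sum_list u = sum_list v \<and> u < v)}"

lemma above_ladd:
  assumes "v \<in> above u" "length w = length u"
  shows "ladd v w \<in> above (ladd u w)"
  using assms ladd_less_mono[of u v w] unfolding above_def by (auto simp: sum_list_ladd)

context cring
begin

lemma power_ideals_set:
  assumes "ideal I R"
  shows ideal_power_0: "ideal_power R I 0 = carrier R"
    and ideal_power_Suc: "ideal_power R I (Suc n) = ideal_power R I n \<cdot> I"
    and ideal_power_ideal: "ideal (ideal_power R I n) R"
    and ideal_power_add: "ideal_power R I (m + n) = ideal_power R I m \<cdot> ideal_power R I n"
    and ideal_power_mult: "ideal_power R (ideal_power R I m) n = ideal_power R I (m * n)"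
proof -
  interpret ISet: comm_monoid "ideals_set R" by (rule ideals_set_is_comm_monoid)
  have I: "I \<in> carrier (ideals_set R)" using assms by (simp add: ideals_set_def)
  have mult: "mult (ideals_set R) = ideal_prod R" and one: "one (ideals_set R) = carrier R"
    by (simp_all add: ideals_set_def)
  show "ideal_power R I 0 = carrier R" using ISet.nat_pow_0[of I] one by simp
  show "ideal_power R I (Suc n) = ideal_power R I n \<cdot> I" using ISet.nat_pow_Suc[of I n] mult by simp
  show "ideal (ideal_power R I n) R" using ISet.nat_pow_closed[OF I, of n] by (simp add: ideals_set_def)
  show "ideal_power R I (m + n) = ideal_power R I m \<cdot> ideal_power R I n"
    using ISet.nat_pow_mult[OF I, of m n] mult by simp
  show "ideal_power R (ideal_power R I m) n = ideal_power R I (m * n)"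
    using ISet.nat_pow_pow[OF I, of m n] .
qed

lemma ideal_prod_least:
  assumes "ideal C R" "\<And>i j. i \<in> I \<Longrightarrow> j \<in> J \<Longrightarrow> i \<otimes> j \<in> C"
  shows "I \<cdot> J \<subseteq> C"
proof
  fix x assume "x \<in> I \<cdot> J"
  then show "x \<in> C"
    by (induction) (use assms smodD(3)[of "carrier R" C] in \<open>auto simp: ideal_iff_smod\<close>)
qed

lemma ideal_prod_mono: "I \<subseteq> I' \<Longrightarrow> J \<subseteq> J' \<Longrightarrow> ideal I' R \<Longrightarrow> ideal J' R \<Longrightarrow> I \<cdot> J \<subseteq> I' \<cdot> J'"
  by (rule ideal_prod_least[OF ideal_prod_is_ideal]) (auto intro: ideal_prod.prod)

lemma ideal_power_mono:
  assumes "ideal I R" "ideal J R" "I \<subseteq> J"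
  shows "ideal_power R I n \<subseteq> ideal_power R J n"
proof (induction n)
  case (Suc n)
  then show ?case using assms
    by (simp only: ideal_power_Suc) (intro ideal_prod_mono ideal_power_ideal)
qed (simp add: assms ideal_power_0)

lemma ideal_power_antimono:
  assumes "ideal I R" "m \<le> n"
  shows "ideal_power R I n \<subseteq> ideal_power R I m"
proof -
  have "ideal_power R I n = ideal_power R I m \<cdot> ideal_power R I (n - m)"
    using ideal_power_add[OF assms(1), of m "n - m"] assms(2) by simp
  then show ?thesis using ideal_prod_inter[of "ideal_power R I m" "ideal_power R I (n - m)"]
    ideal_power_ideal[OF assms(1)] by auto
qed

lemma mult_mem_ideal_power:
  assumes "ideal I R" "x \<in> ideal_power R I m" "y \<in> ideal_power R I n"
  shows "x \<otimes> y \<in> ideal_power R I (m + n)"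
  unfolding ideal_power_add[OF assms(1)] by (rule ideal_prod.prod) (use assms in auto)

lemma ideal_power_1: "ideal I R \<Longrightarrow> ideal_power R I 1 = I"
  using ideal_power_Suc[of I 0] ideal_power_0[of I] ideal_prod_commute[OF oneideal, of I] ideal_prod_one[of I]
  by simp

lemma pow_mem_ideal_power:
  assumes "ideal I R" "x \<in> ideal_power R I t"
  shows "x [^] (n::nat) \<in> ideal_power R I (t * n)"
proof (induction n)
  case 0
  then show ?case using assms ideal_power_0 by simp
next
  case (Suc n)
  then show ?case using mult_mem_ideal_power[OF assms(1) Suc assms(2)] by (simp add: algebra_simps)
qed

text \<open>The second clause truncates to the shorter list, which keeps \<open>mon_closed\<close>
  free of length conditions.\<close>

fun mon :: "'a list \<Rightarrow> nat list \<Rightarrow> 'a"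
  where "mon (x # xs) (k # u) = x [^] k \<otimes> mon xs u"
  | "mon _ _ = \<one>"

lemma mon_closed: "set xs \<subseteq> carrier R \<Longrightarrow> mon xs u \<in> carrier R"
  by (induction xs u rule: mon.induct) auto

lemma mon_ladd:
  "set xs \<subseteq> carrier R \<Longrightarrow> length u = length xs \<Longrightarrow> length v = length xs \<Longrightarrow>
    mon xs (ladd u v) = mon xs u \<otimes> mon xs v"
proof (induction xs arbitrary: u v)
  case (Cons x xs)
  then obtain a u' b v' where uv: "u = a # u'" "v = b # v'"
    by (cases u; cases v) auto
  have c: "x \<in> carrier R" "mon xs u' \<in> carrier R" "mon xs v' \<in> carrier R"
    using Cons.prems by (auto intro: mon_closed)
  have "mon (x # xs) (ladd u v) = (x [^] a \<otimes> x [^] b) \<otimes> (mon xs u' \<otimes> mon xs v')"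
    using Cons uv c by (simp add: nat_pow_mult)
  also have "\<dots> = (x [^] a \<otimes> mon xs u') \<otimes> (x [^] b \<otimes> mon xs v')"
    using c by (simp add: m_ac)
  finally show ?case by (simp add: uv)
qed simp

lemma mon_zero: "set xs \<subseteq> carrier R \<Longrightarrow> mon xs (replicate (length xs) 0) = \<one>"
  by (induction xs) auto

lemma mon_uvec: "set xs \<subseteq> carrier R \<Longrightarrow> k < length xs \<Longrightarrow> mon xs (uvec (length xs) k) = xs ! k"
proof (induction xs arbitrary: k)
  case (Cons x xs)
  then have "k = Suc j \<Longrightarrow> xs ! j \<in> carrier R" for j by auto
  with Cons show ?case by (cases k) (auto simp: uvec_def mon_zero)
qed simp

lemma mon_mult_gen:
  assumes "set xs \<subseteq> carrier R" "length u = length xs" "x \<in> set xs"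
  shows "\<exists>v. length v = length xs \<and> sum_list v = Suc (sum_list u) \<and> mon xs u \<otimes> x = mon xs v"
proof -
  obtain k where k: "k < length xs" "x = xs ! k" using assms(3) by (auto simp: in_set_conv_nth)
  have "mon xs (ladd u (uvec (length xs) k)) = mon xs u \<otimes> x"
    using mon_ladd[OF assms(1,2), of "uvec (length xs) k"] mon_uvec[OF assms(1) k(1)] k by simp
  moreover have "sum_list (ladd u (uvec (length xs) k)) = Suc (sum_list u)"
    using sum_list_ladd[of u "uvec (length xs) k"] sum_uvec[OF k(1)] assms by simp
  ultimately show ?thesis using assms(2) by (intro exI[of _ "ladd u (uvec (length xs) k)"]) simp
qed

lemma Idl_colon_subset:
  assumes "X \<subseteq> carrier R" "ideal C R" "a \<in> carrier R" "\<And>x. x \<in> X \<Longrightarrow> a \<otimes> x \<in> C" "y \<in> Idl X"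
  shows "a \<otimes> y \<in> C"
proof -
  have "Idl X \<subseteq> {r \<in> carrier R. a \<otimes> r \<in> C}"
    by (rule genideal_minimal[OF ideal_colon[OF assms(2,3)]]) (use assms in auto)
  then show ?thesis using assms by auto
qed

text \<open>Membership of a product in an ideal can be tested on generators of one factor while the
  other is fixed, since the colon is an ideal. Doing this for both factors leaves a monomial times a
  generator.\<close>

lemma ideal_power_Idl:
  assumes xs: "set xs \<subseteq> carrier R"
  shows "ideal_power R (Idl (set xs)) n = Idl (mon xs ` exps (length xs) n)"
proof (induction n)
  case 0
  then show ?case
    using ideal_power_0[OF genideal_ideal[OF xs]] mon_zero[OF xs] genideal_one by (simp add: exps_zero)
next
  case (Suc n)
  let ?m = "length xs"
  have c: "mon xs ` E \<subseteq> carrier R" for E using mon_closed[OF xs] by auto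
  have i: "ideal (Idl (mon xs ` E)) R" for E by (rule genideal_ideal[OF c])
  have I: "ideal (Idl (set xs)) R" by (rule genideal_ideal[OF xs])
  show ?case
    unfolding ideal_power_Suc[OF I] Suc
  proof
    show "(Idl (mon xs ` exps ?m n)) \<cdot> (Idl (set xs)) \<subseteq> Idl (mon xs ` exps ?m (Suc n))"
    proof (rule ideal_prod_least[OF i])
      fix a b assume a: "a \<in> Idl (mon xs ` exps ?m n)" and b: "b \<in> Idl (set xs)"
      have ac: "a \<in> carrier R" by (rule ideal.Icarr[OF i a])
      have gx: "a \<otimes> x \<in> Idl (mon xs ` exps ?m (Suc n))" if x: "x \<in> set xs" for x
      proof -
        have "x \<otimes> a \<in> Idl (mon xs ` exps ?m (Suc n))"
        proof (rule Idl_colon_subset[OF c i _ _ a])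
          show "x \<in> carrier R" using x xs by auto
          fix y assume "y \<in> mon xs ` exps ?m n"
          then obtain u where u: "u \<in> exps ?m n" "y = mon xs u" by blast
          then obtain v where "length v = ?m" "sum_list v = Suc n" "mon xs u \<otimes> x = mon xs v"
            using mon_mult_gen[OF xs, of u x] x by (auto simp: exps_def)
          then have "y \<otimes> x \<in> mon xs ` exps ?m (Suc n)" using u unfolding exps_def by auto
          moreover have "x \<otimes> y = y \<otimes> x" using u mon_closed[OF xs] m_comm[of x y] x xs by auto
          ultimately show "x \<otimes> y \<in> Idl (mon xs ` exps ?m (Suc n))"
            using genideal_self[OF c, of "exps ?m (Suc n)"] by auto
        qed
        then show ?thesis using m_comm[of a x] ac x xs by auto
      qed
      show "a \<otimes> b \<in> Idl (mon xs ` exps ?m (Suc n))"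
        by (rule Idl_colon_subset[OF xs i ac gx b])
    qed
    show "Idl (mon xs ` exps ?m (Suc n)) \<subseteq> (Idl (mon xs ` exps ?m n)) \<cdot> (Idl (set xs))"
    proof (rule genideal_minimal[OF ideal_prod_is_ideal[OF i I]], rule subsetI)
      fix y assume "y \<in> mon xs ` exps ?m (Suc n)"
      then obtain u where "u \<in> exps ?m (Suc n)" "y = mon xs u" by blast
      then obtain v k where v: "v \<in> exps ?m n" "k < ?m" "y = mon xs (ladd v (uvec ?m k))"
        using exps_Suc_uvec by blast
      then have "y = mon xs v \<otimes> xs ! k"
        using mon_ladd[OF xs, of v "uvec ?m k"] mon_uvec[OF xs] by (simp add: exps_def)
      moreover have "mon xs v \<in> Idl (mon xs ` exps ?m n)" using genideal_self[OF c] v by blast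
      moreover have "xs ! k \<in> Idl (set xs)" using genideal_self[OF xs] v by auto
      ultimately show "y \<in> (Idl (mon xs ` exps ?m n)) \<cdot> (Idl (set xs))" by (auto intro: ideal_prod.prod)
    qed
  qed
qed

lemma mon_mem_ideal_power:
  assumes "set xs \<subseteq> carrier R" "length u = length xs" "n \<le> sum_list u"
  shows "mon xs u \<in> ideal_power R (Idl (set xs)) n"
proof -
  have "mon xs u \<in> ideal_power R (Idl (set xs)) (sum_list u)"
    unfolding ideal_power_Idl[OF assms(1)]
    using genideal_self[of "mon xs ` exps (length xs) (sum_list u)"] mon_closed[OF assms(1)] assms(2)
    by (auto simp: exps_def)
  then show ?thesis using ideal_power_antimono[OF genideal_ideal[OF assms(1)] assms(3)] by blast
qed

text \<open>\<open>lower\<close> and \<open>upper\<close> are consecutive steps of the filtration of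
  R/A by leading exponents; their quotient is cyclic, generated by \<open>mon xs u\<close>. All
  monomials of higher degree are included, so the piece at u does not depend on a degree
  bound.\<close>

definition lower :: "'a list \<Rightarrow> 'a set \<Rightarrow> nat list \<Rightarrow> 'a set"
  where "lower xs A u = Idl (A \<union> mon xs ` above u)"

definition upper :: "'a list \<Rightarrow> 'a set \<Rightarrow> nat list \<Rightarrow> 'a set"
  where "upper xs A u = Idl (A \<union> mon xs ` insert u (above u))"

definition psi :: "'a list \<Rightarrow> 'a set \<Rightarrow> nat list \<Rightarrow> enat"
  where "psi xs A u = len (carrier R) (lower xs A u) (upper xs A u)"

lemma len_ideal_add:
  assumes "ideal A R" "ideal B R" "ideal C R" "A \<subseteq> B" "B \<subseteq> C"
  shows "len (carrier R) A C = len (carrier R) A B + len (carrier R) B C"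
  by (rule len_add) (use assms in \<open>auto simp: ideal_iff_smod\<close>)

text \<open>The elements are added in decreasing order of the index, so a new least index adds one
  step at the end and leaves the earlier steps unchanged.\<close>

lemma len_filtration:
  fixes g :: "'e::linorder \<Rightarrow> 'a"
  assumes "finite E" and A: "A \<subseteq> carrier R" and "g ` E \<subseteq> carrier R"
  shows "len (carrier R) (Idl A) (Idl (A \<union> g ` E)) =
    (\<Sum>u\<in>E. len (carrier R) (Idl (A \<union> g ` {v\<in>E. u < v})) (Idl (A \<union> g ` insert u {v\<in>E. u < v})))"
  using assms(1,3)
proof (induction E rule: finite_linorder_min_induct)
  case (insert b E)
  let ?L = "\<lambda>E u. len (carrier R) (Idl (A \<union> g ` {v\<in>E. u < v})) (Idl (A \<union> g ` Set.insert u {v\<in>E. u < v}))"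
  have c: "A \<union> g ` F \<subseteq> carrier R" if "F \<subseteq> Set.insert b E" for F using A insert.prems that by blast
  have "len (carrier R) (Idl A) (Idl (A \<union> g ` Set.insert b E)) =
    len (carrier R) (Idl A) (Idl (A \<union> g ` E)) + len (carrier R) (Idl (A \<union> g ` E)) (Idl (A \<union> g ` Set.insert b E))"
    by (intro len_ideal_add genideal_ideal Idl_mono c A) auto
  also have "len (carrier R) (Idl A) (Idl (A \<union> g ` E)) = (\<Sum>u\<in>E. ?L E u)"
    using insert by auto
  also have "\<dots> = (\<Sum>u\<in>E. ?L (Set.insert b E) u)"
  proof (rule sum.cong)
    fix u assume "u \<in> E"
    then have "{v \<in> Set.insert b E. u < v} = {v \<in> E. u < v}" using insert by auto
    then show "?L E u = ?L (Set.insert b E) u" by simp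
  qed simp
  also have "len (carrier R) (Idl (A \<union> g ` E)) (Idl (A \<union> g ` Set.insert b E)) = ?L (Set.insert b E) b"
  proof -
    have "{v \<in> Set.insert b E. b < v} = E" using insert by auto
    then show ?thesis by simp
  qed
  also have "(\<Sum>u\<in>E. ?L (Set.insert b E) u) + ?L (Set.insert b E) b = (\<Sum>u\<in>Set.insert b E. ?L (Set.insert b E) u)"
    using insert by (subst sum.insert) (auto simp: add.commute)
  finally show ?case .
qed simp

context
  fixes xs :: "'a list" and A :: "'a set"
  assumes xs: "set xs \<subseteq> carrier R" and A: "ideal A R"
begin

lemma mon_carrier: "A \<union> mon xs ` F \<subseteq> carrier R"
  using mon_closed[OF xs] A by (auto intro: ideal.Icarr)

lemma lower_ideal: "ideal (lower xs A u) R" and upper_ideal: "ideal (upper xs A u) R"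
  unfolding lower_def upper_def by (intro genideal_ideal mon_carrier)+

lemma lower_upper: "lower xs A u \<subseteq> upper xs A u"
  unfolding lower_def upper_def by (intro Idl_mono mon_carrier) auto

lemma lower_gen: "a \<in> A \<Longrightarrow> a \<in> lower xs A u" "v \<in> above u \<Longrightarrow> mon xs v \<in> lower xs A u"
  unfolding lower_def using genideal_self[OF mon_carrier] by blast+

lemma upper_eq: "upper xs A u = lower xs A u <+>\<^bsub>R\<^esub> (\<lambda>r. mon xs u \<otimes> r) ` carrier R"
proof -
  have g: "A \<union> mon xs ` above u \<subseteq> lower xs A u" using lower_gen by auto
  have "lower xs A u \<subseteq> carrier R" by (rule ideal_subset_carrier[OF lower_ideal])
  then have c: "insert (mon xs u) (lower xs A u) \<subseteq> carrier R" using mon_closed[OF xs] by auto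
  have "upper xs A u = Idl (insert (mon xs u) (lower xs A u))"
  proof
    show "upper xs A u \<subseteq> Idl (insert (mon xs u) (lower xs A u))"
      unfolding upper_def by (rule genideal_minimal[OF genideal_ideal[OF c]])
        (use g genideal_self[OF c] in blast)
    show "Idl (insert (mon xs u) (lower xs A u)) \<subseteq> upper xs A u"
      by (rule genideal_minimal[OF upper_ideal])
        (use lower_upper genideal_self[OF mon_carrier, of "insert u (above u)"] in \<open>auto simp: upper_def\<close>)
  qed
  then show ?thesis using Idl_add_principal[OF lower_ideal mon_closed[OF xs]] by simp
qed

lemma upper_iff: "y \<in> upper xs A u \<longleftrightarrow> (\<exists>z\<in>lower xs A u. \<exists>r\<in>carrier R. y = z \<oplus> mon xs u \<otimes> r)"
  unfolding upper_eq set_add_iff by auto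

lemma mon_upper: "r \<in> carrier R \<Longrightarrow> mon xs u \<otimes> r \<in> upper xs A u"
  unfolding upper_iff using smodD(2)[OF lower_ideal[unfolded ideal_iff_smod], of u] mon_closed[OF xs]
  by (intro bexI[of _ \<zero>] bexI[of _ r]) auto

text \<open>For v = u + w, multiplication by \<open>mon xs w\<close> sends the generator of the
  piece at u to that of the piece at v and, the order being additive, \<open>lower xs A u\<close>
  into \<open>lower xs A v\<close>. It is a surjection of pieces.\<close>

lemma psi_decr:
  assumes u: "length u = length xs" and "lle u v"
  shows "psi xs A v \<le> psi xs A u"
proof -
  obtain w where w: "length w = length xs" "v = ladd u w" using assms by (auto simp: lle_iff_ladd)
  have mw: "mon xs w \<in> carrier R" by (rule mon_closed[OF xs])
  have mv: "mon xs v = mon xs w \<otimes> mon xs u"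
    using mon_ladd[OF xs u w(1)] w mon_closed[OF xs] m_comm by simp
  have D: "mon xs w \<otimes> x \<in> lower xs A v" if x: "x \<in> lower xs A u" for x
  proof (rule Idl_colon_subset[OF mon_carrier lower_ideal mw _ x[unfolded lower_def]])
    fix y assume "y \<in> A \<union> mon xs ` above u"
    then show "mon xs w \<otimes> y \<in> lower xs A v"
    proof
      assume "y \<in> A"
      then show ?thesis using lower_gen(1) ideal.I_l_closed[OF A _ mw] by blast
    next
      assume "y \<in> mon xs ` above u"
      then obtain t where t: "t \<in> above u" "y = mon xs t" by blast
      then have "length t = length xs" using u by (simp add: above_def)
      then have "mon xs w \<otimes> y = mon xs (ladd t w)"
        using mon_ladd[OF xs _ w(1), of t] t mon_closed[OF xs] m_comm by simp
      then show ?thesis using lower_gen(2)[OF above_ladd[OF t(1), of w]] w u by simp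
    qed
  qed
  show ?thesis unfolding psi_def
  proof (rule len_mult_surj[where a = "mon xs w"])
    fix x assume "x \<in> upper xs A u"
    then obtain z r where z: "z \<in> lower xs A u" "r \<in> carrier R" "x = z \<oplus> mon xs u \<otimes> r"
      unfolding upper_iff by blast
    have zc: "z \<in> carrier R" by (rule ideal.Icarr[OF lower_ideal z(1)])
    have "mon xs w \<otimes> x = mon xs w \<otimes> z \<oplus> mon xs v \<otimes> r"
      unfolding z(3) mv using zc z(2) mw mon_closed[OF xs] by (simp add: r_distr m_assoc)
    then show "mon xs w \<otimes> x \<in> upper xs A v" unfolding upper_iff using D[OF z(1)] z(2) by blast
  next
    fix y assume "y \<in> upper xs A v"
    then obtain z r where z: "z \<in> lower xs A v" "r \<in> carrier R" "y = z \<oplus> mon xs v \<otimes> r"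
      unfolding upper_iff by blast
    have zc: "z \<in> carrier R" by (rule ideal.Icarr[OF lower_ideal z(1)])
    have "y = mon xs w \<otimes> (mon xs u \<otimes> r) \<oplus> z"
      unfolding z(3) mv using zc z(2) mw mon_closed[OF xs] by (simp add: m_assoc a_comm)
    then show "\<exists>x\<in>upper xs A u. \<exists>z\<in>lower xs A v. y = mon xs w \<otimes> x \<oplus> z"
      using mon_upper[OF z(2), of u] z(1) by blast
  qed (use D mw lower_upper lower_ideal upper_ideal in \<open>auto simp: ideal_iff_smod\<close>)
qed

text \<open>Multiplying \<open>mon xs u\<close> by a generator raises the degree and so lands in
  \<open>lower xs A u\<close>; hence the piece at u is a quotient of R modulo the ideal of the
  generators.\<close>

lemma psi_le:
  assumes u: "length u = length xs"
  shows "psi xs A u \<le> colen (Idl (set xs))"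
  unfolding psi_def
proof (rule len_mult_surj[where a = "mon xs u"])
  fix x assume x: "x \<in> Idl (set xs)"
  show "mon xs u \<otimes> x \<in> lower xs A u"
  proof (rule Idl_colon_subset[OF xs lower_ideal mon_closed[OF xs] _ x])
    fix y assume "y \<in> set xs"
    then obtain v where "length v = length xs" "sum_list v = Suc (sum_list u)" "mon xs u \<otimes> y = mon xs v"
      using mon_mult_gen[OF xs u] by blast
    then show "mon xs u \<otimes> y \<in> lower xs A u" using lower_gen(2)[of v u] u by (simp add: above_def)
  qed
next
  fix y assume "y \<in> upper xs A u"
  then obtain z r where z: "z \<in> lower xs A u" "r \<in> carrier R" "y = z \<oplus> mon xs u \<otimes> r"
    unfolding upper_iff by blast
  moreover have "z \<in> carrier R" by (rule ideal.Icarr[OF lower_ideal z(1)])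
  ultimately show "\<exists>x\<in>carrier R. \<exists>z\<in>lower xs A u. y = mon xs u \<otimes> x \<oplus> z"
    using mon_closed[OF xs] by (metis a_comm m_closed)
qed (use mon_closed[OF xs] mon_upper lower_ideal upper_ideal genideal_ideal[OF xs] oneideal ideal.Icarr
    in \<open>auto simp: ideal_iff_smod smodD\<close>)

lemma psi_zero: "mon xs u \<in> A \<Longrightarrow> psi xs A u = 0"
proof -
  assume "mon xs u \<in> A"
  then have "A \<union> mon xs ` insert u (above u) = A \<union> mon xs ` above u" by auto
  then show ?thesis unfolding psi_def upper_def lower_def by simp
qed

lemma set_add_Idl:
  assumes "X \<subseteq> carrier R"
  shows "Idl (A \<union> X) = Idl X <+>\<^bsub>R\<^esub> A"
proof
  have Ac: "A \<subseteq> carrier R" by (rule ideal_subset_carrier[OF A])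
  have X: "ideal (Idl X) R" by (rule genideal_ideal[OF assms])
  have up: "Idl X \<subseteq> Idl X <+>\<^bsub>R\<^esub> A" "A \<subseteq> Idl X <+>\<^bsub>R\<^esub> A"
    using set_add_upper X A by (auto simp: ideal_iff_smod)
  show "Idl (A \<union> X) \<subseteq> Idl X <+>\<^bsub>R\<^esub> A"
    by (rule genideal_minimal[OF add_ideals[OF X A]]) (use up genideal_self[OF assms] in blast)
  show "Idl X <+>\<^bsub>R\<^esub> A \<subseteq> Idl (A \<union> X)"
  proof (rule set_add_least)
    show "smod (carrier R) (Idl (A \<union> X))" using genideal_ideal[of "A \<union> X"] assms Ac by (simp add: ideal_iff_smod)
    show "Idl X \<subseteq> Idl (A \<union> X)" by (rule Idl_mono) (use assms Ac in auto)
    show "A \<subseteq> Idl (A \<union> X)" using genideal_self[of "A \<union> X"] assms Ac by auto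
  qed
qed

text \<open>The degree filtration by the ideals A + I^n is refined by the lexicographic order inside
  each degree, and lengths add up along the refinement.\<close>

lemma colen_power_add:
  "colen (ideal_power R (Idl (set xs)) n <+>\<^bsub>R\<^esub> A) = (\<Sum>u\<in>expsl (length xs) n. psi xs A u)"
proof -
  let ?m = "length xs"
  \<comment> \<open>Monomials of degree at least n generate the same ideal as those of degree n, but
    they make \<open>T\<close> visibly decreasing and match the sets \<open>above u\<close>.\<close>
  define T where "T n = Idl (A \<union> mon xs ` {v. length v = ?m \<and> n \<le> sum_list v})" for n
  have Ti: "ideal (T n) R" for n unfolding T_def by (rule genideal_ideal[OF mon_carrier])
  have T_antimono: "T (Suc n) \<subseteq> T n" for n unfolding T_def by (intro Idl_mono mon_carrier) auto
  have T: "T n = ideal_power R (Idl (set xs)) n <+>\<^bsub>R\<^esub> A" for n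
  proof -
    let ?X = "mon xs ` {v. length v = ?m \<and> n \<le> sum_list v}"
    have Xc: "?X \<subseteq> carrier R" using mon_closed[OF xs] by auto
    have "Idl ?X = ideal_power R (Idl (set xs)) n"
    proof
      show "Idl ?X \<subseteq> ideal_power R (Idl (set xs)) n"
        by (rule genideal_minimal[OF ideal_power_ideal[OF genideal_ideal[OF xs]]])
          (use mon_mem_ideal_power[OF xs] in auto)
      show "ideal_power R (Idl (set xs)) n \<subseteq> Idl ?X"
        unfolding ideal_power_Idl[OF xs] by (rule Idl_mono[OF _ Xc]) (auto simp: exps_def)
    qed
    then show ?thesis unfolding T_def by (simp add: set_add_Idl[OF Xc])
  qed
  have layer: "len (carrier R) (T (Suc n)) (T n) = (\<Sum>u\<in>exps ?m n. psi xs A u)" for n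
  proof -
    let ?B = "A \<union> mon xs ` {v. length v = ?m \<and> Suc n \<le> sum_list v}"
    have "?B \<union> mon xs ` exps ?m n = A \<union> mon xs ` {v. length v = ?m \<and> n \<le> sum_list v}"
      unfolding exps_def by (auto simp: Suc_le_eq le_less)
    then have "len (carrier R) (T (Suc n)) (T n) = len (carrier R) (Idl ?B) (Idl (?B \<union> mon xs ` exps ?m n))"
      unfolding T_def by simp
    also have "\<dots> = (\<Sum>u\<in>exps ?m n. len (carrier R) (Idl (?B \<union> mon xs ` {v\<in>exps ?m n. u < v}))
        (Idl (?B \<union> mon xs ` insert u {v\<in>exps ?m n. u < v})))"
      by (rule len_filtration[OF finite_exps mon_carrier]) (use mon_closed[OF xs] in auto)
    also have "\<dots> = (\<Sum>u\<in>exps ?m n. psi xs A u)"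
    proof (rule sum.cong)
      fix u assume u: "u \<in> exps ?m n"
      have e: "above u = {v. length v = ?m \<and> Suc n \<le> sum_list v} \<union> {v\<in>exps ?m n. u < v}"
        using u unfolding above_def exps_def by auto
      have "?B \<union> mon xs ` {v\<in>exps ?m n. u < v} = A \<union> mon xs ` above u"
        "?B \<union> mon xs ` insert u {v\<in>exps ?m n. u < v} = A \<union> mon xs ` insert u (above u)"
        unfolding e by auto
      then show "len (carrier R) (Idl (?B \<union> mon xs ` {v\<in>exps ?m n. u < v}))
        (Idl (?B \<union> mon xs ` insert u {v\<in>exps ?m n. u < v})) = psi xs A u"
        unfolding psi_def lower_def upper_def by simp
    qed simp
    finally show ?thesis .
  qed
  have "colen (T n) = (\<Sum>u\<in>expsl ?m n. psi xs A u)" for n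
  proof (induction n)
    case 0
    have "\<one> \<in> T 0" unfolding T_def
      using genideal_self[OF mon_carrier, of "{v. length v = ?m \<and> 0 \<le> sum_list v}"] mon_zero[OF xs]
      by (metis (mono_tags, lifting) UnI2 image_eqI length_replicate mem_Collect_eq subsetD zero_le)
    then have "T 0 = carrier R" using ideal.one_imp_carrier[OF Ti] by blast
    then show ?case by (simp add: expsl_def)
  next
    case (Suc n)
    have "colen (T (Suc n)) = len (carrier R) (T (Suc n)) (T n) + colen (T n)"
      by (rule len_ideal_add[OF Ti Ti oneideal T_antimono]) (rule ideal_subset_carrier[OF Ti])
    then show ?case using Suc layer by (simp add: sum_expsl add.commute)
  qed
  then show ?thesis using T by simp
qed

end

text \<open>Both pieces are generated by \<open>mon xs u\<close>; a larger A only adds relations.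
  Comparison with A = 0 later makes the support independent of q.\<close>

lemma psi_antimono:
  assumes xs: "set xs \<subseteq> carrier R" and A: "ideal A R" and B: "ideal B R" and AB: "A \<subseteq> B"
  shows "psi xs B u \<le> psi xs A u"
  unfolding psi_def
proof (rule len_quotient)
  show "lower xs A u \<subseteq> lower xs B u" "upper xs A u \<subseteq> upper xs B u"
    unfolding lower_def upper_def by (intro Idl_mono mon_carrier[OF xs B]; use AB in auto)+
  show "lower xs A u \<subseteq> upper xs A u" by (rule lower_upper[OF xs A])
  show "upper xs B u \<subseteq> upper xs A u <+>\<^bsub>R\<^esub> lower xs B u"
  proof
    fix y assume "y \<in> upper xs B u"
    then obtain z r where z: "z \<in> lower xs B u" "r \<in> carrier R" "y = z \<oplus> mon xs u \<otimes> r"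
      unfolding upper_iff[OF xs B] by blast
    then have "y = mon xs u \<otimes> r \<oplus> z"
      using ideal.Icarr[OF lower_ideal[OF xs B]] mon_closed[OF xs] by (simp add: a_comm)
    then show "y \<in> upper xs A u <+>\<^bsub>R\<^esub> lower xs B u"
      unfolding set_add_iff using mon_upper[OF xs A z(2)] z(1) by blast
  qed
qed (use lower_ideal upper_ideal xs A B in \<open>auto simp: ideal_iff_smod\<close>)

end

section \<open>Growth of colengths and chains of primes\<close>

context cring
begin

lemma colen_antimono: "A \<subseteq> B \<Longrightarrow> colen B \<le> colen A"
  by (rule chain_len_mono) auto

lemma ideal_sum:
  assumes "ideal A R" "ideal B R"
  shows "ideal (A <+>\<^bsub>R\<^esub> B) R" "A \<subseteq> A <+>\<^bsub>R\<^esub> B" "B \<subseteq> A <+>\<^bsub>R\<^esub> B"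
  using add_ideals[OF assms] set_add_upper assms by (auto simp: ideal_iff_smod)

lemma ideal_sum_least: "ideal C R \<Longrightarrow> A \<subseteq> C \<Longrightarrow> B \<subseteq> C \<Longrightarrow> A <+>\<^bsub>R\<^esub> B \<subseteq> C"
  unfolding ideal_iff_smod by (rule set_add_least)

lemma ideal_sum_mono:
  "ideal A' R \<Longrightarrow> ideal B' R \<Longrightarrow> A \<subseteq> A' \<Longrightarrow> B \<subseteq> B' \<Longrightarrow> A <+>\<^bsub>R\<^esub> B \<subseteq> A' <+>\<^bsub>R\<^esub> B'"
  by (rule ideal_sum_least) (use ideal_sum[of A' B'] in auto)

lemma ideal_insert:
  assumes "ideal A R" "a \<in> carrier R"
  shows "ideal (Idl (insert a A)) R" "A \<subseteq> Idl (insert a A)" "a \<in> Idl (insert a A)"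
    and "y \<in> Idl (insert a A) \<Longrightarrow> \<exists>x\<in>A. \<exists>r\<in>carrier R. y = x \<oplus> a \<otimes> r"
proof -
  have c: "insert a A \<subseteq> carrier R" using assms ideal_subset_carrier by auto
  show "ideal (Idl (insert a A)) R" by (rule genideal_ideal[OF c])
  show "A \<subseteq> Idl (insert a A)" "a \<in> Idl (insert a A)" using genideal_self[OF c] by auto
  show "y \<in> Idl (insert a A) \<Longrightarrow> \<exists>x\<in>A. \<exists>r\<in>carrier R. y = x \<oplus> a \<otimes> r"
    unfolding Idl_add_principal[OF assms] set_add_iff by auto
qed

text \<open>Multiplication by a maps R/C onto (A + aR + Q)/(A + Q). The ideal C is left free: it is
  the colon ideal plus Q in one application, and A + J^n with Q = J^(n+1) in the other.\<close>

lemma colen_insert_le: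
  assumes A: "ideal A R" and a: "a \<in> carrier R" and Q: "ideal Q R" and C: "ideal C R"
    and CA: "\<And>x. x \<in> C \<Longrightarrow> a \<otimes> x \<in> A <+>\<^bsub>R\<^esub> Q"
  shows "colen (A <+>\<^bsub>R\<^esub> Q) \<le> colen C + colen (Idl (insert a A) <+>\<^bsub>R\<^esub> Q)"
proof -
  let ?B = "Idl (insert a A)"
  note B = ideal_insert[OF A a]
  note AQ = ideal_sum[OF A Q] and BQ = ideal_sum[OF B(1) Q]
  have sub: "A <+>\<^bsub>R\<^esub> Q \<subseteq> ?B <+>\<^bsub>R\<^esub> Q" by (rule ideal_sum_mono) (use B Q in auto)
  have "colen (A <+>\<^bsub>R\<^esub> Q) = len (carrier R) (A <+>\<^bsub>R\<^esub> Q) (?B <+>\<^bsub>R\<^esub> Q) + colen (?B <+>\<^bsub>R\<^esub> Q)"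
    by (rule len_ideal_add[OF AQ(1) BQ(1) oneideal sub ideal_subset_carrier[OF BQ(1)]])
  also have "len (carrier R) (A <+>\<^bsub>R\<^esub> Q) (?B <+>\<^bsub>R\<^esub> Q) \<le> colen C"
  proof (rule len_mult_surj[OF order_refl _ _ _ _ ideal_subset_carrier[OF C] a CA])
    fix x assume "x \<in> carrier R"
    then have "a \<otimes> x \<in> ?B" by (rule ideal.I_r_closed[OF B(1,3)])
    then show "a \<otimes> x \<in> ?B <+>\<^bsub>R\<^esub> Q" using BQ(2) by blast
  next
    fix y assume "y \<in> ?B <+>\<^bsub>R\<^esub> Q"
    then obtain b q where y: "b \<in> ?B" "q \<in> Q" "y = b \<oplus> q" unfolding set_add_iff by blast
    then obtain x r where xr: "x \<in> A" "r \<in> carrier R" "b = x \<oplus> a \<otimes> r" using B(4) by blast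
    have c: "x \<in> carrier R" "q \<in> carrier R" using xr y A Q by (auto intro: ideal.Icarr)
    have "y = a \<otimes> r \<oplus> (x \<oplus> q)" unfolding y(3) xr(3) using c xr(2) a by (simp add: a_ac)
    moreover have "x \<oplus> q \<in> A <+>\<^bsub>R\<^esub> Q" unfolding set_add_iff using xr y by blast
    ultimately show "\<exists>x\<in>carrier R. \<exists>z\<in>A <+>\<^bsub>R\<^esub> Q. y = a \<otimes> x \<oplus> z" using xr(2) by blast
  qed (use AQ BQ C oneideal in \<open>auto simp: ideal_iff_smod\<close>)
  finally show ?thesis by (simp add: add_right_mono)
qed

lemma mon_mem:
  assumes "set xs \<subseteq> carrier R" "ideal A R" "length u = length xs" "k < length xs"
    "(xs ! k) [^] (j::nat) \<in> A" "j \<le> u ! k"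
  shows "mon xs u \<in> A"
  using assms
proof (induction xs arbitrary: u k)
  case (Cons x xs)
  then obtain a v where u: "u = a # v" by (cases u) auto
  have c: "x \<in> carrier R" "mon xs v \<in> carrier R" using Cons.prems by (auto intro: mon_closed)
  show ?case
  proof (cases k)
    case 0
    then have "x [^] j \<in> A" "j \<le> a" using Cons.prems u by auto
    then have "x [^] j \<otimes> x [^] (a - j) \<in> A" using ideal.I_r_closed[OF Cons.prems(2)] c by auto
    then have "x [^] a \<in> A" using c \<open>j \<le> a\<close> by (simp add: nat_pow_mult)
    then show ?thesis using ideal.I_r_closed[OF Cons.prems(2)] c u by auto
  next
    case (Suc k')
    then have "mon xs v \<in> A" using Cons u by auto
    then show ?thesis using ideal.I_l_closed[OF Cons.prems(2)] c u by auto
  qed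
qed simp

text \<open>Pigeonhole on exponents: a monomial of degree above \<open>length xs * j\<close> has an
  exponent of at least j.\<close>

lemma ideal_power_subset_of_gens:
  assumes xs: "set xs \<subseteq> carrier R" and A: "ideal A R" and j: "\<And>x. x \<in> set xs \<Longrightarrow> x [^] (j::nat) \<in> A"
  shows "ideal_power R (Idl (set xs)) (length xs * j + 1) \<subseteq> A"
  unfolding ideal_power_Idl[OF xs]
proof (rule genideal_minimal[OF A], rule subsetI)
  fix y assume "y \<in> mon xs ` exps (length xs) (length xs * j + 1)"
  then obtain u where u: "length u = length xs" "sum_list u = length xs * j + 1" "y = mon xs u"
    by (auto simp: exps_def)
  have "\<exists>k<length u. j \<le> u ! k"
  proof (rule ccontr)
    assume "\<not> ?thesis"
    then have "\<And>x. x \<in> set u \<Longrightarrow> x \<le> j" by (force simp: in_set_conv_nth)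
    then have "sum_list u \<le> length u * j" using sum_list_mono[of u "\<lambda>x. x" "\<lambda>_. j"]
      by (simp add: sum_list_triv)
    then show False using u by simp
  qed
  then obtain k where "k < length xs" "j \<le> u ! k" using u by auto
  then show "y \<in> A" unfolding u(3) using mon_mem[OF xs A u(1)] j[of "xs ! k"] by auto
qed

lemma colen_maximal:
  assumes "maximalideal m R"
  shows "colen m = 1"
proof (rule antisym)
  interpret maximalideal m R by fact
  have m: "ideal m R" by (rule is_ideal)
  show "colen m \<le> 1"
  proof (rule chain_len_le)
    fix n and N :: "nat \<Rightarrow> 'a set"
    assume N: "\<And>i. i \<le> n \<Longrightarrow> smod (carrier R) (N i)" "\<And>i. i \<le> n \<Longrightarrow> m \<subseteq> N i" "\<And>i. i \<le> n \<Longrightarrow> N i \<subseteq> carrier R"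
      "\<And>i. i < n \<Longrightarrow> N i \<subset> N (Suc i)"
    have N': "N i = m \<or> N i = carrier R" if "i \<le> n" for i
      using I_maximal[of "N i"] N(1-3)[OF that] ideal_iff_smod by blast
    show "enat n \<le> 1"
    proof (rule ccontr)
      assume "\<not> enat n \<le> 1"
      then have "n \<ge> 2" by (cases n) (auto simp: one_enat_def)
      then have "N 0 \<subset> N 1" "N 1 \<subset> N 2" using N(4)[of 0] N(4)[of 1] by (auto simp: numeral_2_eq_2)
      then show False using N'[of 0] N'[of 1] N'[of 2] N(3)[of 2] N(2)[of 0] \<open>n \<ge> 2\<close> by auto
    qed
  qed
  have "chain_len (smod (carrier R)) m m + 1 \<le> colen m"
    by (rule chain_len_extend) (use m oneideal a_subset I_notcarr in \<open>auto simp: ideal_iff_smod\<close>)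
  then show "1 \<le> colen m" by simp
qed

lemma sum_enat_finite:
  "finite E \<Longrightarrow> (\<And>x. x \<in> E \<Longrightarrow> f x \<noteq> (\<infinity>::enat)) \<Longrightarrow> sum f E \<noteq> \<infinity>"
proof (induction E rule: finite_induct)
  case (insert x E)
  then show ?case by (cases "f x"; cases "sum f E") auto
qed auto

lemma colen_power_finite:
  assumes xs: "set xs \<subseteq> carrier R" and fin: "colen (Idl (set xs)) \<noteq> \<infinity>" and A: "ideal A R"
  shows "colen (ideal_power R (Idl (set xs)) n <+>\<^bsub>R\<^esub> A) \<noteq> \<infinity>"
  unfolding colen_power_add[OF xs A]
proof (rule sum_enat_finite[OF finite_expsl])
  fix u assume u: "u \<in> expsl (length xs) n"
  show "psi xs A u \<noteq> \<infinity>"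
  proof
    assume "psi xs A u = \<infinity>"
    then show False using psi_le[OF xs A, of u] fin u by (simp add: expsl_def)
  qed
qed

text \<open>The growth of \<open>l(R/(A + J\<^sup>n))\<close> is \<open>O(n\<^bsup>g-1\<^esup>)\<close>; with an unspecified constant factor, \<open>O(n\<^bsup>-1\<^esup>)\<close>
  has to mean that the length vanishes.\<close>

definition slow :: "'a set \<Rightarrow> nat \<Rightarrow> 'a set \<Rightarrow> bool"
  where "slow J g A \<longleftrightarrow> (case g of 0 \<Rightarrow> A = carrier R
    | Suc h \<Rightarrow> \<exists>C::nat. \<forall>n. colen (A <+>\<^bsub>R\<^esub> ideal_power R J n) \<le> enat (C * (n + 1) ^ h))"

text \<open>Modulo powers of J this is the exact sequence from R/(A : a) to R/A to R/(A + aR). At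
  order 0 the reason is that A : a = R puts a into A.\<close>

lemma slow_colon:
  assumes J: "ideal J R" and A: "ideal A R" and a: "a \<in> carrier R"
    and s1: "slow J g (Idl (insert a A))" and s2: "slow J g {r \<in> carrier R. a \<otimes> r \<in> A}"
  shows "slow J g A"
proof (cases g)
  case 0
  then have "\<one> \<in> {r \<in> carrier R. a \<otimes> r \<in> A}" using s2 by (simp add: slow_def)
  then have "insert a A = A" using a by auto
  moreover have "Idl A = A" using genideal_minimal[OF A order_refl] genideal_self[of A] ideal_subset_carrier[OF A] by auto
  ultimately show ?thesis using s1 0 by (simp add: slow_def)
next
  case (Suc h)
  let ?C = "{r \<in> carrier R. a \<otimes> r \<in> A}"
  have C: "ideal ?C R" by (rule ideal_colon[OF A a])
  from s1 s2 Suc obtain C1 C2 where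
    1: "\<And>n. colen (Idl (insert a A) <+>\<^bsub>R\<^esub> ideal_power R J n) \<le> enat (C1 * (n + 1) ^ h)" and
    2: "\<And>n. colen (?C <+>\<^bsub>R\<^esub> ideal_power R J n) \<le> enat (C2 * (n + 1) ^ h)"
    by (auto simp: slow_def)
  have "colen (A <+>\<^bsub>R\<^esub> ideal_power R J n) \<le> enat ((C2 + C1) * (n + 1) ^ h)" for n
  proof -
    let ?Q = "ideal_power R J n"
    have Q: "ideal ?Q R" by (rule ideal_power_ideal[OF J])
    have "colen (A <+>\<^bsub>R\<^esub> ?Q) \<le> colen (?C <+>\<^bsub>R\<^esub> ?Q) + colen (Idl (insert a A) <+>\<^bsub>R\<^esub> ?Q)"
    proof (rule colen_insert_le[OF A a Q ideal_sum(1)[OF C Q]])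
      fix x assume "x \<in> ?C <+>\<^bsub>R\<^esub> ?Q"
      then obtain c q where x: "c \<in> ?C" "q \<in> ?Q" "x = c \<oplus> q" unfolding set_add_iff by blast
      have "q \<in> carrier R" by (rule ideal.Icarr[OF Q x(2)])
      then have "a \<otimes> x = a \<otimes> c \<oplus> a \<otimes> q" using x a by (auto simp: r_distr)
      moreover have "a \<otimes> q \<in> ?Q" by (rule ideal.I_l_closed[OF Q x(2) a])
      ultimately show "a \<otimes> x \<in> A <+>\<^bsub>R\<^esub> ?Q" unfolding set_add_iff using x by blast
    qed
    also have "\<dots> \<le> enat (C2 * (n + 1) ^ h) + enat (C1 * (n + 1) ^ h)" by (intro add_mono 1 2)
    finally show ?thesis by (simp add: algebra_simps)
  qed
  then show ?thesis using Suc by (auto simp: slow_def)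
qed

text \<open>Since y maps A + J^n into A + J^(n+1), consecutive colengths differ by at most l(R/(A +
  yR + J^(n+1))). Summing n such terms raises the order of growth by one.\<close>

lemma slow_Suc:
  assumes J: "ideal J R" and A: "ideal A R" and y: "y \<in> J"
    and s: "slow J g (Idl (insert y A))"
  shows "slow J (Suc g) A"
proof -
  let ?B = "Idl (insert y A)"
  have yc: "y \<in> carrier R" by (rule ideal.Icarr[OF J y])
  define F where "F n = colen (A <+>\<^bsub>R\<^esub> ideal_power R J n)" for n
  have F0: "F 0 = 0"
  proof -
    have "A <+>\<^bsub>R\<^esub> carrier R = carrier R"
      using ideal_sum[OF A oneideal] ideal_subset_carrier by blast
    then show ?thesis unfolding F_def ideal_power_0[OF J] by (simp only: chain_len_self)
  qed
  have FS: "F (Suc n) \<le> F n + colen (?B <+>\<^bsub>R\<^esub> ideal_power R J (Suc n))" for n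
    unfolding F_def
  proof (rule colen_insert_le[OF A yc ideal_power_ideal[OF J] ideal_sum(1)[OF A ideal_power_ideal[OF J]]])
    fix x assume "x \<in> A <+>\<^bsub>R\<^esub> ideal_power R J n"
    then obtain a q where x: "a \<in> A" "q \<in> ideal_power R J n" "x = a \<oplus> q" unfolding set_add_iff by blast
    have "a \<in> carrier R" "q \<in> carrier R"
      using ideal.Icarr[OF A x(1)] ideal.Icarr[OF ideal_power_ideal[OF J] x(2)] by auto
    then have "y \<otimes> x = y \<otimes> a \<oplus> q \<otimes> y" using x(3) yc by (simp add: r_distr m_comm)
    moreover have "q \<otimes> y \<in> ideal_power R J (Suc n)"
      using x(2) y unfolding ideal_power_Suc[OF J] by (auto intro: ideal_prod.prod)
    moreover have "y \<otimes> a \<in> A" by (rule ideal.I_l_closed[OF A x(1) yc])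
    ultimately show "y \<otimes> x \<in> A <+>\<^bsub>R\<^esub> ideal_power R J (Suc n)" unfolding set_add_iff by blast
  qed
  show ?thesis
  proof (cases g)
    case 0
    then have B: "?B = carrier R" using s by (simp add: slow_def)
    have "colen (?B <+>\<^bsub>R\<^esub> ideal_power R J n) = 0" for n
    proof -
      have "?B <+>\<^bsub>R\<^esub> ideal_power R J n = carrier R"
        using ideal_sum[OF oneideal ideal_power_ideal[OF J], of n] ideal_subset_carrier B by auto
      then show ?thesis by simp
    qed
    then have FS': "F (Suc n) \<le> F n" for n using FS[of n] by (simp only: add_0_right)
    have "F n \<le> 0" for n
    proof (induction n)
      case (Suc n)
      then show ?case using FS'[of n] by (metis order_trans)
    qed (simp add: F0)
    then show ?thesis using 0 unfolding slow_def F_def by (auto intro: exI[of _ 0])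
  next
    case (Suc h)
    then obtain C where C: "\<And>n. colen (?B <+>\<^bsub>R\<^esub> ideal_power R J n) \<le> enat (C * (n + 1) ^ h)"
      using s by (auto simp: slow_def)
    have "F n \<le> enat (n * (C * (n + 1) ^ h))" for n
    proof (induction n)
      case 0
      then show ?case using F0 by simp
    next
      case (Suc n)
      have "F (Suc n) \<le> enat (n * (C * (n + 1) ^ h)) + enat (C * (Suc n + 1) ^ h)"
        using FS[of n] C[of "Suc n"] Suc by (meson add_mono order_trans)
      also have "\<dots> \<le> enat (Suc n * (C * (Suc n + 1) ^ h))"
      proof -
        have "(n + 1) ^ h \<le> (Suc n + 1) ^ h" by (rule power_mono) auto
        then have "n * (C * (n + 1) ^ h) \<le> n * (C * (Suc n + 1) ^ h)" by (intro mult_left_mono) auto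
        then show ?thesis by simp
      qed
      finally show ?case .
    qed
    moreover have "n * (C * (n + 1) ^ h) \<le> C * (n + 1) ^ Suc h" for n
    proof -
      have "n * (C * (n + 1) ^ h) \<le> (n + 1) * (C * (n + 1) ^ h)" by (rule mult_right_mono) auto
      then show ?thesis by (simp add: ac_simps)
    qed
    ultimately have "F n \<le> enat (C * (n + 1) ^ Suc h)" for n by (meson enat_ord_simps(1) order_trans)
    then show ?thesis unfolding slow_def F_def Suc by auto
  qed
qed

end

text \<open>In a noetherian ring a nonempty chain of ideals contains its union, so Zorn's lemma
  applies to an arbitrary property.\<close>

lemma (in noetherian_domain) ideal_maximal_with:
  assumes "ideal A R" "Q A"
  shows "\<exists>P. ideal P R \<and> A \<subseteq> P \<and> Q P \<and> (\<forall>B. ideal B R \<longrightarrow> P \<subset> B \<longrightarrow> \<not> Q B)"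
proof -
  let ?F = "{B. ideal B R \<and> A \<subseteq> B \<and> Q B}"
  have "\<exists>M\<in>?F. \<forall>X\<in>?F. M \<subseteq> X \<longrightarrow> X = M"
  proof (rule subset_Zorn_nonempty)
    show "?F \<noteq> {}" using assms by blast
    fix \<C> assume "\<C> \<noteq> {}" and ch: "subset.chain ?F \<C>"
    then have "subset.chain {I. ideal I R} \<C>" unfolding subset.chain_def by blast
    then have "\<Union>\<C> \<in> \<C>" using ideal_chain_is_trivial[OF \<open>\<C> \<noteq> {}\<close>] by blast
    then show "\<Union>\<C> \<in> ?F" using ch unfolding subset.chain_def by blast
  qed
  then obtain M where M: "M \<in> ?F" and M': "\<forall>X\<in>?F. M \<subseteq> X \<longrightarrow> X = M" by (elim bexE)
  have "\<not> Q B" if "ideal B R" "M \<subset> B" for B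
  proof
    assume "Q B"
    then have "B \<in> ?F" using that M(1) by auto
    then show False using bspec[OF M', of B] that(2) by auto
  qed
  then show ?thesis using M by (intro exI[of _ M]) auto
qed

context noetherian_domain
begin

text \<open>An ideal that is maximal among those which are not slow is prime, and adding an element of
  \<open>J\<close> lowers the order of growth by at most one.\<close>

lemma not_slow_prime_chain:
  assumes J: "ideal J R" and fin: "colen J \<noteq> \<infinity>"
  shows "ideal A R \<Longrightarrow> \<not> slow J g A \<Longrightarrow>
    \<exists>P::nat \<Rightarrow> 'a set. (\<forall>i\<le>g. primeideal (P i) R) \<and> (\<forall>i<g. P i \<subset> P (Suc i)) \<and> A \<subseteq> P 0"
proof (induction g arbitrary: A)
  have max_prime: "primeideal P R"
    if P: "ideal P R" "\<not> slow J g P" "\<And>B. ideal B R \<Longrightarrow> P \<subset> B \<Longrightarrow> slow J g B" for P g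
  proof (rule primeidealI[OF P(1) is_cring])
    show "carrier R \<noteq> P"
    proof
      assume c: "carrier R = P"
      have "colen (P <+>\<^bsub>R\<^esub> ideal_power R J n) = 0" for n
      proof -
        have "P <+>\<^bsub>R\<^esub> ideal_power R J n = carrier R"
          using ideal_sum[OF oneideal ideal_power_ideal[OF J], of n] ideal_subset_carrier c by auto
        then show ?thesis by simp
      qed
      then have "slow J g P" using c by (auto simp: slow_def zero_enat_def split: nat.split intro: exI[of _ 0])
      then show False using P by blast
    qed
    fix a b assume ab: "a \<in> carrier R" "b \<in> carrier R" "a \<otimes> b \<in> P"
    show "a \<in> P \<or> b \<in> P"
    proof (rule ccontr)
      assume n: "\<not> (a \<in> P \<or> b \<in> P)"
      \<comment> \<open>P + aR and P : a are both strictly larger than P, hence slow by maximality;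
        then \<open>slow_colon\<close> would make P slow.\<close>
      have "slow J g (Idl (insert a P))"
        using P(3)[OF ideal_insert(1)[OF P(1) ab(1)]] ideal_insert(2,3)[OF P(1) ab(1)] n by blast
      moreover have "slow J g {r \<in> carrier R. a \<otimes> r \<in> P}"
      proof (rule P(3)[OF ideal_colon[OF P(1) ab(1)]])
        show "P \<subset> {r \<in> carrier R. a \<otimes> r \<in> P}"
          using ab n ideal.I_l_closed[OF P(1) _ ab(1)] ideal_subset_carrier[OF P(1)] by auto
      qed
      ultimately show False using slow_colon[OF J P(1) ab(1)] P(2) by blast
    qed
  qed
  have obtain_prime: "\<exists>P. primeideal P R \<and> ideal P R \<and> A \<subseteq> P \<and> \<not> slow J g P"
    if A: "ideal A R" "\<not> slow J g A" for A g
  proof -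
    obtain P where P: "ideal P R \<and> A \<subseteq> P \<and> \<not> slow J g P \<and> (\<forall>B. ideal B R \<longrightarrow> P \<subset> B \<longrightarrow> \<not> \<not> slow J g B)"
      using ideal_maximal_with[of A "\<lambda>A. \<not> slow J g A", OF A] by (elim exE)
    then have "primeideal P R" by (intro max_prime[of P g]) simp_all
    then show ?thesis using P by (intro exI[of _ P]) simp
  qed
  {
    case (0 A)
    obtain P where "primeideal P R" "A \<subseteq> P" using obtain_prime[OF 0] by auto
    then show ?case by (intro exI[of _ "\<lambda>_. P"]) auto
  next
    case (Suc g A)
    obtain P where prime: "primeideal P R" and P: "ideal P R" "A \<subseteq> P" "\<not> slow J (Suc g) P"
      using obtain_prime[OF Suc.prems] by auto
    \<comment> \<open>Otherwise all colengths would be bounded by l(R/J), which is slow of order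
      \<open>Suc g\<close>.\<close>
    have "\<not> J \<subseteq> P"
    proof
      assume "J \<subseteq> P"
      obtain C where C: "colen J = enat C" using fin by auto
      have "colen (P <+>\<^bsub>R\<^esub> ideal_power R J n) \<le> enat (C * (n + 1) ^ g)" for n
      proof -
        have "colen (P <+>\<^bsub>R\<^esub> ideal_power R J n) \<le> colen J"
          by (rule colen_antimono) (use \<open>J \<subseteq> P\<close> ideal_sum(2)[OF P(1) ideal_power_ideal[OF J]] in blast)
        also have "\<dots> \<le> enat (C * (n + 1) ^ g)" unfolding C by simp
        finally show ?thesis .
      qed
      then have "slow J (Suc g) P" by (auto simp: slow_def)
      then show False using P by blast
    qed
    then obtain y where y: "y \<in> J" "y \<notin> P" by blast
    have yc: "y \<in> carrier R" by (rule ideal.Icarr[OF J y(1)])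
    have ns: "\<not> slow J g (Idl (insert y P))" using slow_Suc[OF J P(1) y(1)] P(3) by blast
    obtain Q :: "nat \<Rightarrow> 'a set" where "(\<forall>i\<le>g. primeideal (Q i) R) \<and> (\<forall>i<g. Q i \<subset> Q (Suc i)) \<and>
      Idl (insert y P) \<subseteq> Q 0"
      using Suc.IH[OF ideal_insert(1)[OF P(1) yc] ns] by (elim exE)
    then have Q: "\<forall>i\<le>g. primeideal (Q i) R" "\<forall>i<g. Q i \<subset> Q (Suc i)" "Idl (insert y P) \<subseteq> Q 0"
      by simp_all
    have "P \<subset> Q 0" using Q(3) ideal_insert(2,3)[OF P(1) yc] y by blast
    then show ?case using P(2) prime Q
      by (intro exI[of _ "\<lambda>i. case i of 0 \<Rightarrow> P | Suc j \<Rightarrow> Q j"]) (auto split: nat.split)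
  }
qed

text \<open>Faster growth would give d + 1 primes in a strict chain, all containing c. As c is
  nonzero and R is a domain, the zero ideal prolongs it to a chain longer than the dimension
  allows.\<close>

lemma colen_principal_growth:
  assumes J: "ideal J R" and fin: "colen J \<noteq> \<infinity>" and dim: "krull_dim R = enat d" and d: "d \<ge> 1"
    and c: "c \<in> carrier R" "c \<noteq> \<zero>"
  shows "\<exists>C::nat. \<forall>n. colen (Idl {c} <+>\<^bsub>R\<^esub> ideal_power R J n) \<le> enat (C * (n + 1) ^ (d - 1))"
proof -
  have I: "ideal (Idl {c}) R" by (rule genideal_ideal) (use c in auto)
  have cI: "c \<in> Idl {c}" using genideal_self[of "{c}"] c by auto
  have "slow J d (Idl {c})"
  proof (rule ccontr)
    assume ns: "\<not> slow J d (Idl {c})"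
    obtain P :: "nat \<Rightarrow> 'a set" where "(\<forall>i\<le>d. primeideal (P i) R) \<and> (\<forall>i<d. P i \<subset> P (Suc i)) \<and> Idl {c} \<subseteq> P 0"
      using not_slow_prime_chain[OF J fin I ns] by (elim exE)
    then have P: "\<forall>i\<le>d. primeideal (P i) R" "\<forall>i<d. P i \<subset> P (Suc i)" "Idl {c} \<subseteq> P 0" by simp_all
    have "\<zero> \<in> P 0" using P(1) primeideal.axioms(1)[of "P 0" R] smodD(2)[of "carrier R" "P 0"] ideal_iff_smod by auto
    then have "{\<zero>} \<subset> P 0" using P(3) cI c by blast
    then have "\<exists>P :: nat \<Rightarrow> 'a set. (\<forall>i\<le>Suc d. primeideal (P i) R) \<and> (\<forall>i<Suc d. P i \<subset> P (Suc i))"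
      using P zeroprimeideal
      by (intro exI[of _ "\<lambda>i. case i of 0 \<Rightarrow> {\<zero>} | Suc j \<Rightarrow> P j"]) (auto split: nat.split)
    then have "enat (Suc d) \<le> krull_dim R" unfolding krull_dim_def by (intro Sup_upper) blast
    then show False using dim by simp
  qed
  then show ?thesis using d by (cases d) (auto simp: slow_def)
qed

end

section \<open>The subring of p-th powers\<close>

context cring
begin

lemma binomial_theorem:
  assumes x: "x \<in> carrier R" and y: "y \<in> carrier R"
  shows "(x \<oplus> y) [^] (n::nat) = (\<Oplus>k\<in>{..n}. [(n choose k)] \<cdot> (x [^] k \<otimes> y [^] (n - k)))"
proof (induction n)
  case 0
  then show ?case by simp
next
  case (Suc n)
  define t where "t n k = [(n choose k)] \<cdot> (x [^] k \<otimes> y [^] (n - k))" for n k :: nat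
  have tc: "t n k \<in> carrier R" for n k unfolding t_def using x y by simp
  have tx: "t n k \<otimes> x = [(n choose k)] \<cdot> (x [^] Suc k \<otimes> y [^] (n - k))" for k
    unfolding t_def using x y by (simp add: add_pow_ldistr add_pow_rdistr m_ac)
  have ty: "t n k \<otimes> y = [(n choose k)] \<cdot> (x [^] k \<otimes> y [^] (Suc n - k))" if "k \<le> n" for k
    unfolding t_def using x y that by (simp add: add_pow_ldistr add_pow_rdistr m_ac Suc_diff_le)
  have t0: "t (Suc n) 0 = t n 0 \<otimes> y" using ty[of 0] x y by (simp add: t_def)
  \<comment> \<open>Pascal's rule. For k = n the second binomial coefficient vanishes, and
    \<open>ty\<close> is available only up to n, hence the case distinction.\<close>
  have tS: "t (Suc n) (Suc k) = t n k \<otimes> x \<oplus> (if k < n then t n (Suc k) \<otimes> y else \<zero>)" if "k \<le> n" for k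
  proof -
    have "t (Suc n) (Suc k) = [(n choose k)] \<cdot> (x [^] Suc k \<otimes> y [^] (n - k)) \<oplus>
        [(n choose Suc k)] \<cdot> (x [^] Suc k \<otimes> y [^] (n - k))"
      unfolding t_def using x y by (simp add: add.nat_pow_mult)
    then show ?thesis using that tx[of k] ty[of "Suc k"] x y by (auto simp: binomial_eq_0)
  qed
  have "(x \<oplus> y) [^] Suc n = (\<Oplus>k\<in>{..n}. t n k) \<otimes> (x \<oplus> y)" using Suc by (simp add: t_def)
  also have "\<dots> = (\<Oplus>k\<in>{..n}. t n k) \<otimes> x \<oplus> (\<Oplus>k\<in>{..n}. t n k) \<otimes> y"
    using x y tc by (intro r_distr) (auto intro: finsum_closed)
  also have "(\<Oplus>k\<in>{..n}. t n k) \<otimes> x = (\<Oplus>k\<in>{..n}. t n k \<otimes> x)"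
    using x tc by (intro finsum_ldistr) auto
  also have "(\<Oplus>k\<in>{..n}. t n k) \<otimes> y = (\<Oplus>k\<in>{..n}. t n k \<otimes> y)"
    using y tc by (intro finsum_ldistr) auto
  also have "\<dots> = (\<Oplus>k\<in>{..n}. if k < n then t n (Suc k) \<otimes> y else \<zero>) \<oplus> t n 0 \<otimes> y"
  proof (cases n)
    case 0
    then show ?thesis using tc x y by simp
  next
    case (Suc j)
    have "(\<Oplus>k\<in>{..Suc j}. t n k \<otimes> y) = (\<Oplus>k\<in>{..j}. t n (Suc k) \<otimes> y) \<oplus> t n 0 \<otimes> y"
      using tc y by (intro finsum_Suc2) auto
    moreover have "(\<Oplus>k\<in>{..Suc j}. if k < n then t n (Suc k) \<otimes> y else \<zero>) =
        \<zero> \<oplus> (\<Oplus>k\<in>{..j}. if k < n then t n (Suc k) \<otimes> y else \<zero>)"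
      using tc y Suc by (subst finsum_Suc) auto
    moreover have "(\<Oplus>k\<in>{..j}. if k < n then t n (Suc k) \<otimes> y else \<zero>) = (\<Oplus>k\<in>{..j}. t n (Suc k) \<otimes> y)"
      by (rule finsum_cong') (use tc y Suc in auto)
    moreover have "(\<Oplus>k\<in>{..j}. t n (Suc k) \<otimes> y) \<in> carrier R" using tc y by (intro finsum_closed) auto
    ultimately show ?thesis using Suc by simp
  qed
  also have "(\<Oplus>k\<in>{..n}. t n k \<otimes> x) \<oplus> ((\<Oplus>k\<in>{..n}. if k < n then t n (Suc k) \<otimes> y else \<zero>) \<oplus> t n 0 \<otimes> y)
    = ((\<Oplus>k\<in>{..n}. t n k \<otimes> x) \<oplus> (\<Oplus>k\<in>{..n}. if k < n then t n (Suc k) \<otimes> y else \<zero>)) \<oplus> t n 0 \<otimes> y"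
    using tc x y by (intro a_assoc[symmetric] finsum_closed) auto
  also have "(\<Oplus>k\<in>{..n}. t n k \<otimes> x) \<oplus> (\<Oplus>k\<in>{..n}. if k < n then t n (Suc k) \<otimes> y else \<zero>)
    = (\<Oplus>k\<in>{..n}. t n k \<otimes> x \<oplus> (if k < n then t n (Suc k) \<otimes> y else \<zero>))"
    using tc x y by (intro finsum_addf[symmetric]) auto
  also have "\<dots> = (\<Oplus>k\<in>{..n}. t (Suc n) (Suc k))"
    by (rule finsum_cong') (use tc x y tS in auto)
  also have "\<dots> \<oplus> t n 0 \<otimes> y = (\<Oplus>k\<in>{..Suc n}. t (Suc n) k)"
    using tc t0 by (subst finsum_Suc2) auto
  finally show ?case by (simp add: t_def)
qed

end

locale char_domain = domain +
  fixes p :: nat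
  assumes p_pos: "p > 0" and char: "has_characteristic R p"
begin

lemma add_pow_one_mult: "x \<in> carrier R \<Longrightarrow> [(n::nat)] \<cdot> x = ([n] \<cdot> \<one>) \<otimes> x"
  by (simp add: add_pow_ldistr)

lemma prime_p: "Factorial_Ring.prime p"
proof (rule prime_natI)
  have "[(1::nat)] \<cdot> \<one> \<noteq> \<zero>" by simp
  then have "\<not> p dvd 1" using char unfolding has_characteristic_def by blast
  then show "p \<ge> 2" using p_pos by (cases p) (auto simp: numeral_2_eq_2 Suc_le_eq)
next
  fix a b assume ab: "p dvd a * b"
  have "([a] \<cdot> \<one>) \<otimes> ([b] \<cdot> \<one>) = [(a * b)] \<cdot> \<one>"
    by (simp add: add_pow_ldistr add.nat_pow_pow mult.commute)
  then have "([a] \<cdot> \<one>) \<otimes> ([b] \<cdot> \<one>) = \<zero>" using ab char unfolding has_characteristic_def by simp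
  then show "p dvd a \<or> p dvd b"
    using char unfolding has_characteristic_def by (simp add: integral_iff)
qed

lemma frob_add:
  assumes x: "x \<in> carrier R" and y: "y \<in> carrier R"
  shows "(x \<oplus> y) [^] p = x [^] p \<oplus> y [^] p"
proof -
  \<comment> \<open>As p is at least 2, the first and the last term can be split off as different
    terms.\<close>
  obtain j where p: "p = Suc (Suc j)" using prime_ge_2_nat[OF prime_p] by (metis One_nat_def Suc_1 add_2_eq_Suc le_Suc_ex)
  let ?t = "\<lambda>k. [(p choose k)] \<cdot> (x [^] k \<otimes> y [^] (p - k))"
  have z: "?t k = \<zero>" if "0 < k" "k < p" for k
  proof -
    have "p dvd (p choose k)" using dvd_choose_prime[of k p] prime_p that by auto
    then have "[(p choose k)] \<cdot> \<one> = \<zero>" using char unfolding has_characteristic_def by simp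
    then show ?thesis using x y by (subst add_pow_one_mult) auto
  qed
  have "(x \<oplus> y) [^] p = (\<Oplus>k\<in>{..Suc (Suc j)}. ?t k)" using binomial_theorem[OF x y, of p] unfolding p .
  also have "\<dots> = ?t (Suc (Suc j)) \<oplus> (\<Oplus>k\<in>{..Suc j}. ?t k)"
    using x y by (intro finsum_Suc) auto
  also have "(\<Oplus>k\<in>{..Suc j}. ?t k) = (\<Oplus>k\<in>{..j}. ?t (Suc k)) \<oplus> ?t 0"
    using x y by (intro finsum_Suc2) auto
  also have "(\<Oplus>k\<in>{..j}. ?t (Suc k)) = (\<Oplus>k\<in>{..j}. \<zero>)"
  proof (rule finsum_cong')
    show "?t (Suc k) = \<zero>" if "k \<in> {..j}" for k by (rule z) (use that p in auto)
  qed auto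
  also have "\<dots> = \<zero>" by (rule add.finprod_one_eqI) auto
  finally show ?thesis using x y p by simp
qed

lemma frob_minus:
  assumes "x \<in> carrier R"
  shows "(\<ominus> x) [^] p = \<ominus> (x [^] p)"
proof -
  have "(\<ominus> x) [^] p \<oplus> x [^] p = \<zero>"
    using frob_add[of "\<ominus> x" x] assms p_pos by (simp add: l_neg nat_pow_zero)
  then show ?thesis using assms by (simp add: minus_equality)
qed

lemma frob_diff:
  "x \<in> carrier R \<Longrightarrow> y \<in> carrier R \<Longrightarrow> (x \<ominus> y) [^] p = x [^] p \<ominus> y [^] p"
  unfolding a_minus_def by (simp add: frob_add frob_minus)

lemma frob_iter:
  assumes "x \<in> carrier R" "y \<in> carrier R"
  shows "(x \<oplus> y) [^] (p ^ n) = x [^] (p ^ n) \<oplus> y [^] (p ^ n)"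
proof (induction n)
  case (Suc n)
  have "(x \<oplus> y) [^] (p ^ Suc n) = ((x \<oplus> y) [^] (p ^ n)) [^] p"
    using assms by (simp add: nat_pow_pow mult.commute)
  also have "\<dots> = (x [^] (p ^ n)) [^] p \<oplus> (y [^] (p ^ n)) [^] p"
    unfolding Suc using assms by (intro frob_add) auto
  finally show ?case using assms by (simp add: nat_pow_pow mult.commute)
qed (use assms in simp)

lemma pow_eq_zero_iff: "x \<in> carrier R \<Longrightarrow> n > 0 \<Longrightarrow> x [^] (n::nat) = \<zero> \<longleftrightarrow> x = \<zero>"
proof (induction n)
  case (Suc n)
  then show ?case by (cases n) (auto simp: integral_iff)
qed simp

text \<open>Just the set of p-th powers, not the ideal they generate in R. For an ideal A it is the
  ideal of the subring \<open>S\<close> that corresponds to A under the Frobenius isomorphism of R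
  with \<open>S\<close>.\<close>

definition pw :: "'a set \<Rightarrow> 'a set"
  where "pw A = (\<lambda>x. x [^] p) ` A"

abbreviation S where "S \<equiv> pw (carrier R)"

lemma S_carrier: "S \<subseteq> carrier R"
  unfolding pw_def by auto

lemma one_S: "\<one> \<in> S"
  unfolding pw_def by (auto simp: image_iff intro: bexI[of _ \<one>])

lemma smod_pw:
  assumes A: "ideal A R"
  shows "smod S (pw A)"
  unfolding smod_def
proof (intro conjI ballI)
  note Ad = smodD[OF A[unfolded ideal_iff_smod]]
  show "pw A \<subseteq> carrier R" using Ad(7) by (auto simp: pw_def)
  show "\<zero> \<in> pw A" unfolding pw_def using Ad(2) p_pos by (intro image_eqI[of _ _ \<zero>]) (auto simp: nat_pow_zero)
  fix x assume "x \<in> pw A"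
  then obtain a where a: "a \<in> A" "x = a [^] p" by (auto simp: pw_def)
  show "\<ominus> x \<in> pw A" unfolding pw_def a(2)
    using frob_minus[OF Ad(7)[OF a(1)]] Ad(4)[OF a(1)] by (intro image_eqI[of _ _ "\<ominus> a"]) auto
  show "x \<oplus> y \<in> pw A" if "y \<in> pw A" for y
  proof -
    from that obtain b where b: "b \<in> A" "y = b [^] p" by (auto simp: pw_def)
    then show ?thesis unfolding pw_def a(2)
      using frob_add[OF Ad(7)[OF a(1)] Ad(7)[OF b(1)]] Ad(3)[OF a(1) b(1)]
      by (intro image_eqI[of _ _ "a \<oplus> b"]) auto
  qed
  show "s \<otimes> x \<in> pw A" if "s \<in> S" for s
  proof -
    from that obtain r where r: "r \<in> carrier R" "s = r [^] p" by (auto simp: pw_def)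
    then show ?thesis unfolding pw_def a(2)
      using nat_pow_distrib[OF r(1) Ad(7)[OF a(1)], of p] Ad(6)[OF r(1) a(1)]
      by (intro image_eqI[of _ _ "r \<otimes> a"]) auto
  qed
qed

lemma smod_mult_image:
  assumes "smod S A" "b \<in> carrier R"
  shows "smod S ((\<lambda>s. s \<otimes> b) ` A)"
  unfolding smod_def
proof (intro conjI ballI)
  note Ad = smodD[OF assms(1)]
  show "(\<lambda>s. s \<otimes> b) ` A \<subseteq> carrier R" using Ad(7) assms(2) by auto
  show "\<zero> \<in> (\<lambda>s. s \<otimes> b) ` A" using Ad(2) assms(2) by (intro image_eqI[of _ _ \<zero>]) auto
  fix x assume "x \<in> (\<lambda>s. s \<otimes> b) ` A"
  then obtain a where a: "a \<in> A" "x = a \<otimes> b" by auto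
  note ac = Ad(7)[OF a(1)]
  show "\<ominus> x \<in> (\<lambda>s. s \<otimes> b) ` A" unfolding a(2)
    using ac assms(2) Ad(4)[OF a(1)] by (intro image_eqI[of _ _ "\<ominus> a"]) (auto simp: l_minus)
  show "x \<oplus> y \<in> (\<lambda>s. s \<otimes> b) ` A" if "y \<in> (\<lambda>s. s \<otimes> b) ` A" for y
  proof -
    from that obtain a' where a': "a' \<in> A" "y = a' \<otimes> b" by auto
    then show ?thesis unfolding a(2)
      using ac Ad(7)[OF a'(1)] assms(2) Ad(3)[OF a(1) a'(1)]
      by (intro image_eqI[of _ _ "a \<oplus> a'"]) (auto simp: l_distr)
  qed
  show "s \<otimes> x \<in> (\<lambda>s. s \<otimes> b) ` A" if "s \<in> S" for s
    unfolding a(2) using ac assms(2) Ad(6)[OF that a(1)] subsetD[OF S_carrier that]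
    by (intro image_eqI[of _ _ "s \<otimes> a"]) (auto simp: m_assoc)
qed

text \<open>\<open>gsp A bs\<close> is \<open>\<Sum> A b\<close>. For independent \<open>bs\<close> and \<open>A = S\<close> it is a free \<open>S\<close>-module \<open>G\<close>, and for
  \<open>A = pw \<aa>\<close> it is the product \<open>\<aa>\<^bsup>(p)\<^esup> G\<close>.\<close>

fun gsp :: "'a set \<Rightarrow> 'a list \<Rightarrow> 'a set"
  where "gsp A [] = {\<zero>}"
  | "gsp A (b # bs) = gsp A bs <+>\<^bsub>R\<^esub> (\<lambda>s. s \<otimes> b) ` A"

text \<open>Linear independence over \<open>S\<close>, phrased so that adjoining one element is one
  step of an induction.\<close>

fun indep :: "'a list \<Rightarrow> bool"
  where "indep [] \<longleftrightarrow> True"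
  | "indep (b # bs) \<longleftrightarrow> indep bs \<and> (\<forall>s\<in>S. s \<otimes> b \<in> gsp S bs \<longrightarrow> s = \<zero>)"

lemma smod_gsp: "smod S A \<Longrightarrow> set bs \<subseteq> carrier R \<Longrightarrow> smod S (gsp A bs)"
proof (induction bs)
  case Nil
  then show ?case using S_carrier by (auto simp: smod_def)
next
  case (Cons b bs)
  then show ?case using smod_add[OF _ smod_mult_image S_carrier] by auto
qed

lemma gsp_mono: "A \<subseteq> B \<Longrightarrow> gsp A bs \<subseteq> gsp B bs"
proof (induction bs)
  case (Cons b bs)
  show ?case
  proof
    fix x assume "x \<in> gsp A (b # bs)"
    then obtain g s where "g \<in> gsp A bs" "s \<in> A" "x = g \<oplus> s \<otimes> b" by (auto simp: set_add_iff)
    moreover from this have "g \<in> gsp B bs" "s \<in> B" using Cons by auto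
    ultimately show "x \<in> gsp B (b # bs)" by (auto simp: set_add_iff)
  qed
qed simp

lemma gsp_gen:
  assumes A: "smod S A" and bs: "set bs \<subseteq> carrier R" and "s \<in> A" "b \<in> set bs"
  shows "s \<otimes> b \<in> gsp A bs"
  using bs \<open>b \<in> set bs\<close>
proof (induction bs)
  case (Cons c bs)
  have "smod S (gsp A bs)" "smod S ((\<lambda>s. s \<otimes> c) ` A)" using Cons.prems smod_gsp[OF A] smod_mult_image[OF A] by auto
  from set_add_upper[OF this] show ?case using Cons \<open>s \<in> A\<close> by auto
qed simp

lemma gsp_least:
  assumes "smod S N" "\<And>s b. s \<in> A \<Longrightarrow> b \<in> set bs \<Longrightarrow> s \<otimes> b \<in> N"
  shows "gsp A bs \<subseteq> N"
  using assms(2)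
proof (induction bs)
  case Nil
  then show ?case using smodD(2)[OF assms(1)] by simp
next
  case (Cons b bs)
  have "gsp A bs \<subseteq> N" using Cons by simp
  moreover have "(\<lambda>s. s \<otimes> b) ` A \<subseteq> N" using Cons.prems by auto
  ultimately show ?case unfolding gsp.simps by (rule set_add_least[OF assms(1)])
qed

lemma smod_S: "smod S S"
  by (rule smod_pw[OF oneideal])

lemma pw_mono: "A \<subseteq> B \<Longrightarrow> pw A \<subseteq> pw B"
  unfolding pw_def by auto

lemma pw_sub_S: "ideal A R \<Longrightarrow> pw A \<subseteq> S"
  by (rule pw_mono) (rule ideal_subset_carrier)

lemma S_pw: "ideal A R \<Longrightarrow> s \<in> S \<Longrightarrow> a \<in> pw A \<Longrightarrow> s \<otimes> a \<in> pw A"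
  using smodD(6)[OF smod_pw] .

text \<open>The module G + pw(A) b between T' and G' splits the quotient into one piece covered by
  G/T and one covered by R/A through x -> x^p b. Independence of b makes both maps injective and
  gives the reverse bound.\<close>

lemma len_gsp_Cons:
  fixes b :: 'a and bs :: "'a list"
  assumes A: "ideal A R" and b: "b \<in> carrier R" and bs: "set bs \<subseteq> carrier R"
  defines "T \<equiv> gsp (pw A) bs" and "G \<equiv> gsp S bs"
    and "T' \<equiv> gsp (pw A) (b # bs)" and "G' \<equiv> gsp S (b # bs)"
  shows "len S T' G' \<le> len S T G + colen A"
    and "indep (b # bs) \<Longrightarrow> len S T G + colen A \<le> len S T' G'"
proof -
  let ?Ab = "(\<lambda>s. s \<otimes> b) ` pw A" and ?Sb = "(\<lambda>s. s \<otimes> b) ` S"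
  let ?H = "G <+>\<^bsub>R\<^esub> ?Ab"
  have sT: "smod S T" and sG: "smod S G" unfolding T_def G_def by (intro smod_gsp smod_pw A smod_S bs)+
  have sAb: "smod S ?Ab" and sSb: "smod S ?Sb" by (intro smod_mult_image smod_pw A smod_S b)+
  have T': "T' = T <+>\<^bsub>R\<^esub> ?Ab" and G': "G' = G <+>\<^bsub>R\<^esub> ?Sb" by (simp_all add: T_def T'_def G_def G'_def)
  have sT': "smod S T'" and sG': "smod S G'" and sH: "smod S ?H"
    unfolding T' G' by (intro smod_add sT sG sAb sSb S_carrier)+
  have Sb: "?Ab \<subseteq> ?Sb" using pw_sub_S[OF A] by auto
  have TG: "T \<subseteq> G" unfolding T_def G_def by (rule gsp_mono[OF pw_sub_S[OF A]])
  note up = set_add_upper[OF sT sAb] set_add_upper[OF sG sAb] set_add_upper[OF sG sSb]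
  have TH: "T' \<subseteq> ?H" unfolding T' by (rule set_add_least[OF sH]) (use up TG in auto)
  have HG: "?H \<subseteq> G'" unfolding G' by (rule set_add_least[OF sG'[unfolded G']]) (use up Sb in auto)
  have split: "len S T' G' = len S T' ?H + len S ?H G'"
    by (rule len_add[OF S_carrier sT' sH sG' TH HG])
  have 1: "len S T' ?H \<le> len S T G"
  proof (rule len_quotient[OF sT sG sT' sH])
    show "T \<subseteq> T'" "T \<subseteq> G" "G \<subseteq> ?H" using up TG unfolding T' by auto
    show "?H \<subseteq> G <+>\<^bsub>R\<^esub> T'" using up unfolding T' by (auto simp: set_add_iff subset_iff; blast)
  qed
  \<comment> \<open>Multiplication by s in R becomes multiplication by s^p in \<open>S\<close>, so
    this map converts a length over R into one over \<open>S\<close>.\<close>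
  define f where "f x = x [^] p \<otimes> b" for x
  have fadd: "f (x \<oplus> y) = f x \<oplus> f y" if "x \<in> carrier R" "y \<in> carrier R" for x y
    unfolding f_def using that b by (simp add: frob_add l_distr)
  have fS: "f x \<in> ?Sb" if "x \<in> carrier R" for x using that unfolding f_def pw_def by auto
  have fsc: "f (s \<otimes> x) = s [^] p \<otimes> f x" if "s \<in> carrier R" "x \<in> carrier R" for s x
    unfolding f_def using that b by (simp add: nat_pow_distrib m_assoc)
  have 2: "len S ?H G' \<le> colen A"
  proof (rule len_surj[where f = f])
    show "\<exists>s'\<in>S. f (s \<otimes> x) = s' \<otimes> f x" if "s \<in> carrier R" "x \<in> carrier R" for s x
      using fsc[OF that] that unfolding pw_def by auto
    show "f x \<in> ?H" if "x \<in> A" for x using that up(4) unfolding f_def pw_def by auto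
    show "f x \<in> G'" if "x \<in> carrier R" for x using fS[OF that] up(6) unfolding G' by blast
    show "\<exists>x\<in>carrier R. \<exists>a\<in>?H. y = f x \<oplus> a" if "y \<in> G'" for y
    proof -
      from that obtain g x where g: "g \<in> G" "x \<in> carrier R" "y = g \<oplus> f x"
        unfolding G' set_add_iff by (auto simp: pw_def f_def)
      have "g \<in> carrier R" "f x \<in> carrier R" using smodD(7)[OF sG g(1)] g(2) b by (auto simp: f_def)
      then have "y = f x \<oplus> g" unfolding g(3) by (rule a_comm)
      then show ?thesis using g up(3) by blast
    qed
  qed (use A oneideal ideal_subset_carrier[OF A] sH sG' fadd in \<open>auto simp: ideal_iff_smod\<close>)
  show "len S T' G' \<le> len S T G + colen A" unfolding split by (intro add_mono 1 2)
  assume ind: "indep (b # bs)"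
  then have ind': "s = \<zero>" if "s \<in> S" "s \<otimes> b \<in> G" for s using that by (simp add: G_def)
  have 3: "len S T G \<le> len S T' ?H"
  proof (rule len_inj[where f = "\<lambda>x. x"])
    fix x assume x: "x \<in> G" "x \<in> T'"
    then obtain t a where ta: "t \<in> T" "a \<in> pw A" "x = t \<oplus> a \<otimes> b" unfolding T' set_add_iff by auto
    have c: "t \<in> carrier R" "a \<in> carrier R" using smodD(7)[OF sT ta(1)] smodD(7)[OF smod_pw[OF A] ta(2)] by auto
    have "x = a \<otimes> b \<oplus> t" unfolding ta(3) using c b by (simp add: a_comm)
    then have "a \<otimes> b = x \<ominus> t" using c b by (simp add: a_minus_def a_assoc r_neg)
    then have "a \<otimes> b \<in> G" using smodD(5)[OF sG x(1)] TG ta(1) by auto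
    then have "a = \<zero>" using ind' pw_sub_S[OF A] ta(2) by blast
    then show "x \<in> T" using ta c b by simp
  qed (use sT sG sT' sH S_carrier TH up in auto)
  have 4: "colen A \<le> len S ?H G'"
  proof (rule len_inj[where f = f])
    show "\<exists>s'\<in>carrier R. f (s' \<otimes> x) = s \<otimes> f x" if "s \<in> S" "x \<in> carrier R" for s x
      using fsc that unfolding pw_def by auto
    show "f x \<in> G'" if "x \<in> carrier R" for x using fS[OF that] up(6) unfolding G' by blast
    show "x \<in> A" if x: "x \<in> carrier R" "f x \<in> ?H" for x
    proof -
      from x(2) obtain g a where g: "g \<in> G" "a \<in> A" "f x = g \<oplus> f a"
        unfolding set_add_iff by (auto simp: pw_def f_def)
      have ac: "a \<in> carrier R" by (rule ideal.Icarr[OF A g(2)])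
      have c: "g \<in> carrier R" "f x \<in> carrier R" "f a \<in> carrier R"
        using smodD(7)[OF sG g(1)] x(1) ac b by (auto simp: f_def)
      have "f (x \<ominus> a) = f x \<ominus> f a"
        unfolding f_def using x(1) ac b frob_diff by (simp add: a_minus_def l_distr l_minus)
      also have "\<dots> = g" unfolding g(3) using c by (simp add: a_minus_def a_assoc r_neg)
      finally have "(x \<ominus> a) [^] p \<otimes> b \<in> G" using g(1) by (simp add: f_def)
      moreover have "(x \<ominus> a) [^] p \<in> S" using x(1) ac by (auto simp: pw_def)
      ultimately have "(x \<ominus> a) [^] p = \<zero>" using ind' by blast
      then have "x \<ominus> a = \<zero>" using pow_eq_zero_iff[of "x \<ominus> a" p] x(1) ac p_pos by auto
      then have "x = a" using x(1) ac by (simp add: r_right_minus_eq)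
      then show "x \<in> A" using g(2) by simp
    qed
  qed (use A oneideal ideal_subset_carrier[OF A] sH sG' fadd S_carrier HG in \<open>auto simp: ideal_iff_smod\<close>)
  show "len S T G + colen A \<le> len S T' G'" unfolding split by (intro add_mono 3 4)
qed

lemma len_gsp_le:
  "ideal A R \<Longrightarrow> set bs \<subseteq> carrier R \<Longrightarrow> len S (gsp (pw A) bs) (gsp S bs) \<le> of_nat (length bs) * colen A"
proof (induction bs)
  case (Cons b bs)
  have "len S (gsp (pw A) (b # bs)) (gsp S (b # bs)) \<le> len S (gsp (pw A) bs) (gsp S bs) + colen A"
    by (rule len_gsp_Cons(1)) (use Cons in auto)
  also have "\<dots> \<le> of_nat (length bs) * colen A + colen A" using Cons by (intro add_right_mono) auto
  also have "\<dots> = of_nat (length (b # bs)) * colen A" by (simp add: distrib_right add.commute)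
  finally show ?case .
qed simp

lemma len_gsp_ge:
  "ideal A R \<Longrightarrow> set bs \<subseteq> carrier R \<Longrightarrow> indep bs \<Longrightarrow> of_nat (length bs) * colen A \<le> len S (gsp (pw A) bs) (gsp S bs)"
proof (induction bs)
  case (Cons b bs)
  have "of_nat (length (b # bs)) * colen A = of_nat (length bs) * colen A + colen A"
    by (simp add: distrib_right add.commute)
  also have "\<dots> \<le> len S (gsp (pw A) bs) (gsp S bs) + colen A" using Cons by (intro add_right_mono) auto
  also have "\<dots> \<le> len S (gsp (pw A) (b # bs)) (gsp S (b # bs))"
    by (rule len_gsp_Cons(2)) (use Cons in auto)
  finally show ?case .
qed simp

end

section \<open>Comparing an ideal with its Frobenius power\<close>

context char_domain
begin

lemma smod_finsum:
  assumes N: "smod T N" and "finite B" "\<And>b. b \<in> B \<Longrightarrow> f b \<in> N"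
  shows "(\<Oplus>b\<in>B. f b) \<in> N"
  using assms(2,3)
proof (induction B rule: finite_induct)
  case empty
  then show ?case using smodD(2)[OF N] by simp
next
  case (insert b B)
  have "f \<in> B \<rightarrow> carrier R" "f b \<in> carrier R" using insert smodD(7)[OF N] by auto
  then show ?case using insert smodD(3)[OF N] by simp
qed

text \<open>The family is built greedily: b is adjoined exactly when no nonzero p-th power
  multiplies it into the span built so far. Its length is the rank r.\<close>

lemma exists_indep:
  "set Bs \<subseteq> carrier R \<Longrightarrow> \<exists>bs. set bs \<subseteq> carrier R \<and> indep bs \<and>
    (\<forall>b\<in>set Bs. \<exists>s\<in>carrier R. s \<noteq> \<zero> \<and> s [^] p \<otimes> b \<in> gsp S bs)"
proof (induction Bs)
  case Nil
  then show ?case by (intro exI[of _ "[]"]) auto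
next
  case (Cons b Bs)
  then obtain bs where bs: "set bs \<subseteq> carrier R" "indep bs"
    "\<And>b. b \<in> set Bs \<Longrightarrow> \<exists>s\<in>carrier R. s \<noteq> \<zero> \<and> s [^] p \<otimes> b \<in> gsp S bs" by auto
  show ?case
  proof (cases "\<exists>s\<in>carrier R. s \<noteq> \<zero> \<and> s [^] p \<otimes> b \<in> gsp S bs")
    case True
    then show ?thesis using bs by (intro exI[of _ bs]) simp
  next
    case False
    have b: "b \<in> carrier R" using Cons.prems by simp
    have ind: "indep (b # bs)"
    proof -
      have "s = \<zero>" if s: "s \<in> S" "s \<otimes> b \<in> gsp S bs" for s
      proof -
        obtain t where t: "t \<in> carrier R" "s = t [^] p" using s(1) by (auto simp: pw_def)
        then have "t = \<zero>" using False s(2) by auto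
        then show ?thesis using t p_pos by (simp add: nat_pow_zero)
      qed
      then show ?thesis using bs(2) by simp
    qed
    have sub: "gsp S bs \<subseteq> gsp S (b # bs)"
      using set_add_upper(1)[OF smod_gsp[OF smod_S bs(1)] smod_mult_image[OF smod_S b]] by simp
    have "\<exists>s\<in>carrier R. s \<noteq> \<zero> \<and> s [^] p \<otimes> x \<in> gsp S (b # bs)" if "x \<in> set (b # Bs)" for x
    proof (cases "x = b")
      case True
      have "\<one> \<otimes> b \<in> gsp S (b # bs)" by (rule gsp_gen[OF smod_S _ one_S]) (use b bs in auto)
      then show ?thesis using True by (intro bexI[of _ \<one>]) auto
    next
      case F: False
      then show ?thesis using bs(3)[of x] that sub by auto
    qed
    then show ?thesis using bs(1) b ind by (intro exI[of _ "b # bs"]) auto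
  qed
qed

text \<open>Clearing denominators: the product of the individual multipliers works and is nonzero in
  a domain.\<close>

lemma common_multiplier:
  assumes N: "smod S N"
  shows "set Bs \<subseteq> carrier R \<Longrightarrow> (\<And>b. b \<in> set Bs \<Longrightarrow> \<exists>s\<in>carrier R. s \<noteq> \<zero> \<and> s [^] p \<otimes> b \<in> N) \<Longrightarrow>
    \<exists>c\<in>carrier R. c \<noteq> \<zero> \<and> (\<forall>b\<in>set Bs. c [^] p \<otimes> b \<in> N)"
proof (induction Bs)
  case Nil
  then show ?case by (intro bexI[of _ \<one>]) auto
next
  case (Cons b Bs)
  obtain c where c: "c \<in> carrier R" "c \<noteq> \<zero>" "\<And>b. b \<in> set Bs \<Longrightarrow> c [^] p \<otimes> b \<in> N" using Cons by auto
  obtain s where s: "s \<in> carrier R" "s \<noteq> \<zero>" "s [^] p \<otimes> b \<in> N" using Cons.prems(2)[of b] by auto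
  have 1: "(s \<otimes> c) [^] p \<otimes> x = s [^] p \<otimes> (c [^] p \<otimes> x)" "(s \<otimes> c) [^] p \<otimes> x = c [^] p \<otimes> (s [^] p \<otimes> x)"
    if "x \<in> carrier R" for x
    using s(1) c(1) that by (simp_all add: nat_pow_distrib m_ac)
  have S: "s [^] p \<in> S" "c [^] p \<in> S" using s c by (auto simp: pw_def)
  have "(s \<otimes> c) [^] p \<otimes> x \<in> N" if x: "x \<in> set (b # Bs)" for x
  proof (cases "x = b")
    case True
    then show ?thesis using 1(2)[of b] smodD(6)[OF N S(2) s(3)] Cons.prems(1) by simp
  next
    case False
    then have "x \<in> set Bs" using x by simp
    then show ?thesis using 1(1)[of x] smodD(6)[OF N S(1) c(3)] Cons.prems(1) by auto
  qed
  then show ?case using s c by (intro bexI[of _ "s \<otimes> c"]) (auto simp: integral_iff)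
qed

lemma frobenius_power_p: "frobenius_power R A p = Idl (pw A)"
  by (simp add: frobenius_power_def pw_def)

lemma pw_carrier: "ideal A R \<Longrightarrow> pw A \<subseteq> carrier R"
  using smodD(1)[OF smod_pw] .

section \<open>A free module of full rank compared with R\<close>

context
  fixes bs :: "'a list" and c :: 'a
  assumes bs: "set bs \<subseteq> carrier R" and ind: "indep bs" and c: "c \<in> carrier R"
    and cG: "\<And>x. x \<in> carrier R \<Longrightarrow> c [^] p \<otimes> x \<in> gsp S bs"
begin

lemma gsp_pw_sub_Idl:
  assumes A: "ideal A R"
  shows "gsp (pw A) bs \<subseteq> Idl (pw A)"
proof (rule gsp_least)
  have I: "ideal (Idl (pw A)) R" by (rule genideal_ideal[OF pw_carrier[OF A]])
  show "smod S (Idl (pw A))" by (rule ideal_imp_smod[OF I S_carrier])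
  show "s \<otimes> b \<in> Idl (pw A)" if "s \<in> pw A" "b \<in> set bs" for s b
    using ideal.I_r_closed[OF I] genideal_self[OF pw_carrier[OF A]] that bs by blast
qed

lemma smods:
  assumes A: "ideal A R"
  shows "smod S (gsp (pw A) bs)" "smod S (gsp S bs)" "smod S (Idl (pw A))" "smod S (carrier R)"
    "smod S (Idl {c [^] p})" "ideal (Idl (pw A)) R" "ideal (Idl {c [^] p}) R"
proof -
  show "smod S (gsp (pw A) bs)" by (rule smod_gsp[OF smod_pw[OF A] bs])
  show "smod S (gsp S bs)" by (rule smod_gsp[OF smod_S bs])
  show I: "ideal (Idl (pw A)) R" by (rule genideal_ideal[OF pw_carrier[OF A]])
  show C: "ideal (Idl {c [^] p}) R" by (rule genideal_ideal) (use c in auto)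
  show "smod S (Idl (pw A))" "smod S (carrier R)" "smod S (Idl {c [^] p})"
    using ideal_imp_smod[OF I S_carrier] ideal_imp_smod[OF oneideal S_carrier] ideal_imp_smod[OF C S_carrier] by auto
qed

lemma Idl_principal: "a \<in> carrier R \<Longrightarrow> Idl {a} = (\<lambda>x. a \<otimes> x) ` carrier R"
  using cgenideal_eq_genideal[of a] m_comm by (auto simp: cgenideal_def)

lemma cR_sub: "Idl {c [^] p} \<subseteq> gsp S bs"
  using Idl_principal[of "c [^] p"] c cG by auto

text \<open>Insert G + F between F = A^[p] and R. The lower piece is a quotient of G/T, of length at
  most r l(R/A); the upper one is a quotient of R/(c^p R + F), because c^p R lies in G.\<close>

lemma frob_upper:
  assumes A: "ideal A R"
  shows "len S (Idl (pw A)) (carrier R) \<le>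
    of_nat (length bs) * colen A + len S (Idl {c [^] p} <+>\<^bsub>R\<^esub> Idl (pw A)) (carrier R)"
proof -
  let ?T = "gsp (pw A) bs" and ?G = "gsp S bs" and ?F = "Idl (pw A)"
  note s = smods[OF A]
  note GF = smod_add[OF s(2,3) S_carrier] and up = set_add_upper[OF s(2,3)]
  have "len S ?F (carrier R) = len S ?F (?G <+>\<^bsub>R\<^esub> ?F) + len S (?G <+>\<^bsub>R\<^esub> ?F) (carrier R)"
    by (rule len_add[OF S_carrier s(3) GF s(4) up(2) smodD(1)[OF GF]])
  also have "len S ?F (?G <+>\<^bsub>R\<^esub> ?F) \<le> len S ?T ?G"
    by (rule len_quotient[OF s(1,2,3) GF gsp_pw_sub_Idl[OF A] gsp_mono[OF pw_sub_S[OF A]] up(1) order_refl])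
  also have "\<dots> \<le> of_nat (length bs) * colen A" by (rule len_gsp_le[OF A bs])
  also have "len S (?G <+>\<^bsub>R\<^esub> ?F) (carrier R) \<le> len S (Idl {c [^] p} <+>\<^bsub>R\<^esub> ?F) (carrier R)"
  proof (rule chain_len_mono)
    show "Idl {c [^] p} <+>\<^bsub>R\<^esub> ?F \<subseteq> ?G <+>\<^bsub>R\<^esub> ?F"
      by (rule set_add_least[OF GF]) (use cR_sub up in auto)
  qed simp
  finally show ?thesis by (simp add: add_mono)
qed

text \<open>Independence gives r l(R/A) \<le> l(G/T). Insert c^p R + T between T and G:
  multiplication by c^p maps R/F onto the lower piece. The upper piece is a quotient of G modulo the
  module built from cR + A, because (cr + a)^p = c^p r^p + a^p.\<close>

lemma frob_lower:
  assumes A: "ideal A R"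
  shows "of_nat (length bs) * colen A \<le>
    len S (Idl (pw A)) (carrier R) + of_nat (length bs) * colen (Idl {c} <+>\<^bsub>R\<^esub> A)"
proof -
  let ?T = "gsp (pw A) bs" and ?G = "gsp S bs" and ?F = "Idl (pw A)" and ?C = "Idl {c [^] p}"
  have C: "ideal (Idl {c}) R" by (rule genideal_ideal) (use c in auto)
  let ?B = "Idl {c} <+>\<^bsub>R\<^esub> A"
  have B: "ideal ?B R" by (rule ideal_sum(1)[OF C A])
  note s = smods[OF A]
  note CT = smod_add[OF s(5,1) S_carrier] and up = set_add_upper[OF s(5,1)]
  have TG: "?T \<subseteq> ?G" by (rule gsp_mono[OF pw_sub_S[OF A]])
  have CG: "?C <+>\<^bsub>R\<^esub> ?T \<subseteq> ?G" by (rule set_add_least[OF s(2) cR_sub TG])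
  have cp: "c [^] p \<in> carrier R" using c by simp
  have "of_nat (length bs) * colen A \<le> len S ?T ?G" by (rule len_gsp_ge[OF A bs ind])
  also have "\<dots> = len S ?T (?C <+>\<^bsub>R\<^esub> ?T) + len S (?C <+>\<^bsub>R\<^esub> ?T) ?G"
    by (rule len_add[OF S_carrier s(1) CT s(2) up(2) CG])
  also have "len S ?T (?C <+>\<^bsub>R\<^esub> ?T) \<le> len S ?F (carrier R)"
  proof (rule len_mult_surj[OF S_carrier s(3,4,1) CT smodD(1)[OF s(3)] cp])
    fix x assume x: "x \<in> ?F"
    \<comment> \<open>T is only an \<open>S\<close>-module. Demanding the condition for all
      multiples of y makes \<open>?N\<close> an ideal, so that F can be tested on its generators,
      the p-th powers of elements of A.\<close>
    let ?N = "{y \<in> carrier R. \<forall>r\<in>carrier R. c [^] p \<otimes> (r \<otimes> y) \<in> ?T}"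
    have "ideal ?N R" unfolding ideal_iff_smod smod_def
    proof (intro conjI ballI)
      note T = smodD[OF s(1)]
      show "?N \<subseteq> carrier R" by auto
      show "\<zero> \<in> ?N" using T(2) cp by simp
      fix y assume y: "y \<in> ?N"
      show "y \<oplus> z \<in> ?N" if z: "z \<in> ?N" for z
        using y z T(3) cp by (simp add: r_distr)
      show "\<ominus> y \<in> ?N" using y T(4) cp by (simp add: r_minus)
      show "t \<otimes> y \<in> ?N" if t: "t \<in> carrier R" for t
      proof -
        have "c [^] p \<otimes> (r \<otimes> (t \<otimes> y)) \<in> ?T" if r: "r \<in> carrier R" for r
        proof -
          have "r \<otimes> (t \<otimes> y) = (r \<otimes> t) \<otimes> y" using r t y by (simp add: m_assoc)
          then show ?thesis using y r t by simp
        qed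
        then show ?thesis using y t by simp
      qed
    qed
    moreover have "pw A \<subseteq> ?N"
    proof
      fix y assume y: "y \<in> pw A"
      have yc: "y \<in> carrier R" using y pw_carrier[OF A] by blast
      have "c [^] p \<otimes> (r \<otimes> y) \<in> ?T" if r: "r \<in> carrier R" for r
      proof -
        \<comment> \<open>Multiplication by a p-th power y of an element of A maps G into T, and c^p
          r lies in G by the choice of c.\<close>
        let ?M = "{z \<in> carrier R. y \<otimes> z \<in> ?T}"
        have "?G \<subseteq> ?M"
        proof (rule gsp_least)
          note T = smodD[OF s(1)]
          show "smod S ?M" unfolding smod_def
          proof (intro conjI ballI)
            show "\<zero> \<in> ?M" using T(2) yc by simp
            fix z assume z: "z \<in> ?M"
            show "z \<oplus> w \<in> ?M" if "w \<in> ?M" for w using z that T(3) yc by (simp add: r_distr)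
            show "\<ominus> z \<in> ?M" using z T(4) yc by (simp add: r_minus)
            show "t \<otimes> z \<in> ?M" if "t \<in> S" for t
            proof -
              have tc: "t \<in> carrier R" using that S_carrier by blast
              have "y \<otimes> (t \<otimes> z) = t \<otimes> (y \<otimes> z)" using z tc yc by (simp add: m_lcomm)
              then show ?thesis using z tc T(6)[OF that, of "y \<otimes> z"] by simp
            qed
          qed auto
          fix t b assume t: "t \<in> S" and b: "b \<in> set bs"
          have tb: "t \<in> carrier R" "b \<in> carrier R" using t b S_carrier bs by auto
          have "(t \<otimes> y) \<otimes> b \<in> ?T" by (rule gsp_gen[OF smod_pw[OF A] bs S_pw[OF A t y] b])
          moreover have "y \<otimes> (t \<otimes> b) = (t \<otimes> y) \<otimes> b" using tb yc by (simp add: m_ac)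
          ultimately show "t \<otimes> b \<in> ?M" using tb by simp
        qed
        then have "y \<otimes> (c [^] p \<otimes> r) \<in> ?T" using cG[OF r] by auto
        moreover have "c [^] p \<otimes> (r \<otimes> y) = y \<otimes> (c [^] p \<otimes> r)" using cp r yc by (simp add: m_ac)
        ultimately show ?thesis by simp
      qed
      then show "y \<in> ?N" using yc by simp
    qed
    ultimately have "?F \<subseteq> ?N" by (rule genideal_minimal)
    then have "x \<in> ?N" using x by blast
    then have "c [^] p \<otimes> (\<one> \<otimes> x) \<in> ?T" using one_closed by blast
    then show "c [^] p \<otimes> x \<in> ?T" using \<open>x \<in> ?N\<close> by simp
  next
    fix x assume x: "x \<in> carrier R"
    then have "c [^] p \<otimes> x \<in> ?C" using Idl_principal[OF cp] by blast
    then show "c [^] p \<otimes> x \<in> ?C <+>\<^bsub>R\<^esub> ?T" using up(1) by blast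
  next
    fix y assume "y \<in> ?C <+>\<^bsub>R\<^esub> ?T"
    then show "\<exists>x\<in>carrier R. \<exists>z\<in>?T. y = c [^] p \<otimes> x \<oplus> z"
      unfolding set_add_iff Idl_principal[OF cp] by blast
  qed
  also have "len S (?C <+>\<^bsub>R\<^esub> ?T) ?G \<le> len S (gsp (pw ?B) bs) ?G"
  proof (rule chain_len_mono[OF _ order_refl])
    show "gsp (pw ?B) bs \<subseteq> ?C <+>\<^bsub>R\<^esub> ?T"
    proof (rule gsp_least[OF CT])
      fix t b assume t: "t \<in> pw ?B" and b: "b \<in> set bs"
      have bc: "b \<in> carrier R" using b bs by blast
      obtain x where x: "x \<in> ?B" "t = x [^] p" using t by (auto simp: pw_def)
      obtain r a where ra: "r \<in> carrier R" "a \<in> A" "t = (c \<otimes> r \<oplus> a) [^] p"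
        using x unfolding Idl_principal[OF c] by (auto simp: set_add_iff)
      have ac: "a \<in> carrier R" by (rule ideal.Icarr[OF A ra(2)])
      have "t = c [^] p \<otimes> r [^] p \<oplus> a [^] p"
        unfolding ra(3) using c ra(1) ac by (simp add: frob_add nat_pow_distrib)
      then have "t \<otimes> b = c [^] p \<otimes> (r [^] p \<otimes> b) \<oplus> a [^] p \<otimes> b"
        using c ra(1) ac bc by (simp add: l_distr m_assoc)
      moreover have "c [^] p \<otimes> (r [^] p \<otimes> b) \<in> ?C" using Idl_principal[OF cp] ra(1) bc by auto
      moreover have "a [^] p \<otimes> b \<in> ?T" by (rule gsp_gen[OF smod_pw[OF A] bs _ b]) (use ra in \<open>auto simp: pw_def\<close>)
      ultimately show "t \<otimes> b \<in> ?C <+>\<^bsub>R\<^esub> ?T" unfolding set_add_iff by blast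
    qed
  qed
  also have "\<dots> \<le> of_nat (length bs) * colen ?B" by (rule len_gsp_le[OF B bs])
  finally show ?thesis by (simp add: add_mono)
qed

end

end

section \<open>F-finite local domains over their subring of p-th powers\<close>

locale frob_setting = noetherian_domain R + char_domain R p
  for R (structure) and p +
  fixes m
  assumes local: "local_ring R m" and ff: "F_finite R p"
begin

lemma maximal_m: "maximalideal m R"
  using local by (simp add: local_ring_def)

lemma ideal_m: "ideal m R"
  using maximalideal.axioms(1)[OF maximal_m] .

text \<open>Finite generation over \<open>S\<close> in the form in which it is used: a membership t
  x \<in> N has to be checked only for finitely many x.\<close>

lemma F_finite_gens:
  "\<exists>Bs. set Bs \<subseteq> carrier R \<and>
    (\<forall>N t x. smod S N \<longrightarrow> t \<in> carrier R \<longrightarrow> x \<in> carrier R \<longrightarrow> (\<forall>b\<in>set Bs. t \<otimes> b \<in> N) \<longrightarrow> t \<otimes> x \<in> N)"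
proof -
  obtain B where B: "finite B" "B \<subseteq> carrier R"
    "\<And>x. x \<in> carrier R \<Longrightarrow> \<exists>h\<in>B \<rightarrow> carrier R. x = (\<Oplus>b\<in>B. h b [^] p \<otimes> b)"
    using ff unfolding F_finite_def finite_ring_hom_def by blast
  obtain Bs where Bs: "set Bs = B" using finite_list[OF B(1)] by blast
  have "t \<otimes> x \<in> N" if N: "smod S N" "t \<in> carrier R" "x \<in> carrier R" "\<forall>b\<in>set Bs. t \<otimes> b \<in> N" for N t x
  proof -
    obtain h where h: "h \<in> B \<rightarrow> carrier R" "x = (\<Oplus>b\<in>B. h b [^] p \<otimes> b)" using B(3)[OF N(3)] by blast
    have c: "h b \<in> carrier R" "b \<in> carrier R" if "b \<in> B" for b using h(1) B(2) that by auto
    have "t \<otimes> x = (\<Oplus>b\<in>B. t \<otimes> (h b [^] p \<otimes> b))"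
      unfolding h(2) by (rule finsum_rdistr[OF B(1) N(2)]) (use c in auto)
    also have "\<dots> \<in> N"
    proof (rule smod_finsum[OF N(1) B(1)])
      fix b assume b: "b \<in> B"
      have "t \<otimes> (h b [^] p \<otimes> b) = h b [^] p \<otimes> (t \<otimes> b)" using c[OF b] N(2) by (simp add: m_lcomm)
      moreover have "h b [^] p \<in> S" using c[OF b] by (auto simp: pw_def)
      ultimately show "t \<otimes> (h b [^] p \<otimes> b) \<in> N" using smodD(6)[OF N(1)] N(4) b Bs by simp
    qed
    finally show ?thesis .
  qed
  then show ?thesis using Bs B(2) by (intro exI[of _ Bs]) auto
qed

text \<open>R is spanned over \<open>S\<close> by finitely many elements, and each contributes at
  most l(R/m) = 1 to R/m. This length is the residue degree f.\<close>

lemma len_S_m_finite: "len S m (carrier R) \<noteq> \<infinity>"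
proof -
  obtain Bs where Bs: "set Bs \<subseteq> carrier R"
    and gen: "\<And>N t x. smod S N \<Longrightarrow> t \<in> carrier R \<Longrightarrow> x \<in> carrier R \<Longrightarrow> (\<forall>b\<in>set Bs. t \<otimes> b \<in> N) \<Longrightarrow> t \<otimes> x \<in> N"
    using F_finite_gens by blast
  have sG: "smod S (gsp S Bs)" by (rule smod_gsp[OF smod_S Bs])
  have "\<one> \<otimes> x \<in> gsp S Bs" if "x \<in> carrier R" for x
    by (rule gen[OF sG one_closed that]) (use gsp_gen[OF smod_S Bs one_S] in auto)
  then have G: "gsp S Bs = carrier R" using smodD(1)[OF sG] by auto
  have sm: "smod S m" by (rule ideal_imp_smod[OF ideal_m S_carrier])
  have "pw m \<subseteq> m"
  proof
    fix x assume "x \<in> pw m"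
    then obtain y where y: "y \<in> m" "x = y [^] p" by (auto simp: pw_def)
    have yc: "y \<in> carrier R" by (rule ideal.Icarr[OF ideal_m y(1)])
    obtain q where "p = Suc q" using p_pos by (cases p) auto
    then show "x \<in> m" using y yc ideal.I_l_closed[OF ideal_m y(1), of "y [^] q"] by simp
  qed
  then have "gsp (pw m) Bs \<subseteq> m"
    by (intro gsp_least[OF sm]) (use ideal.I_r_closed[OF ideal_m] Bs in blast)
  then have "len S m (carrier R) \<le> len S (gsp (pw m) Bs) (gsp S Bs)" unfolding G by (rule chain_len_mono) simp
  also have "\<dots> \<le> of_nat (length Bs) * colen m" by (rule len_gsp_le[OF ideal_m Bs])
  also have "\<dots> = enat (length Bs)" unfolding colen_maximal[OF maximal_m] by (simp add: of_nat_eq_enat)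
  finally show ?thesis by (cases "len S m (carrier R)") auto
qed

lemma len_S_m_pos: "len S m (carrier R) \<noteq> 0"
proof -
  have "chain_len (smod S) m m + 1 \<le> len S m (carrier R)"
    by (rule chain_len_extend)
      (use ideal_imp_smod[OF ideal_m S_carrier] ideal_imp_smod[OF oneideal S_carrier] ideal_subset_carrier[OF ideal_m]
        maximalideal.I_notcarr[OF maximal_m] in auto)
  then show ?thesis by auto
qed

lemma colen_zero_iff: "ideal A R \<Longrightarrow> colen A = 0 \<longleftrightarrow> A = carrier R"
proof
  assume A: "ideal A R" "colen A = 0"
  show "A = carrier R"
  proof (rule ccontr)
    assume "A \<noteq> carrier R"
    then have "A \<subset> carrier R" using ideal_subset_carrier[OF A(1)] by blast
    then have "chain_len (smod (carrier R)) A A + 1 \<le> colen A"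
      by (intro chain_len_extend) (use A oneideal in \<open>auto simp: ideal_iff_smod\<close>)
    then show False using A(2) by simp
  qed
qed simp

text \<open>B/A is simple, so b generates it and its annihilator is a maximal ideal; in a local ring
  this can only be m.\<close>

lemma colon_of_simple:
  assumes A: "ideal A R" and B: "ideal B R" "A \<subset> B"
    and min: "\<And>C. ideal C R \<Longrightarrow> A \<subset> C \<Longrightarrow> C \<subseteq> B \<Longrightarrow> C = B"
    and b: "b \<in> B" "b \<notin> A"
  shows "{r \<in> carrier R. b \<otimes> r \<in> A} = m"
proof -
  have bc: "b \<in> carrier R" by (rule ideal.Icarr[OF B(1) b(1)])
  let ?C = "{r \<in> carrier R. b \<otimes> r \<in> A}"
  have C: "ideal ?C R" by (rule ideal_colon[OF A bc])
  have "maximalideal ?C R"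
  proof (rule maximalidealI[OF C])
    show "carrier R \<noteq> ?C"
    proof
      assume "carrier R = ?C"
      then have "\<one> \<in> ?C" using one_closed by blast
      then show False using b bc by simp
    qed
    fix N assume N: "ideal N R" "?C \<subseteq> N" "N \<subseteq> carrier R"
    show "N = ?C \<or> N = carrier R"
    proof (cases "N = ?C")
      case False
      then obtain r where r: "r \<in> N" "r \<notin> ?C" using N by blast
      have rc: "r \<in> carrier R" using r N by blast
      have rb: "r \<otimes> b \<in> carrier R" "r \<otimes> b \<notin> A" using rc bc r m_comm by auto
      have "r \<otimes> b \<in> B" by (rule ideal.I_l_closed[OF B(1) b(1) rc])
      then have "Idl (insert (r \<otimes> b) A) \<subseteq> B" using B by (intro genideal_minimal) auto
      then have "Idl (insert (r \<otimes> b) A) = B"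
        using min[OF ideal_insert(1)[OF A rb(1)]] ideal_insert(2,3)[OF A rb(1)] rb(2) by blast
      then obtain a t where at: "a \<in> A" "t \<in> carrier R" "b = a \<oplus> (r \<otimes> b) \<otimes> t"
        using ideal_insert(4)[OF A rb(1)] b(1) by blast
      have ac: "a \<in> carrier R" by (rule ideal.Icarr[OF A at(1)])
      have "b \<otimes> (\<one> \<ominus> r \<otimes> t) = b \<ominus> (r \<otimes> b) \<otimes> t"
        using bc rc at(2) by (simp add: a_minus_def r_distr r_minus m_ac)
      also have "\<dots> = a"
      proof -
        have "b \<ominus> (r \<otimes> b) \<otimes> t = (a \<oplus> (r \<otimes> b) \<otimes> t) \<ominus> (r \<otimes> b) \<otimes> t" using at(3) by simp
        also have "\<dots> = a" using ac bc rc at(2) by (simp add: a_minus_def a_assoc r_neg)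
        finally show ?thesis .
      qed
      finally have "\<one> \<ominus> r \<otimes> t \<in> ?C" using at rc by simp
      then have 1: "\<one> \<ominus> r \<otimes> t \<in> N" using N by blast
      have 2: "r \<otimes> t \<in> N" by (rule ideal.I_r_closed[OF N(1) r(1) at(2)])
      have "(\<one> \<ominus> r \<otimes> t) \<oplus> r \<otimes> t \<in> N"
        using smodD(3)[OF N(1)[unfolded ideal_iff_smod] 1 2] .
      then have "\<one> \<in> N" using rc at(2) by (simp add: a_minus_def a_assoc l_neg)
      then show ?thesis using ideal.one_imp_carrier[OF N(1)] by simp
    qed simp
  qed
  then show "?C = m" using local by (simp add: local_ring_def)
qed

text \<open>Among the ideals strictly above A, one of greatest colength is minimal, so its quotient
  by A is simple.\<close>

lemma exists_simple_extension:
  assumes A: "ideal A R" and "A \<noteq> carrier R" and fin: "colen A \<noteq> \<infinity>"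
  shows "\<exists>b\<in>carrier R. b \<notin> A \<and> {r \<in> carrier R. b \<otimes> r \<in> A} = m"
proof -
  let ?Q = "\<lambda>k. \<exists>B. ideal B R \<and> A \<subset> B \<and> colen B = enat k"
  obtain n where n: "colen A = enat n" using fin by auto
  have "A \<subset> carrier R" using ideal_subset_carrier[OF A] assms(2) by blast
  then have "?Q 0" using oneideal by (intro exI[of _ "carrier R"]) (simp add: zero_enat_def)
  moreover have "k \<le> n" if "?Q k" for k
    using that colen_antimono[of A] n by (metis enat_ord_simps(1) psubset_imp_subset)
  ultimately have "\<exists>k. ?Q k \<and> (\<forall>j. ?Q j \<longrightarrow> j \<le> k)"
    using ex_has_greatest_nat[of ?Q 0 "\<lambda>k. k" "Suc n"] by (simp add: less_Suc_eq_le)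
  then obtain k where "?Q k \<and> (\<forall>j. ?Q j \<longrightarrow> j \<le> k)" by (elim exE)
  then have k: "?Q k" "\<And>j. ?Q j \<Longrightarrow> j \<le> k" by simp_all
  then obtain B where B: "ideal B R" "A \<subset> B" "colen B = enat k" by blast
  have min: "C = B" if C: "ideal C R" "A \<subset> C" "C \<subseteq> B" for C
  proof (rule ccontr)
    assume "C \<noteq> B"
    then have CB: "C \<subset> B" using C by blast
    have "len (carrier R) C C + 1 \<le> len (carrier R) C B"
      by (rule chain_len_extend) (use CB C B in \<open>auto simp: ideal_iff_smod\<close>)
    then have "1 + colen B \<le> len (carrier R) C B + colen B" by (simp add: add_right_mono)
    also have "\<dots> = colen C"
      by (rule len_ideal_add[symmetric]) (use C B oneideal ideal_subset_carrier in auto)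
    finally have 1: "1 + enat k \<le> colen C" using B by simp
    have "colen C \<le> enat n" using colen_antimono[of A C] C n by auto
    then obtain j where j: "colen C = enat j" using enat_ile by blast
    then have "j \<le> k" using k(2) C by blast
    then show False using 1 j by (simp add: one_enat_def)
  qed
  obtain b where b: "b \<in> B" "b \<notin> A" using B by blast
  show ?thesis
    using b ideal.Icarr[OF B(1) b(1)] colon_of_simple[OF A B(1,2) min b] by blast
qed

text \<open>If \<open>B\<close> is a maximal proper subideal of \<open>N\<close>, then \<open>m\<close> annihilates \<open>N/B\<close>.\<close>

lemma nakayama:
  assumes N: "ideal N R" "N \<noteq> {\<zero>}" and J: "ideal J R" "J \<subseteq> m"
  shows "\<not> N \<subseteq> J \<cdot> N"
proof
  assume sub: "N \<subseteq> J \<cdot> N"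
  have "\<zero> \<in> N" using smodD(2) N(1) ideal_iff_smod by blast
  then have zN: "{\<zero>} \<subset> N" using N(2) by blast
  obtain B where "ideal B R \<and> {\<zero>} \<subseteq> B \<and> B \<subset> N \<and> (\<forall>C. ideal C R \<longrightarrow> B \<subset> C \<longrightarrow> \<not> C \<subset> N)"
    using ideal_maximal_with[of "{\<zero>}" "\<lambda>B. B \<subset> N", OF zeroideal zN] by (elim exE)
  then have B: "ideal B R" "B \<subset> N" and max: "\<And>C. ideal C R \<Longrightarrow> B \<subset> C \<Longrightarrow> C \<subseteq> N \<Longrightarrow> C = N" by auto
  have "J \<cdot> N \<subseteq> B"
  proof (rule ideal_prod_least[OF B(1)])
    fix i z assume iz: "i \<in> J" "z \<in> N"
    have c: "i \<in> carrier R" "z \<in> carrier R" using ideal.Icarr[OF J(1) iz(1)] ideal.Icarr[OF N(1) iz(2)] by auto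
    show "i \<otimes> z \<in> B"
    proof (cases "z \<in> B")
      case True
      then show ?thesis using ideal.I_l_closed[OF B(1) _ c(1)] by blast
    next
      case False
      have "{r \<in> carrier R. z \<otimes> r \<in> B} = m"
        by (rule colon_of_simple[OF B(1) N(1) B(2) _ iz(2) False]) (rule max)
      then have "z \<otimes> i \<in> B" using J(2) iz(1) by auto
      then show ?thesis using c by (simp add: m_comm)
    qed
  qed
  then show False using sub B(2) by blast
qed

text \<open>Every composition factor of R/A is a copy of R/m, whose length over \<open>S\<close> is
  f; the proof is an induction on the colength.\<close>

lemma len_S_colen:
  assumes "ideal A R" "colen A \<noteq> \<infinity>"
  shows "len S A (carrier R) = len S m (carrier R) * colen A"
proof -
  have "len S A (carrier R) = len S m (carrier R) * enat n" if "ideal A R" "colen A = enat n" for n A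
    using that
  proof (induction n arbitrary: A)
    case 0
    then have "A = carrier R" using colen_zero_iff by (simp add: zero_enat_def)
    then show ?case by (simp flip: zero_enat_def)
  next
    case (Suc n A)
    note A = Suc.prems(1)
    have "A \<noteq> carrier R" using Suc.prems colen_zero_iff[OF A] by (auto simp: zero_enat_def)
    then obtain b where b: "b \<in> carrier R" "b \<notin> A" and Cm: "{r \<in> carrier R. b \<otimes> r \<in> A} = m"
      using exists_simple_extension[OF A] Suc.prems(2) by auto
    let ?B = "Idl (insert b A)"
    note B = ideal_insert[OF A b(1)]
    have AB: "len T A ?B = len T m (carrier R)" if T: "T \<subseteq> carrier R" for T
    proof (rule antisym)
      note s = ideal_imp_smod[OF A T] ideal_imp_smod[OF B(1) T] ideal_imp_smod[OF ideal_m T] ideal_imp_smod[OF oneideal T]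
      have bB: "b \<otimes> x \<in> ?B" if "x \<in> carrier R" for x by (rule ideal.I_r_closed[OF B(1,3) that])
      show "len T A ?B \<le> len T m (carrier R)"
      proof (rule len_mult_surj[OF T s(3,4,1,2) ideal_subset_carrier[OF ideal_m] b(1)])
        show "b \<otimes> x \<in> A" if "x \<in> m" for x using that Cm by blast
        fix y assume "y \<in> ?B"
        then obtain x r where xr: "x \<in> A" "r \<in> carrier R" "y = x \<oplus> b \<otimes> r" using B(4) by blast
        have "y = b \<otimes> r \<oplus> x" unfolding xr(3) using ideal.Icarr[OF A xr(1)] b xr(2) by (simp add: a_comm)
        then show "\<exists>x\<in>carrier R. \<exists>z\<in>A. y = b \<otimes> x \<oplus> z" using xr by blast
      qed (rule bB)
      show "len T m (carrier R) \<le> len T A ?B"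
        by (rule len_mult_inj[OF T s(3,4,1,2) B(2) b(1) _ bB]) (use Cm in blast)
    qed
    have add: "len T A (carrier R) = len T m (carrier R) + len T ?B (carrier R)" if T: "T \<subseteq> carrier R" for T
      using len_add[OF T ideal_imp_smod[OF A T] ideal_imp_smod[OF B(1) T] ideal_imp_smod[OF oneideal T] B(2)
          ideal_subset_carrier[OF B(1)]] AB[OF T] by simp
    have "colen A = 1 + colen ?B" using add[OF order_refl] colen_maximal[OF maximal_m] by simp
    then have "colen ?B = enat n" using Suc.prems(2) by (cases "colen ?B") (auto simp: one_enat_def)
    then have "len S ?B (carrier R) = len S m (carrier R) * enat n" using Suc.IH B(1) by blast
    then show ?case using add[OF S_carrier] by (simp add: eSuc_enat[symmetric] mult_eSuc_right)
  qed
  then show ?thesis using assms by (cases "colen A") auto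
qed

text \<open>The bounds of \<open>frob_upper\<close> and \<open>frob_lower\<close>, with lengths over
  \<open>S\<close> rewritten as f times lengths over R. The error terms belong to ideals containing
  c or c^p and will turn out to be of lower order.\<close>

theorem frobenius_comparison:
  "\<exists>f r c. f > (0::nat) \<and> c \<in> carrier R \<and> c \<noteq> \<zero> \<and> (\<forall>A. ideal A R \<longrightarrow> colen (frobenius_power R A p) \<noteq> \<infinity> \<longrightarrow>
    enat f * colen (frobenius_power R A p) \<le>
      enat r * colen A + enat f * colen (Idl {c [^] p} <+>\<^bsub>R\<^esub> frobenius_power R A p) \<and>
    enat r * colen A \<le>
      enat f * colen (frobenius_power R A p) + enat r * colen (Idl {c} <+>\<^bsub>R\<^esub> A))"
proof -
  obtain Bs where Bs: "set Bs \<subseteq> carrier R"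
    and gen: "\<And>N t x. smod S N \<Longrightarrow> t \<in> carrier R \<Longrightarrow> x \<in> carrier R \<Longrightarrow> (\<forall>b\<in>set Bs. t \<otimes> b \<in> N) \<Longrightarrow> t \<otimes> x \<in> N"
    using F_finite_gens by blast
  obtain bs where bs: "set bs \<subseteq> carrier R" "indep bs"
    "\<And>b. b \<in> set Bs \<Longrightarrow> \<exists>s\<in>carrier R. s \<noteq> \<zero> \<and> s [^] p \<otimes> b \<in> gsp S bs"
    using exists_indep[OF Bs] by blast
  have sG: "smod S (gsp S bs)" by (rule smod_gsp[OF smod_S bs(1)])
  obtain c where c: "c \<in> carrier R" "c \<noteq> \<zero>" "\<forall>b\<in>set Bs. c [^] p \<otimes> b \<in> gsp S bs"
    using common_multiplier[OF sG Bs bs(3)] by blast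
  have cG: "c [^] p \<otimes> x \<in> gsp S bs" if "x \<in> carrier R" for x
    by (rule gen[OF sG _ that c(3)]) (use c in simp)
  obtain f where f: "len S m (carrier R) = enat f" using len_S_m_finite by auto
  have "f > 0" using len_S_m_pos f by (cases f) (auto simp: zero_enat_def)
  moreover have "enat f * colen (frobenius_power R A p) \<le>
      enat (length bs) * colen A + enat f * colen (Idl {c [^] p} <+>\<^bsub>R\<^esub> frobenius_power R A p) \<and>
    enat (length bs) * colen A \<le>
      enat f * colen (frobenius_power R A p) + enat (length bs) * colen (Idl {c} <+>\<^bsub>R\<^esub> A)"
    if A: "ideal A R" and fin: "colen (frobenius_power R A p) \<noteq> \<infinity>" for A
  proof -
    let ?F = "Idl (pw A)"
    note s = smods[OF bs(1,2) c(1) cG A]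
    have cF: "ideal (Idl {c [^] p} <+>\<^bsub>R\<^esub> ?F) R" and sub: "?F \<subseteq> Idl {c [^] p} <+>\<^bsub>R\<^esub> ?F"
      using ideal_sum[OF s(7,6)] by auto
    have fin': "colen (Idl {c [^] p} <+>\<^bsub>R\<^esub> ?F) \<noteq> \<infinity>"
      using colen_antimono[OF sub] fin
      by (cases "colen (Idl {c [^] p} <+>\<^bsub>R\<^esub> ?F)") (auto simp: frobenius_power_p)
    show ?thesis
      using frob_upper[OF bs(1,2) c(1) cG A] frob_lower[OF bs(1,2) c(1) cG A]
        len_S_colen[OF s(6)] fin len_S_colen[OF cF fin'] f
      by (simp add: frobenius_power_p of_nat_eq_enat)
  qed
  ultimately show ?thesis using c by blast
qed

end

section \<open>Asymptotics of lattice point sums\<close>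

text \<open>The value of \<sigma> is unknown, so all cases are covered: for \<sigma> = 1 the
  increments are summable, for \<sigma> < 1 the sequence decays, and for \<sigma> > 1 boundedness
  forces it to decay as well.\<close>

lemma perturbed_geometric_convergent:
  fixes b :: "nat \<Rightarrow> real"
  assumes b: "\<And>n. 0 \<le> b n" "\<And>n. b n \<le> B" and r: "0 < r" "r < 1" and \<sigma>: "0 \<le> \<sigma>"
    and step: "\<And>n. \<bar>b (Suc n) - \<sigma> * b n\<bar> \<le> C * r ^ n"
  shows "convergent b"
proof -
  have C: "0 \<le> C" using order_trans[OF abs_ge_zero step[of 0]] by simp
  consider "\<sigma> = 1" | "\<sigma> < 1" | "\<sigma> > 1" by linarith
  then show ?thesis
  proof cases
    case 1
    have "summable (\<lambda>n. C * r ^ n)" using r by (intro summable_mult summable_geometric) auto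
    then have "summable (\<lambda>n. b (Suc n) - b n)"
      by (rule summable_comparison_test'[where N = 0]) (use step 1 in auto)
    then have "convergent (\<lambda>n. \<Sum>k<n. b (Suc k) - b k)" by (simp add: summable_iff_convergent)
    then have "convergent (\<lambda>n. b n - b 0)" by (simp add: sum_lessThan_telescope)
    then have "convergent (\<lambda>n. b n - b 0 + b 0)" by (intro convergent_add convergent_const)
    then show ?thesis by simp
  next
    case 2
    define \<tau> where "\<tau> = max \<sigma> r"
    have \<tau>: "0 < \<tau>" "\<tau> < 1" "\<sigma> \<le> \<tau>" "r \<le> \<tau>" using 2 r by (auto simp: \<tau>_def)
    \<comment> \<open>The factor n appears because both geometric sequences are estimated by the
      larger base \<tau>. Multiplying through by \<tau> avoids the exponent n - 1.\<close>
    have le: "\<tau> * b n \<le> \<tau> * \<tau> ^ n * b 0 + C * (real n * \<tau> ^ n)" for n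
    proof (induction n)
      case (Suc n)
      have "b (Suc n) \<le> \<sigma> * b n + C * r ^ n" using step[of n] by (simp add: abs_le_iff)
      also have "\<dots> \<le> \<tau> * b n + C * \<tau> ^ n"
        using b(1)[of n] \<tau> r C by (intro add_mono mult_right_mono mult_left_mono power_mono) auto
      finally have "\<tau> * b (Suc n) \<le> \<tau> * (\<tau> * b n + C * \<tau> ^ n)" using \<tau> by simp
      also have "\<dots> \<le> \<tau> * (\<tau> * \<tau> ^ n * b 0 + C * (real n * \<tau> ^ n) + C * \<tau> ^ n)"
        using Suc \<tau> by simp
      also have "\<dots> = \<tau> * \<tau> ^ Suc n * b 0 + C * (real (Suc n) * \<tau> ^ Suc n)" by (simp add: algebra_simps)
      finally show ?case .
    qed simp
    have "(\<lambda>n. real n * \<tau> ^ n) \<longlonglongrightarrow> 0" using \<tau> powser_times_n_limit_0[of \<tau>] by simp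
    moreover have "(\<lambda>n. \<tau> ^ n) \<longlonglongrightarrow> 0" using \<tau> by (intro LIMSEQ_power_zero) auto
    ultimately have "(\<lambda>n. (\<tau> * \<tau> ^ n * b 0 + C * (real n * \<tau> ^ n)) / \<tau>) \<longlonglongrightarrow> (\<tau> * 0 * b 0 + C * 0) / \<tau>"
      using \<tau> by (intro tendsto_intros) auto
    then have lim: "(\<lambda>n. (\<tau> * \<tau> ^ n * b 0 + C * (real n * \<tau> ^ n)) / \<tau>) \<longlonglongrightarrow> 0" by simp
    have "b n \<le> (\<tau> * \<tau> ^ n * b 0 + C * (real n * \<tau> ^ n)) / \<tau>" for n
      using le[of n] \<tau> by (simp add: pos_le_divide_eq mult.commute)
    then have "b \<longlonglongrightarrow> 0"
      by (intro tendsto_sandwich[OF _ _ tendsto_const lim]) (use b in auto)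
    then show ?thesis by (auto simp: convergent_def)
  next
    case 3
    \<comment> \<open>\<open>D\<close> is chosen so that x = \<open>D * r ^ n\<close> solves the
      extremal recursion x' = \<sigma> x - C r^n. The difference \<open>b n - D * r ^ n\<close> then
      grows by at least the factor \<sigma>, which boundedness excludes unless it is
      nonpositive.\<close>
    define D where "D = C / (\<sigma> - r)"
    have D: "C + D * r = D * \<sigma>" "D \<ge> 0" using 3 r C by (auto simp: D_def field_simps)
    have g: "\<sigma> * (b n - D * r ^ n) \<le> b (Suc n) - D * r ^ Suc n" for n
    proof -
      have "\<sigma> * b n - C * r ^ n \<le> b (Suc n)" using step[of n] by (simp add: abs_le_iff)
      moreover have "(C + D * r) * r ^ n = D * \<sigma> * r ^ n" using D by simp
      ultimately show ?thesis by (simp add: algebra_simps)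
    qed
    have it: "\<sigma> ^ k * (b n - D * r ^ n) \<le> b (n + k) - D * r ^ (n + k)" for k n
    proof (induction k)
      case (Suc k)
      have "\<sigma> ^ Suc k * (b n - D * r ^ n) \<le> \<sigma> * (b (n + k) - D * r ^ (n + k))"
        using mult_left_mono[OF Suc, of \<sigma>] 3 by (simp add: ac_simps)
      also have "\<dots> \<le> b (n + Suc k) - D * r ^ (n + Suc k)" using g[of "n + k"] by simp
      finally show ?case .
    qed simp
    have "b n - D * r ^ n \<le> 0" for n
    proof -
      have "b n - D * r ^ n \<le> B * (1 / \<sigma>) ^ k" for k
      proof -
        have "\<sigma> ^ k * (b n - D * r ^ n) \<le> B"
          using it[of k n] b(2)[of "n + k"] D r by (smt (verit) mult_nonneg_nonneg zero_le_power)
        then show ?thesis using 3 by (simp add: power_divide pos_le_divide_eq mult.commute)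
      qed
      moreover have "(\<lambda>k. B * (1 / \<sigma>) ^ k) \<longlonglongrightarrow> B * 0"
        using 3 by (intro tendsto_intros LIMSEQ_power_zero) auto
      ultimately show ?thesis by (intro LIMSEQ_le_const[of "\<lambda>k. B * (1 / \<sigma>) ^ k"]) auto
    qed
    then have "b n \<le> D * r ^ n" for n by (simp add: algebra_simps)
    moreover have "(\<lambda>n. D * r ^ n) \<longlonglongrightarrow> D * 0" using r by (intro tendsto_intros LIMSEQ_power_zero) auto
    ultimately have "b \<longlonglongrightarrow> 0"
      by (intro tendsto_sandwich[of "\<lambda>_. 0" b _ "\<lambda>n. D * r ^ n"]) (use b in auto)
    then show ?thesis by (auto simp: convergent_def)
  qed
qed

text \<open>The count is n (n + 1) ... (n + d - 1) / d!, a product of d factors each asymptotic to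
  n.\<close>

lemma card_expsl_asymp: "(\<lambda>n. real (card (expsl d n)) / real n ^ d) \<longlonglongrightarrow> 1 / fact d"
proof -
  have eq: "real (card (expsl d n)) / real n ^ d = (\<Prod>i<d. 1 + real i / real n) / fact d" if "n > 0" for n
  proof -
    have "real (n + d - 1 choose d) = (real n + real d - 1) gchoose d"
      using that by (simp add: binomial_gbinomial of_nat_diff)
    also have "\<dots> = pochhammer (real n) d / fact d" by (simp add: gbinomial_pochhammer')
    also have "pochhammer (real n) d = (\<Prod>i<d. real n + real i)"
      by (simp add: pochhammer_prod lessThan_atLeast0)
    finally have "real (card (expsl d n)) / real n ^ d = (\<Prod>i<d. real n + real i) / real n ^ d / fact d"
      using that by (simp add: card_expsl_eq)
    also have "(\<Prod>i<d. real n + real i) / real n ^ d = (\<Prod>i<d. (real n + real i) / real n)"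
      by (simp add: prod_dividef)
    also have "\<dots> = (\<Prod>i<d. 1 + real i / real n)" using that by (intro prod.cong) (auto simp: field_simps)
    finally show ?thesis .
  qed
  have "(\<lambda>n. (\<Prod>i<d. 1 + real i / real n) / fact d) \<longlonglongrightarrow> (\<Prod>i<d. 1 + 0) / fact d"
    by (intro tendsto_intros lim_const_over_n) auto
  then have "(\<lambda>n. (\<Prod>i<d. 1 + real i / real n) / fact d) \<longlonglongrightarrow> 1 / fact d" by simp
  then show ?thesis
    by (rule Lim_transform_eventually)
      (use eq in \<open>auto intro: eventually_mono[OF eventually_gt_at_top[of 0]]\<close>)
qed

definition box :: "nat \<Rightarrow> nat \<Rightarrow> nat list set"
  where "box d q = {u. set u \<subseteq> {..<q} \<and> length u = d}"

lemma card_box: "card (box d q) = q ^ d"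
  unfolding box_def by (simp add: card_lists_length_eq)

lemma finite_box: "finite (box d q)"
  unfolding box_def by (rule finite_lists_length_eq) simp

lemma inj_on_ladd: "inj_on (ladd u) {w. length w = length u}"
proof (rule inj_onI)
  show "v = w" if "v \<in> {w. length w = length u}" "w \<in> {w. length w = length u}" "ladd u v = ladd u w" for v w
  proof -
    have "length u = length v \<Longrightarrow> length w = length v \<Longrightarrow> ladd u v = ladd u w \<Longrightarrow> v = w"
      by (induction u v arbitrary: w rule: list_induct2) (auto simp: length_Suc_conv)
    then show ?thesis using that by simp
  qed
qed

text \<open>A natural-valued function attains its minimum e at some u0 and, being decreasing, is
  constant on u0 + N^d. Elsewhere it is only bounded by B, but few points of a simplex or a box lie
  there.\<close>

lemma decr_asymp:
  fixes \<phi> :: "nat list \<Rightarrow> nat"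
  assumes dec: "decr d \<phi>" and B: "\<And>u. length u = d \<Longrightarrow> \<phi> u \<le> B"
  obtains e s :: nat where "\<And>n. e * card (expsl d n) \<le> (\<Sum>u\<in>expsl d n. \<phi> u)"
    and "(\<lambda>n. real (\<Sum>u\<in>expsl d n. \<phi> u) / real n ^ d) \<longlonglongrightarrow> real e / fact d"
    and "\<And>q. s \<le> q \<Longrightarrow> (\<Sum>u\<in>box d q. \<phi> u) \<le> e * q ^ d + B * (q ^ d - (q - s) ^ d)"
proof -
  obtain u0 where u0: "length u0 = d" "\<And>u. length u = d \<Longrightarrow> \<phi> u0 \<le> \<phi> u"
    using ex_has_least_nat[of "\<lambda>u. length u = d" "replicate d 0" \<phi>] by auto
  define e where "e = \<phi> u0"
  define s where "s = sum_list u0"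
  have eq: "\<phi> (ladd u0 w) = e" if "length w = d" for w
  proof (rule antisym)
    have "lle u0 (ladd u0 w)" using that u0(1) by (auto simp: lle_iff_ladd)
    then show "\<phi> (ladd u0 w) \<le> e" using dec u0(1) unfolding decr_def e_def by blast
    show "e \<le> \<phi> (ladd u0 w)" unfolding e_def using u0 that by simp
  qed
  \<comment> \<open>All but \<open>card E - card F\<close> points of E lie in the translate of F by
    u0, where the value is e.\<close>
  have bound: "(\<Sum>u\<in>E. \<phi> u) \<le> e * card E + B * (card E - card F)"
    if E: "finite E" "E \<subseteq> {u. length u = d}" and F: "F \<subseteq> {u. length u = d}" "ladd u0 ` F \<subseteq> E" for E F
  proof -
    let ?F = "ladd u0 ` F"
    have cF: "card ?F = card F"
      by (rule card_image) (use inj_on_subset[OF inj_on_ladd[of u0]] F u0(1) in auto)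
    have fF: "finite ?F" using E F finite_subset by blast
    have "(\<Sum>u\<in>E. \<phi> u) = (\<Sum>u\<in>?F. \<phi> u) + (\<Sum>u\<in>E - ?F. \<phi> u)"
      using sum.subset_diff[OF F(2) E(1), of \<phi>] by simp
    also have "(\<Sum>u\<in>?F. \<phi> u) = (\<Sum>u\<in>?F. e)" by (rule sum.cong) (use eq F in auto)
    also have "(\<Sum>u\<in>E - ?F. \<phi> u) \<le> (\<Sum>u\<in>E - ?F. B)" by (rule sum_mono) (use B E in auto)
    also have "(\<Sum>u\<in>?F. e) + (\<Sum>u\<in>E - ?F. B) = e * card F + B * (card E - card F)"
      using card_Diff_subset[OF fF F(2)] cF by simp
    also have "e * card F \<le> e * card E" using card_mono[OF E(1) F(2)] cF by simp
    finally show ?thesis by simp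
  qed
  show ?thesis
  proof (rule that[of e s])
    show low: "e * card (expsl d n) \<le> (\<Sum>u\<in>expsl d n. \<phi> u)" for n
    proof -
      have "(\<Sum>u\<in>expsl d n. e) \<le> (\<Sum>u\<in>expsl d n. \<phi> u)"
        by (rule sum_mono) (use u0 in \<open>auto simp: e_def expsl_def\<close>)
      then show ?thesis by (simp add: mult.commute)
    qed
    have up: "(\<Sum>u\<in>expsl d n. \<phi> u) \<le> e * card (expsl d n) + B * (card (expsl d n) - card (expsl d (n - s)))" for n
    proof (rule bound[OF finite_expsl])
      show "ladd u0 ` expsl d (n - s) \<subseteq> expsl d n"
        using u0(1) sum_list_ladd[of u0] by (auto simp: expsl_def s_def)
    qed (auto simp: expsl_def)
    have l1: "(\<lambda>n. real (card (expsl d n)) / real n ^ d) \<longlonglongrightarrow> 1 / fact d" by (rule card_expsl_asymp)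
    have l2: "(\<lambda>n. real (card (expsl d (n - s))) / real n ^ d) \<longlonglongrightarrow> 1 / fact d"
    proof -
      \<comment> \<open>The limit is computed at index n + s, where the truncated difference n - s
        becomes n.\<close>
      have "(\<lambda>n. real (card (expsl d n)) / real n ^ d * (real n / real (n + s)) ^ d) \<longlonglongrightarrow> 1 / fact d * 1 ^ d"
      proof (intro tendsto_mult tendsto_power l1)
        have "(\<lambda>n. 1 / (1 + real s / real n)) \<longlonglongrightarrow> 1 / (1 + 0)"
          by (intro tendsto_intros lim_const_over_n) auto
        then have "(\<lambda>n. real n / (real n + real s)) \<longlonglongrightarrow> 1 / (1 + 0)"
          by (rule Lim_transform_eventually)
            (auto intro!: eventually_mono[OF eventually_gt_at_top[of 0]] simp: field_simps)
        then show "(\<lambda>n. real n / real (n + s)) \<longlonglongrightarrow> 1" by simp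
      qed
      then have "(\<lambda>n. real (card (expsl d n)) / real n ^ d * (real n / real (n + s)) ^ d) \<longlonglongrightarrow> 1 / fact d" by simp
      then have "(\<lambda>n. real (card (expsl d (n + s - s))) / real (n + s) ^ d) \<longlonglongrightarrow> 1 / fact d"
      proof (rule Lim_transform_eventually)
        show "\<forall>\<^sub>F n in sequentially. real (card (expsl d n)) / real n ^ d * (real n / real (n + s)) ^ d =
            real (card (expsl d (n + s - s))) / real (n + s) ^ d"
          using eventually_gt_at_top[of 0] by eventually_elim (simp add: power_divide)
      qed
      then show ?thesis by (rule LIMSEQ_offset[of "\<lambda>n. real (card (expsl d (n - s))) / real n ^ d" s])
    qed
    show "(\<lambda>n. real (\<Sum>u\<in>expsl d n. \<phi> u) / real n ^ d) \<longlonglongrightarrow> real e / fact d"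
    proof (rule tendsto_sandwich)
      have "(\<lambda>n. real e * (real (card (expsl d n)) / real n ^ d)) \<longlonglongrightarrow> real e * (1 / fact d)"
        by (intro tendsto_intros l1)
      then show "(\<lambda>n. real e * (real (card (expsl d n)) / real n ^ d)) \<longlonglongrightarrow> real e / fact d" by simp
      have "(\<lambda>n. real e * (real (card (expsl d n)) / real n ^ d) +
          real B * (real (card (expsl d n)) / real n ^ d - real (card (expsl d (n - s))) / real n ^ d))
        \<longlonglongrightarrow> real e * (1 / fact d) + real B * (1 / fact d - 1 / fact d)"
        by (intro tendsto_intros l1 l2)
      then show "(\<lambda>n. real e * (real (card (expsl d n)) / real n ^ d) +
          real B * (real (card (expsl d n)) / real n ^ d - real (card (expsl d (n - s))) / real n ^ d))
        \<longlonglongrightarrow> real e / fact d" by simp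
      show "\<forall>\<^sub>F n in sequentially. real e * (real (card (expsl d n)) / real n ^ d) \<le> real (\<Sum>u\<in>expsl d n. \<phi> u) / real n ^ d"
      proof (rule always_eventually, rule allI)
        fix n
        have "real e * real (card (expsl d n)) \<le> real (\<Sum>u\<in>expsl d n. \<phi> u)"
          using low[of n] by (metis of_nat_le_iff of_nat_mult)
        then show "real e * (real (card (expsl d n)) / real n ^ d) \<le> real (\<Sum>u\<in>expsl d n. \<phi> u) / real n ^ d"
          using divide_right_mono[of _ _ "real n ^ d"] by simp
      qed
      show "\<forall>\<^sub>F n in sequentially. real (\<Sum>u\<in>expsl d n. \<phi> u) / real n ^ d \<le> real e * (real (card (expsl d n)) / real n ^ d) +
          real B * (real (card (expsl d n)) / real n ^ d - real (card (expsl d (n - s))) / real n ^ d)"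
      proof (rule always_eventually, rule allI)
        fix n
        have "card (expsl d (n - s)) \<le> card (expsl d n)"
          by (intro card_mono finite_expsl) (auto simp: expsl_def)
        then have "real (\<Sum>u\<in>expsl d n. \<phi> u) \<le> real e * real (card (expsl d n)) +
            real B * (real (card (expsl d n)) - real (card (expsl d (n - s))))"
          using up[of n] by (metis of_nat_add of_nat_diff of_nat_le_iff of_nat_mult)
        from divide_right_mono[OF this, of "real n ^ d"]
        show "real (\<Sum>u\<in>expsl d n. \<phi> u) / real n ^ d \<le> real e * (real (card (expsl d n)) / real n ^ d) +
          real B * (real (card (expsl d n)) / real n ^ d - real (card (expsl d (n - s))) / real n ^ d)"
          by (simp add: add_divide_distrib diff_divide_distrib right_diff_distrib)
      qed
    qed
    show "(\<Sum>u\<in>box d q. \<phi> u) \<le> e * q ^ d + B * (q ^ d - (q - s) ^ d)" if "s \<le> q" for q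
    proof -
      have "(\<Sum>u\<in>box d q. \<phi> u) \<le> e * card (box d q) + B * (card (box d q) - card (box d (q - s)))"
      proof (rule bound[OF finite_box])
        show "ladd u0 ` box d (q - s) \<subseteq> box d q"
        proof
          fix v assume "v \<in> ladd u0 ` box d (q - s)"
          then obtain w where w: "set w \<subseteq> {..<q - s}" "length w = d" "v = ladd u0 w" by (auto simp: box_def)
          have "x < q" if xv: "x \<in> set v" for x
          proof -
            obtain i where i: "i < d" "x = u0 ! i + w ! i"
              using xv w u0(1) by (auto simp: in_set_conv_nth)
            have "u0 ! i \<le> s" unfolding s_def using i u0(1) by (intro member_le_sum_list) auto
            moreover have "w ! i < q - s" using i(1) w(1,2) nth_mem[of i w] by (metis lessThan_iff subsetD)
            ultimately show ?thesis using i by linarith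
          qed
          then show "v \<in> box d q" using w u0(1) by (auto simp: box_def)
        qed
      qed (auto simp: box_def)
      then show ?thesis by (simp add: card_box)
    qed
  qed
qed

text \<open>What summation over a cylinder needs, with the parametrisation as a witness. For n < s
  the truncated \<open>n - s\<close> already gives the empty simplex; the sum over a single degree
  needs the explicit 0, since \<open>exps k 0\<close> is not empty.\<close>

definition chart :: "nat \<Rightarrow> nat list set \<Rightarrow> nat \<Rightarrow> nat \<Rightarrow> (nat list \<Rightarrow> nat list) \<Rightarrow> bool"
  where "chart m X k s \<gamma> \<longleftrightarrow>
    (\<forall>\<psi>. decr m \<psi> \<longrightarrow> decr k (\<lambda>w. \<psi> (\<gamma> w))) \<and> (\<forall>w. length w = k \<longrightarrow> length (\<gamma> w) = m) \<and>
    (\<forall>(\<psi> :: nat list \<Rightarrow> nat) n. sum \<psi> {u\<in>X. sum_list u < n} = (\<Sum>w\<in>expsl k (n - s). \<psi> (\<gamma> w))) \<and>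
    (\<forall>(\<psi> :: nat list \<Rightarrow> nat) n. sum \<psi> {u\<in>X. sum_list u = n} =
      (if s \<le> n then \<Sum>w\<in>exps k (n - s). \<psi> (\<gamma> w) else 0))"

lemma cylinder_chart:
  assumes "cylinder k s X" and Xm: "X \<subseteq> {u. length u = m}"
  shows "\<exists>\<gamma>. chart m X k s \<gamma>"
proof -
  from assms obtain \<gamma> where \<gamma>: "bij_betw \<gamma> {w. length w = k} X"
    "\<And>w. length w = k \<Longrightarrow> sum_list (\<gamma> w) = s + sum_list w"
    "\<And>w w'. length w = k \<Longrightarrow> lle w w' \<Longrightarrow> lle (\<gamma> w) (\<gamma> w')"
    unfolding cylinder_def by blast
  have X: "X = \<gamma> ` {w. length w = k}" and inj: "inj_on \<gamma> {w. length w = k}"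
    using \<gamma>(1) by (auto simp: bij_betw_def)
  have len: "length (\<gamma> w) = m" if "length w = k" for w using that X Xm by auto
  have "decr k (\<lambda>w. \<psi> (\<gamma> w))" if "decr m \<psi>" for \<psi>
    unfolding decr_def
  proof (intro allI impI)
    fix u v assume uv: "length u = k" "lle u v"
    show "\<psi> (\<gamma> v) \<le> \<psi> (\<gamma> u)" using that \<gamma>(3)[OF uv] len[OF uv(1)] unfolding decr_def by blast
  qed
  moreover have "sum \<psi> {u\<in>X. sum_list u < n} = (\<Sum>w\<in>expsl k (n - s). \<psi> (\<gamma> w))" for \<psi> :: "nat list \<Rightarrow> nat" and n
  proof -
    have "{u\<in>X. sum_list u < n} = \<gamma> ` expsl k (n - s)"
      unfolding X expsl_def using \<gamma>(2) by auto
    moreover have "inj_on \<gamma> (expsl k (n - s))" by (rule inj_on_subset[OF inj]) (auto simp: expsl_def)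
    ultimately show ?thesis by (simp add: sum.reindex)
  qed
  moreover have "sum \<psi> {u\<in>X. sum_list u = n} = (if s \<le> n then \<Sum>w\<in>exps k (n - s). \<psi> (\<gamma> w) else 0)"
    for \<psi> :: "nat list \<Rightarrow> nat" and n
  proof (cases "s \<le> n")
    case True
    then have "{u\<in>X. sum_list u = n} = \<gamma> ` exps k (n - s)"
      unfolding X exps_def using \<gamma>(2) by auto
    moreover have "inj_on \<gamma> (exps k (n - s))" by (rule inj_on_subset[OF inj]) (auto simp: exps_def)
    ultimately show ?thesis using True by (simp add: sum.reindex)
  next
    case False
    then have "{u\<in>X. sum_list u = n} = {}" unfolding X using \<gamma>(2) by auto
    then show ?thesis using False by (simp only: sum.empty if_False)
  qed
  ultimately show ?thesis unfolding chart_def using len by blast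
qed

locale thin_downset =
  fixes m d :: nat and D :: "nat list set" and C :: nat
  assumes down: "downset m D" and thin: "\<And>n. card {u\<in>D. sum_list u < n} \<le> C * (n + 1) ^ d"
begin

lemma D_length: "u \<in> D \<Longrightarrow> length u = m"
  using down by (auto simp: downset_def)

lemma finite_D: "finite {u\<in>D. sum_list u < n}"
  by (rule finite_subset[OF _ finite_expsl[of m n]]) (use D_length in \<open>auto simp: expsl_def\<close>)

text \<open>A cylinder of dimension k has at least M^k points of degree at most k M + s, whereas the
  downset has O(M^d) of them; for k > d this fails for large M.\<close>

lemma cylinder_dim:
  assumes X: "cylinder k s X" "X \<subseteq> D"
  shows "k \<le> d"
proof (rule ccontr)
  assume "\<not> k \<le> d"
  then have kd: "Suc d \<le> k" by simp
  have "X \<subseteq> {u. length u = m}" using X(2) D_length by blast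
  then obtain \<gamma> where "chart m X k s \<gamma>" using cylinder_chart[OF X(1)] by blast
  then have \<gamma>: "sum (\<psi> :: nat list \<Rightarrow> nat) {u\<in>X. sum_list u < n} = (\<Sum>w\<in>expsl k (n - s). \<psi> (\<gamma> w))" for \<psi> n
    unfolding chart_def by blast
  have "M \<le> C * (k + s + 2) ^ d" if "M \<ge> 1" for M
  proof -
    let ?n = "k * M + 1 + s"
    have "M * M ^ d \<le> M ^ k" using power_increasing[OF kd that] by simp
    also have "\<dots> \<le> card (expsl k (k * M + 1))" by (rule card_expsl_ge)
    also have "\<dots> = card {u\<in>X. sum_list u < ?n}" using \<gamma>[of "\<lambda>_. 1" ?n] by simp
    also have "\<dots> \<le> card {u\<in>D. sum_list u < ?n}" by (intro card_mono finite_D) (use X in auto)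
    also have "\<dots> \<le> C * (?n + 1) ^ d" by (rule thin)
    also have "\<dots> \<le> C * ((k + s + 2) * M) ^ d"
    proof (intro mult_left_mono power_mono)
      have "s * 1 \<le> s * M" using that by (intro mult_left_mono) auto
      moreover have "(k + s + 2) * M = k * M + s * M + 2 * M" by (simp add: add_mult_distrib)
      ultimately show "?n + 1 \<le> (k + s + 2) * M" using that by linarith
    qed auto
    also have "\<dots> = (C * (k + s + 2) ^ d) * M ^ d" by (simp only: power_mult_distrib mult.assoc)
    finally show ?thesis using that by simp
  qed
  from this[of "C * (k + s + 2) ^ d + 1"] show False by simp
qed

lemma cylinders:
  "\<exists>\<X> \<kappa> \<s> \<Gamma>. finite \<X> \<and> disjoint \<X> \<and> \<Union>\<X> = D \<and>
    (\<forall>X\<in>\<X>. \<kappa> X \<le> d \<and> chart m X (\<kappa> X) (\<s> X) (\<Gamma> X))"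
proof -
  obtain \<X> where \<X>: "finite \<X>" "disjoint \<X>" "\<Union>\<X> = D" "\<forall>X\<in>\<X>. \<exists>k s. cylinder k s X"
    using downset_cylinders[OF down] by auto
  have "\<exists>k s \<gamma>. k \<le> d \<and> chart m X k s \<gamma>" if X: "X \<in> \<X>" for X
  proof -
    obtain k s where ks: "cylinder k s X" using \<X>(4) X by blast
    have XD: "X \<subseteq> D" using X \<X>(3) by blast
    then have "X \<subseteq> {u. length u = m}" using D_length by blast
    then show ?thesis using cylinder_chart[OF ks] cylinder_dim[OF ks XD] by blast
  qed
  then have "\<exists>t. fst t \<le> d \<and> chart m X (fst t) (fst (snd t)) (snd (snd t))" if "X \<in> \<X>" for X
    using that by fastforce
  then have "\<forall>X\<in>\<X>. \<exists>t. fst t \<le> d \<and> chart m X (fst t) (fst (snd t)) (snd (snd t))" by blast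
  from bchoice[OF this] obtain t where
    "\<forall>X\<in>\<X>. fst (t X) \<le> d \<and> chart m X (fst (t X)) (fst (snd (t X))) (snd (snd (t X)))" by (elim exE)
  then show ?thesis using \<X>(1-3)
    by (intro exI[of _ \<X>] exI[of _ "\<lambda>X. fst (t X)"] exI[of _ "\<lambda>X. fst (snd (t X))"]
        exI[of _ "\<lambda>X. snd (snd (t X))"]) simp
qed

text \<open>The functions will vary with q while the downset and B stay fixed, so estimates that
  depend on the function only through B are uniform in q.\<close>

definition supported :: "(nat list \<Rightarrow> nat) \<Rightarrow> nat \<Rightarrow> bool"
  where "supported \<psi> B \<longleftrightarrow> decr m \<psi> \<and> (\<forall>u. length u = m \<longrightarrow> u \<notin> D \<longrightarrow> \<psi> u = 0) \<and>
    (\<forall>u. length u = m \<longrightarrow> \<psi> u \<le> B)"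

text \<open>In degree N a cylinder of dimension at most d has at most (N + 1)^(d-1) points; K is the
  number of cylinders.\<close>

lemma layer_bound:
  "\<exists>K. \<forall>\<psi> B N. supported \<psi> B \<longrightarrow> (\<Sum>u\<in>exps m N. \<psi> u) \<le> B * K * (N + 1) ^ (d - 1)"
proof -
  obtain \<X> \<kappa> \<s> \<Gamma> where X0: "finite \<X> \<and> disjoint \<X> \<and> \<Union>\<X> = D \<and>
      (\<forall>X\<in>\<X>. \<kappa> X \<le> d \<and> chart m X (\<kappa> X) (\<s> X) (\<Gamma> X))"
    using cylinders by (elim exE)
  then have X: "finite \<X>" "disjoint \<X>" "\<Union>\<X> = D" "\<And>X. X \<in> \<X> \<Longrightarrow> \<kappa> X \<le> d" by simp_all
  have X5: "decr (\<kappa> X) (\<lambda>w. \<psi> (\<Gamma> X w))" if "X \<in> \<X>" "decr m \<psi>" for X \<psi>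
    using X0 that unfolding chart_def by blast
  have X6: "length (\<Gamma> X w) = m" if "X \<in> \<X>" "length w = \<kappa> X" for X w
    using X0 that unfolding chart_def by blast
  have X7: "sum (\<psi> :: nat list \<Rightarrow> nat) {u\<in>X. sum_list u < n} = (\<Sum>w\<in>expsl (\<kappa> X) (n - \<s> X). \<psi> (\<Gamma> X w))"
    if "X \<in> \<X>" for X \<psi> n
    using X0 that unfolding chart_def by blast
  have X8: "sum (\<psi> :: nat list \<Rightarrow> nat) {u\<in>X. sum_list u = n} =
      (if \<s> X \<le> n then \<Sum>w\<in>exps (\<kappa> X) (n - \<s> X). \<psi> (\<Gamma> X w) else 0)" if "X \<in> \<X>" for X \<psi> n
    using X0 that unfolding chart_def by blast
  have "(\<Sum>u\<in>exps m N. \<psi> u) \<le> B * card \<X> * (N + 1) ^ (d - 1)" if \<psi>: "supported \<psi> B" for \<psi> B N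
  proof -
    have XD: "X \<subseteq> D" if "X \<in> \<X>" for X using that X(3) by blast
    have "(\<Sum>u\<in>exps m N. \<psi> u) = (\<Sum>u\<in>{u\<in>D. sum_list u = N}. \<psi> u)"
      using \<psi> D_length by (intro sum.mono_neutral_right finite_exps) (auto simp: exps_def supported_def)
    also have "{u\<in>D. sum_list u = N} = (\<Union>X\<in>\<X>. {u\<in>X. sum_list u = N})" using X(3) by auto
    also have "(\<Sum>u\<in>\<dots>. \<psi> u) = (\<Sum>X\<in>\<X>. \<Sum>u\<in>{u\<in>X. sum_list u = N}. \<psi> u)"
    proof (rule sum.UNION_disjoint[OF X(1)])
      show "\<forall>X\<in>\<X>. finite {u \<in> X. sum_list u = N}"
        by (intro ballI finite_subset[OF _ finite_D[of "Suc N"]]) (use XD in auto)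
      show "\<forall>X\<in>\<X>. \<forall>Y\<in>\<X>. X \<noteq> Y \<longrightarrow> {u \<in> X. sum_list u = N} \<inter> {u \<in> Y. sum_list u = N} = {}"
        using X(2) unfolding disjoint_def by blast
    qed
    also have "\<dots> \<le> (\<Sum>X\<in>\<X>. B * (N + 1) ^ (d - 1))"
    proof (rule sum_mono)
      fix X' assume X': "X' \<in> \<X>"
      have "(\<Sum>w\<in>exps (\<kappa> X') (N - \<s> X'). \<psi> (\<Gamma> X' w)) \<le> (\<Sum>w\<in>exps (\<kappa> X') (N - \<s> X'). B)"
        by (rule sum_mono) (use \<psi> X6[OF X'] in \<open>auto simp: supported_def exps_def\<close>)
      also have "\<dots> = B * card (exps (\<kappa> X') (N - \<s> X'))" by simp
      also have "\<dots> \<le> B * (N - \<s> X' + 1) ^ (\<kappa> X' - 1)" by (intro mult_left_mono card_exps_le) auto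
      also have "\<dots> \<le> B * (N + 1) ^ (\<kappa> X' - 1)" by (intro mult_left_mono power_mono) auto
      also have "\<dots> \<le> B * (N + 1) ^ (d - 1)"
        using X(4)[OF X'] by (intro mult_left_mono power_increasing) auto
      finally show "(\<Sum>u\<in>{u\<in>X'. sum_list u = N}. \<psi> u) \<le> B * (N + 1) ^ (d - 1)"
        unfolding X8[OF X'] by auto
    qed
    also have "\<dots> = B * card \<X> * (N + 1) ^ (d - 1)" by simp
    finally show ?thesis .
  qed
  then show ?thesis by blast
qed

text \<open>On d-dimensional cylinders \<open>decr_growth\<close> compares the sums with a factor
  ((N2 - s)/(N1 - s))^d, which tends to (b/a)^d. Cylinders of smaller dimension disappear after
  division by q^d.\<close>

lemma growth_limit:
  fixes q :: "nat \<Rightarrow> real" and N1 N2 :: "nat \<Rightarrow> nat"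
  assumes \<psi>: "\<And>n. supported (\<psi> n) B"
    and q: "filterlim q at_top sequentially" and N: "\<And>n. N1 n \<le> N2 n"
    and a: "(\<lambda>n. real (N1 n) / q n) \<longlonglongrightarrow> a" "0 < a" and b: "(\<lambda>n. real (N2 n) / q n) \<longlonglongrightarrow> b"
    and \<alpha>: "(\<lambda>n. real (\<Sum>u\<in>expsl m (N1 n). \<psi> n u) / q n ^ d) \<longlonglongrightarrow> \<alpha>"
    and \<beta>: "(\<lambda>n. real (\<Sum>u\<in>expsl m (N2 n). \<psi> n u) / q n ^ d) \<longlonglongrightarrow> \<beta>"
  shows "\<beta> \<le> (b / a) ^ d * \<alpha>"
proof -
  obtain \<X> \<kappa> \<s> \<Gamma> where X0: "finite \<X> \<and> disjoint \<X> \<and> \<Union>\<X> = D \<and>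
      (\<forall>X\<in>\<X>. \<kappa> X \<le> d \<and> chart m X (\<kappa> X) (\<s> X) (\<Gamma> X))"
    using cylinders by (elim exE)
  then have X: "finite \<X>" "disjoint \<X>" "\<Union>\<X> = D" "\<And>X. X \<in> \<X> \<Longrightarrow> \<kappa> X \<le> d" by simp_all
  have X5: "decr (\<kappa> X) (\<lambda>w. \<psi> (\<Gamma> X w))" if "X \<in> \<X>" "decr m \<psi>" for X \<psi>
    using X0 that unfolding chart_def by blast
  have X6: "length (\<Gamma> X w) = m" if "X \<in> \<X>" "length w = \<kappa> X" for X w
    using X0 that unfolding chart_def by blast
  have X7: "sum (\<psi> :: nat list \<Rightarrow> nat) {u\<in>X. sum_list u < n} = (\<Sum>w\<in>expsl (\<kappa> X) (n - \<s> X). \<psi> (\<Gamma> X w))"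
    if "X \<in> \<X>" for X \<psi> n
    using X0 that unfolding chart_def by blast
  have X8: "sum (\<psi> :: nat list \<Rightarrow> nat) {u\<in>X. sum_list u = n} =
      (if \<s> X \<le> n then \<Sum>w\<in>exps (\<kappa> X) (n - \<s> X). \<psi> (\<Gamma> X w) else 0)" if "X \<in> \<X>" for X \<psi> n
    using X0 that unfolding chart_def by blast
  have XD: "X \<subseteq> D" if "X \<in> \<X>" for X using that X(3) by blast
  define G where "G X n N = (\<Sum>w\<in>expsl (\<kappa> X) (N - \<s> X). \<psi> n (\<Gamma> X w))" for X n N
  have dec: "(\<Sum>u\<in>expsl m N. \<psi> n u) = (\<Sum>X\<in>\<X>. G X n N)" for n N
  proof -
    have "(\<Sum>u\<in>expsl m N. \<psi> n u) = (\<Sum>u\<in>{u\<in>D. sum_list u < N}. \<psi> n u)"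
      using \<psi>[of n] D_length by (intro sum.mono_neutral_right finite_expsl) (auto simp: expsl_def supported_def)
    also have "{u\<in>D. sum_list u < N} = (\<Union>X\<in>\<X>. {u\<in>X. sum_list u < N})" using X(3) by auto
    also have "(\<Sum>u\<in>\<dots>. \<psi> n u) = (\<Sum>X\<in>\<X>. \<Sum>u\<in>{u\<in>X. sum_list u < N}. \<psi> n u)"
    proof (rule sum.UNION_disjoint[OF X(1)])
      show "\<forall>X\<in>\<X>. finite {u \<in> X. sum_list u < N}"
        by (intro ballI finite_subset[OF _ finite_D[of N]]) (use XD in auto)
      show "\<forall>X\<in>\<X>. \<forall>Y\<in>\<X>. X \<noteq> Y \<longrightarrow> {u \<in> X. sum_list u < N} \<inter> {u \<in> Y. sum_list u < N} = {}"
        using X(2) unfolding disjoint_def by blast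
    qed
    also have "\<dots> = (\<Sum>X\<in>\<X>. G X n N)" unfolding G_def by (rule sum.cong) (use X7 in auto)
    finally show ?thesis .
  qed
  have qinf: "(\<lambda>n. 1 / q n) \<longlonglongrightarrow> 0" using q by (intro tendsto_divide_0[OF tendsto_const] filterlim_at_top_imp_at_infinity)
  have shift: "(\<lambda>n. real (N n - s) / q n) \<longlonglongrightarrow> x" if x: "(\<lambda>n. real (N n) / q n) \<longlonglongrightarrow> x" for N s x
  proof (rule tendsto_sandwich[OF _ _ _ x])
    have "(\<lambda>n. real (N n) / q n - real s * (1 / q n)) \<longlonglongrightarrow> x - real s * 0" by (intro tendsto_intros x qinf)
    then show "(\<lambda>n. real (N n) / q n - real s * (1 / q n)) \<longlonglongrightarrow> x" by simp
    have ev: "\<forall>\<^sub>F n in sequentially. q n > 0" using q by (simp add: filterlim_at_top_dense)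
    show "\<forall>\<^sub>F n in sequentially. real (N n) / q n - real s * (1 / q n) \<le> real (N n - s) / q n"
      using ev by eventually_elim (simp add: diff_divide_distrib[symmetric] divide_right_mono)
    show "\<forall>\<^sub>F n in sequentially. real (N n - s) / q n \<le> real (N n) / q n"
      using ev by eventually_elim (simp add: divide_right_mono)
  qed
  have evq: "\<forall>\<^sub>F n in sequentially. q n > 0" using q by (simp add: filterlim_at_top_dense)
  have Gle: "G X n N \<le> B * (N - \<s> X) ^ \<kappa> X" if "X \<in> \<X>" for X n N
  proof -
    have "G X n N \<le> (\<Sum>w\<in>expsl (\<kappa> X) (N - \<s> X). B)"
      unfolding G_def by (rule sum_mono) (use \<psi>[of n] X6[OF that] in \<open>auto simp: supported_def expsl_def\<close>)
    also have "\<dots> = B * card (expsl (\<kappa> X) (N - \<s> X))" by simp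
    also have "\<dots> \<le> B * (N - \<s> X) ^ \<kappa> X" by (intro mult_left_mono card_expsl_le) auto
    finally show ?thesis .
  qed
  \<comment> \<open>The sums over single cylinders need not converge; only the totals do. The
    inequality is therefore kept for each n, with an error term tending to 0.\<close>
  have "\<exists>\<delta>. \<delta> \<longlonglongrightarrow> (0::real) \<and> (\<forall>\<^sub>F n in sequentially.
      real (G X n (N2 n)) / q n ^ d \<le> (b / a) ^ d * (real (G X n (N1 n)) / q n ^ d) + \<delta> n)" if XX: "X \<in> \<X>" for X
  proof (cases "\<kappa> X < d")
    case True
    let ?x = "\<lambda>n. real (N2 n - \<s> X) / q n"
    define \<delta> where "\<delta> n = real B * (?x n ^ \<kappa> X * (1 / q n) ^ (d - \<kappa> X))" for n
    have "\<delta> \<longlonglongrightarrow> real B * (b ^ \<kappa> X * 0 ^ (d - \<kappa> X))"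
      unfolding \<delta>_def by (intro tendsto_intros shift b qinf)
    then have "\<delta> \<longlonglongrightarrow> 0" using True by (simp add: power_0_left)
    moreover have "\<forall>\<^sub>F n in sequentially.
      real (G X n (N2 n)) / q n ^ d \<le> (b / a) ^ d * (real (G X n (N1 n)) / q n ^ d) + \<delta> n"
      using evq
    proof eventually_elim
      case (elim n)
      have b0: "0 \<le> b / a"
      proof -
        have "0 \<le> b" by (rule tendsto_lowerbound[OF b]) (use evq in \<open>auto elim: eventually_mono\<close>)
        then show ?thesis using a by simp
      qed
      have "real (G X n (N2 n)) \<le> real B * real (N2 n - \<s> X) ^ \<kappa> X"
        using Gle[OF XX, of n "N2 n"] by (metis of_nat_le_iff of_nat_mult of_nat_power)
      then have "real (G X n (N2 n)) / q n ^ d \<le> real B * real (N2 n - \<s> X) ^ \<kappa> X / q n ^ d"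
        using elim by (intro divide_right_mono) auto
      also have "real B * real (N2 n - \<s> X) ^ \<kappa> X / q n ^ d = \<delta> n"
      proof -
        have "q n ^ d = q n ^ \<kappa> X * q n ^ (d - \<kappa> X)" using True by (simp flip: power_add)
        then show ?thesis unfolding \<delta>_def by (simp add: power_divide)
      qed
      finally show ?case using b0 elim by (simp add: add_increasing)
    qed
    ultimately show ?thesis by blast
  next
    case False
    then have kd: "\<kappa> X = d" using X(4)[OF XX] by simp
    let ?x1 = "\<lambda>n. real (N1 n - \<s> X) / q n" and ?x2 = "\<lambda>n. real (N2 n - \<s> X) / q n"
    \<comment> \<open>Replacing the ratio by its limit costs at most the bounded normalised sum over
      the smaller simplex times the deviation of the ratio.\<close>
    define \<delta> where "\<delta> n = real B * ?x1 n ^ d * \<bar>(?x2 n / ?x1 n) ^ d - (b / a) ^ d\<bar>" for n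
    have "\<delta> \<longlonglongrightarrow> real B * a ^ d * \<bar>(b / a) ^ d - (b / a) ^ d\<bar>"
      unfolding \<delta>_def using a(2) by (intro tendsto_intros shift a b) auto
    then have "\<delta> \<longlonglongrightarrow> 0" by simp
    moreover have "\<forall>\<^sub>F n in sequentially. ?x1 n > 0" using shift[OF a(1), of "\<s> X"] a(2) by (rule order_tendstoD(1))
    then have "\<forall>\<^sub>F n in sequentially.
      real (G X n (N2 n)) / q n ^ d \<le> (b / a) ^ d * (real (G X n (N1 n)) / q n ^ d) + \<delta> n"
      using evq
    proof eventually_elim
      case (elim n)
      have M: "0 < N1 n - \<s> X" "N1 n - \<s> X \<le> N2 n - \<s> X" using elim N[of n] by (auto simp: zero_less_divide_iff)
      have "decr d (\<lambda>w. \<psi> n (\<Gamma> X w))" using X5[OF XX, of "\<psi> n"] \<psi>[of n] kd by (simp add: supported_def)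
      from decr_growth[OF this M] have "G X n (N2 n) * (N1 n - \<s> X) ^ d \<le> G X n (N1 n) * (N2 n - \<s> X) ^ d"
        unfolding G_def kd .
      then have "real (G X n (N2 n)) * real (N1 n - \<s> X) ^ d \<le> real (G X n (N1 n)) * real (N2 n - \<s> X) ^ d"
        by (metis of_nat_le_iff of_nat_mult of_nat_power)
      then have "real (G X n (N2 n)) \<le> real (G X n (N1 n)) * (real (N2 n - \<s> X) / real (N1 n - \<s> X)) ^ d"
        using M by (simp add: power_divide pos_le_divide_eq)
      also have "real (N2 n - \<s> X) / real (N1 n - \<s> X) = ?x2 n / ?x1 n" using elim by simp
      finally have 1: "real (G X n (N2 n)) / q n ^ d \<le> real (G X n (N1 n)) / q n ^ d * (?x2 n / ?x1 n) ^ d"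
        using divide_right_mono[of "real (G X n (N2 n))" _ "q n ^ d"] elim by simp
      have "real (G X n (N1 n)) \<le> real B * real (N1 n - \<s> X) ^ d"
        using Gle[OF XX, of n "N1 n"] kd by (metis of_nat_le_iff of_nat_mult of_nat_power)
      then have "real (G X n (N1 n)) / q n ^ d \<le> real B * real (N1 n - \<s> X) ^ d / q n ^ d"
        using elim by (intro divide_right_mono) auto
      then have 2: "real (G X n (N1 n)) / q n ^ d \<le> real B * ?x1 n ^ d" by (simp add: power_divide)
      let ?g = "real (G X n (N1 n)) / q n ^ d" and ?y = "(?x2 n / ?x1 n) ^ d"
      have "?g * (?y - (b / a) ^ d) \<le> ?g * \<bar>?y - (b / a) ^ d\<bar>" using elim by (intro mult_left_mono) auto
      also have "\<dots> \<le> \<delta> n" unfolding \<delta>_def by (intro mult_right_mono 2) auto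
      finally have "?g * ?y \<le> (b / a) ^ d * ?g + \<delta> n" by (simp add: algebra_simps)
      then show ?case using 1 by linarith
    qed
    ultimately show ?thesis by blast
  qed
  then have "\<forall>X\<in>\<X>. \<exists>\<delta>. \<delta> \<longlonglongrightarrow> (0::real) \<and> (\<forall>\<^sub>F n in sequentially.
      real (G X n (N2 n)) / q n ^ d \<le> (b / a) ^ d * (real (G X n (N1 n)) / q n ^ d) + \<delta> n)" by blast
  from bchoice[OF this] obtain \<delta> where \<delta>: "\<And>X. X \<in> \<X> \<Longrightarrow> \<delta> X \<longlonglongrightarrow> (0::real)"
    "\<And>X. X \<in> \<X> \<Longrightarrow> \<forall>\<^sub>F n in sequentially.
      real (G X n (N2 n)) / q n ^ d \<le> (b / a) ^ d * (real (G X n (N1 n)) / q n ^ d) + \<delta> X n" by blast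
  have lim: "(\<lambda>n. (b / a) ^ d * (real (\<Sum>u\<in>expsl m (N1 n). \<psi> n u) / q n ^ d) + (\<Sum>X\<in>\<X>. \<delta> X n))
      \<longlonglongrightarrow> (b / a) ^ d * \<alpha> + (\<Sum>X\<in>\<X>. 0)"
    by (intro tendsto_intros \<alpha> \<delta>(1))
  have "\<forall>\<^sub>F n in sequentially. \<forall>X\<in>\<X>. real (G X n (N2 n)) / q n ^ d \<le> (b / a) ^ d * (real (G X n (N1 n)) / q n ^ d) + \<delta> X n"
    by (rule eventually_ball_finite[OF X(1)]) (use \<delta>(2) in blast)
  then have "\<forall>\<^sub>F n in sequentially. real (\<Sum>u\<in>expsl m (N2 n). \<psi> n u) / q n ^ d \<le>
      (b / a) ^ d * (real (\<Sum>u\<in>expsl m (N1 n). \<psi> n u) / q n ^ d) + (\<Sum>X\<in>\<X>. \<delta> X n)"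
  proof eventually_elim
    case (elim n)
    have "real (\<Sum>u\<in>expsl m (N2 n). \<psi> n u) / q n ^ d = (\<Sum>X\<in>\<X>. real (G X n (N2 n)) / q n ^ d)"
      unfolding dec by (simp add: sum_divide_distrib)
    also have "\<dots> \<le> (\<Sum>X\<in>\<X>. (b / a) ^ d * (real (G X n (N1 n)) / q n ^ d) + \<delta> X n)"
      by (rule sum_mono) (use elim in blast)
    also have "\<dots> = (b / a) ^ d * (real (\<Sum>u\<in>expsl m (N1 n). \<psi> n u) / q n ^ d) + (\<Sum>X\<in>\<X>. \<delta> X n)"
      unfolding dec by (simp add: sum.distrib sum_divide_distrib sum_distrib_left)
    finally show ?case .
  qed
  then have "\<beta> \<le> (b / a) ^ d * \<alpha> + (\<Sum>X\<in>\<X>. 0)"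
    by (rule tendsto_le[OF _ lim \<beta>, rotated]) simp
  then show ?thesis by simp
qed

end

section \<open>Parameter ideals and the multiplicity\<close>

lemma sum_list_div_bound:
  fixes p :: nat
  assumes "p > 0"
  shows "sum_list u \<le> p * sum_list (map (\<lambda>k. k div p) u) + p * length u"
proof (induction u)
  case (Cons a u)
  have "a = p * (a div p) + a mod p" by simp
  moreover have "a mod p \<le> p" using assms by (simp add: less_imp_le)
  ultimately have "a \<le> p * (a div p) + p" by linarith
  then show ?case using Cons by (simp add: algebra_simps)
qed simp

lemma sum_enat: "(\<Sum>x\<in>A. enat (f x)) = enat (\<Sum>x\<in>A. f x)"
  by (induction A rule: infinite_finite_induct) (auto simp: zero_enat_def)

section \<open>Finite colengths as natural numbers\<close>

context cring
begin

lemma mon_scale: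
  "set xs \<subseteq> carrier R \<Longrightarrow> length v = length xs \<Longrightarrow> mon xs (map (\<lambda>k. p * k) v) = mon xs v [^] (p::nat)"
proof (induction xs arbitrary: v)
  case (Cons x xs)
  then obtain a v' where v: "v = a # v'" by (cases v) auto
  have "x \<in> carrier R" "mon xs v' \<in> carrier R" using Cons.prems by (auto intro: mon_closed)
  then show ?case using Cons v by (simp add: nat_pow_distrib nat_pow_pow mult.commute)
qed simp

definition nlen :: "'a set \<Rightarrow> nat"
  where "nlen A = the_enat (colen A)"

definition phi :: "'a list \<Rightarrow> 'a set \<Rightarrow> nat list \<Rightarrow> nat"
  where "phi xs A u = the_enat (psi xs A u)"

lemma quot_length_nlen: "ideal A R \<Longrightarrow> quot_length R A = real (nlen A)"
  by (simp add: quot_length_eq nlen_def)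

lemma nlen_enat: "colen A \<noteq> \<infinity> \<Longrightarrow> colen A = enat (nlen A)"
  by (auto simp: nlen_def)

lemma nlen_antimono: "A \<subseteq> B \<Longrightarrow> colen A \<noteq> \<infinity> \<Longrightarrow> nlen B \<le> nlen A"
  using colen_antimono[of A B] unfolding nlen_def by (cases "colen A"; cases "colen B") auto

lemma colen_finite_mono: "A \<subseteq> B \<Longrightarrow> colen A \<noteq> \<infinity> \<Longrightarrow> colen B \<noteq> \<infinity>"
  using colen_antimono[of A B] by (cases "colen B") auto

lemma ideal_sum_zero: "ideal A R \<Longrightarrow> A <+>\<^bsub>R\<^esub> {\<zero>} = A"
  using ideal_subset_carrier[of A] by (auto simp: set_add_iff) (metis r_zero subsetD)+

context
  fixes xs :: "'a list"
  assumes xs: "set xs \<subseteq> carrier R" and fin: "colen (Idl (set xs)) \<noteq> \<infinity>"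
begin

lemma psi_phi:
  assumes "ideal A R" "length u = length xs"
  shows "psi xs A u = enat (phi xs A u)"
proof -
  have "psi xs A u \<noteq> \<infinity>"
  proof
    assume "psi xs A u = \<infinity>"
    then show False using psi_le[OF xs assms] fin by simp
  qed
  then show ?thesis by (auto simp: phi_def)
qed

lemma phi_le:
  assumes "ideal A R" "length u = length xs"
  shows "phi xs A u \<le> nlen (Idl (set xs))"
  using psi_le[OF xs assms] psi_phi[OF assms] nlen_enat[OF fin] by simp

lemma phi_decr: "ideal A R \<Longrightarrow> decr (length xs) (phi xs A)"
  unfolding decr_def
proof (intro allI impI)
  fix u v assume A: "ideal A R" and uv: "length u = length xs" "lle u v"
  have "length v = length xs" using uv list_all2_lengthD by metis
  then show "phi xs A v \<le> phi xs A u" using psi_decr[OF xs A uv] psi_phi[OF A] uv(1) by simp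
qed

lemma phi_antimono:
  assumes "ideal A R" "ideal B R" "A \<subseteq> B" "length u = length xs"
  shows "phi xs B u \<le> phi xs A u"
  using psi_antimono[OF xs assms(1-3), of u] psi_phi[OF assms(1,4)] psi_phi[OF assms(2,4)] by simp

lemma phi_zero: "ideal A R \<Longrightarrow> mon xs u \<in> A \<Longrightarrow> phi xs A u = 0"
  using psi_zero[OF xs, of A u] by (simp add: phi_def zero_enat_def)

lemma nlen_power_add:
  assumes A: "ideal A R"
  shows "nlen (ideal_power R (Idl (set xs)) n <+>\<^bsub>R\<^esub> A) = (\<Sum>u\<in>expsl (length xs) n. phi xs A u)"
proof -
  have "(\<Sum>u\<in>expsl (length xs) n. psi xs A u) = (\<Sum>u\<in>expsl (length xs) n. enat (phi xs A u))"
    by (rule sum.cong) (use psi_phi[OF A] in \<open>auto simp: expsl_def\<close>)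
  then have "colen (ideal_power R (Idl (set xs)) n <+>\<^bsub>R\<^esub> A) = enat (\<Sum>u\<in>expsl (length xs) n. phi xs A u)"
    unfolding colen_power_add[OF xs A] by (simp add: sum_enat)
  then show ?thesis by (simp add: nlen_def)
qed

lemma nlen_power:
  "nlen (ideal_power R (Idl (set xs)) n) = (\<Sum>u\<in>expsl (length xs) n. phi xs {\<zero>} u)"
  using nlen_power_add[OF zeroideal, of n] ideal_sum_zero[OF ideal_power_ideal[OF genideal_ideal[OF xs]], of n]
  by simp

lemma colen_power_finite': "colen (ideal_power R (Idl (set xs)) n) \<noteq> \<infinity>"
  using colen_power_finite[OF xs fin zeroideal, of n]
    ideal_sum_zero[OF ideal_power_ideal[OF genideal_ideal[OF xs]], of n] by simp

text \<open>A monomial with an exponent of at least q lies in A, so \<open>phi xs A\<close> vanishes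
  outside the box; inside it is bounded by its value for the zero ideal.\<close>

lemma nlen_of_gens_in:
  assumes A: "ideal A R" and q: "\<And>x. x \<in> set xs \<Longrightarrow> x [^] (q::nat) \<in> A"
  shows "nlen A \<le> (\<Sum>u\<in>box (length xs) q. phi xs {\<zero>} u)" and "colen A \<noteq> \<infinity>"
proof -
  let ?N = "length xs * q + 1" and ?P = "ideal_power R (Idl (set xs))"
  have Pi: "ideal (?P ?N) R" by (rule ideal_power_ideal[OF genideal_ideal[OF xs]])
  have sub: "?P ?N \<subseteq> A" by (rule ideal_power_subset_of_gens[OF xs A q])
  then show "colen A \<noteq> \<infinity>" using colen_power_finite' colen_finite_mono by blast
  have e: "?P ?N <+>\<^bsub>R\<^esub> A = A"
    using ideal_sum_least[OF A sub order_refl] ideal_sum(3)[OF Pi A] by blast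
  have box: "box (length xs) q \<subseteq> expsl (length xs) ?N"
  proof
    fix u assume u: "u \<in> box (length xs) q"
    have "sum_list u \<le> length u * q" if "set u \<subseteq> {..<q}" for u using that by (induction u) auto
    from this[of u] show "u \<in> expsl (length xs) ?N" using u by (auto simp: box_def expsl_def less_Suc_eq_le)
  qed
  have "nlen A = (\<Sum>u\<in>expsl (length xs) ?N. phi xs A u)" using nlen_power_add[OF A, of ?N] e by simp
  also have "\<dots> = (\<Sum>u\<in>box (length xs) q. phi xs A u)"
  proof (rule sum.mono_neutral_right[OF finite_expsl box], rule ballI)
    fix u assume u: "u \<in> expsl (length xs) ?N - box (length xs) q"
    then have l: "length u = length xs" by (simp add: expsl_def)
    obtain k where k: "k < length xs" "q \<le> u ! k" using u l by (auto simp: box_def in_set_conv_nth subset_iff not_less)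
    have "mon xs u \<in> A" by (rule mon_mem[OF xs A l k(1) _ k(2)]) (use q k(1) in auto)
    then show "phi xs A u = 0" by (rule phi_zero[OF A])
  qed
  also have "\<dots> \<le> (\<Sum>u\<in>box (length xs) q. phi xs {\<zero>} u)"
    by (rule sum_mono, rule phi_antimono[OF zeroideal A])
      (use smodD(2)[OF A[unfolded ideal_iff_smod]] in \<open>auto simp: box_def\<close>)
  finally show "nlen A \<le> (\<Sum>u\<in>box (length xs) q. phi xs {\<zero>} u)" .
qed

end

section \<open>Frobenius powers of ideals\<close>

lemma frobenius_power_carrier: "ideal A R \<Longrightarrow> (\<lambda>x. x [^] (q::nat)) ` A \<subseteq> carrier R"
  using ideal_subset_carrier by auto

lemma frobenius_power_ideal: "ideal A R \<Longrightarrow> ideal (frobenius_power R A q) R"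
  unfolding frobenius_power_def by (rule genideal_ideal[OF frobenius_power_carrier])

lemma frobenius_power_mem: "ideal A R \<Longrightarrow> x \<in> A \<Longrightarrow> x [^] q \<in> frobenius_power R A q"
  unfolding frobenius_power_def using genideal_self[OF frobenius_power_carrier] by blast

lemma frobenius_power_least:
  "ideal K R \<Longrightarrow> (\<And>x. x \<in> A \<Longrightarrow> x [^] q \<in> K) \<Longrightarrow> frobenius_power R A q \<subseteq> K"
  unfolding frobenius_power_def by (rule genideal_minimal) auto

lemma frobenius_power_mono:
  "ideal B R \<Longrightarrow> A \<subseteq> B \<Longrightarrow> frobenius_power R A q \<subseteq> frobenius_power R B q"
  by (rule frobenius_power_least[OF frobenius_power_ideal]) (auto intro: frobenius_power_mem)

lemma frobenius_power_ideal_power: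
  assumes "ideal A R"
  shows "frobenius_power R (ideal_power R A t) q \<subseteq> ideal_power R A (t * q)"
  by (rule frobenius_power_least[OF ideal_power_ideal[OF assms]]) (rule pow_mem_ideal_power[OF assms])

lemma frobenius_power_sub_power: "ideal A R \<Longrightarrow> frobenius_power R A q \<subseteq> ideal_power R A q"
  using frobenius_power_ideal_power[of A 1 q] ideal_power_1[of A] by simp

text \<open>Dividing the exponents by q writes a monomial as the q-th power of
  \<open>mon ys v\<close> times another monomial. The remainders use up at most q * length ys of the
  degree, so v has degree at least t.\<close>

lemma power_sub_frobenius_power:
  assumes ys: "set ys \<subseteq> carrier R" and q: "q > 0"
  shows "ideal_power R (Idl (set ys)) (q * t + q * length ys) \<subseteq> frobenius_power R (ideal_power R (Idl (set ys)) t) q"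
  unfolding ideal_power_Idl[OF ys, of "q * t + q * length ys"]
proof (rule genideal_minimal[OF frobenius_power_ideal[OF ideal_power_ideal[OF genideal_ideal[OF ys]]]], rule subsetI)
  let ?I = "Idl (set ys)"
  have It: "ideal (ideal_power R ?I t) R" by (rule ideal_power_ideal[OF genideal_ideal[OF ys]])
  fix y assume "y \<in> mon ys ` exps (length ys) (q * t + q * length ys)"
  then obtain u where u: "length u = length ys" "sum_list u = q * t + q * length ys" "y = mon ys u"
    by (auto simp: exps_def)
  define v where "v = map (\<lambda>k. k div q) u"
  define w where "w = map (\<lambda>k. k mod q) u"
  have l: "length v = length ys" "length w = length ys" using u by (auto simp: v_def w_def)
  have "q * t \<le> q * sum_list v" using sum_list_div_bound[OF q, of u] u by (simp add: v_def)
  then have "mon ys v \<in> ideal_power R ?I t" using q by (intro mon_mem_ideal_power[OF ys l(1)]) simp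
  then have vF: "mon ys v [^] q \<in> frobenius_power R (ideal_power R ?I t) q" by (rule frobenius_power_mem[OF It])
  have "u = ladd (map (\<lambda>k. q * k) v) w"
    unfolding v_def w_def by (rule nth_equalityI) auto
  then have "y = mon ys v [^] q \<otimes> mon ys w"
    using mon_ladd[OF ys, of "map (\<lambda>k. q * k) v" w] mon_scale[OF ys l(1), of q] l u(3) by simp
  then show "y \<in> frobenius_power R (ideal_power R ?I t) q"
    using ideal.I_r_closed[OF frobenius_power_ideal[OF It] vF mon_closed[OF ys]] by simp
qed

end

context char_domain
begin

text \<open>Additivity of Frobenius makes the preimage of an ideal an ideal; this reduces statements
  about p^n-th powers of all elements to generators.\<close>

lemma frobenius_vimage_ideal:
  assumes K: "ideal K R"
  shows "ideal {x \<in> carrier R. x [^] (p ^ n) \<in> K} R"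
  unfolding ideal_iff_smod smod_def
proof (intro conjI ballI)
  note Kd = smodD[OF K[unfolded ideal_iff_smod]]
  let ?V = "{x \<in> carrier R. x [^] (p ^ n) \<in> K}"
  show "\<zero> \<in> ?V" using Kd(2) p_pos by (simp add: nat_pow_zero)
  fix x assume x: "x \<in> ?V"
  show "x \<oplus> y \<in> ?V" if "y \<in> ?V" for y
    using x that Kd(3)[of "x [^] (p ^ n)" "y [^] (p ^ n)"] by (simp add: frob_iter)
  show mult: "s \<otimes> x \<in> ?V" if "s \<in> carrier R" for s
    using x that Kd(6)[of "s [^] (p ^ n)" "x [^] (p ^ n)"] by (simp add: nat_pow_distrib)
  have "\<ominus> x = (\<ominus> \<one>) \<otimes> x" using x by (simp add: l_minus)
  then show "\<ominus> x \<in> ?V" using mult[of "\<ominus> \<one>"] by simp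
qed auto

lemma frobenius_power_Idl:
  assumes xs: "set xs \<subseteq> carrier R"
  shows "frobenius_power R (Idl (set xs)) (p ^ n) = Idl (set (map (\<lambda>x. x [^] (p ^ n)) xs))"
proof
  have I: "ideal (Idl (set xs)) R" by (rule genideal_ideal[OF xs])
  have c: "set (map (\<lambda>x. x [^] (p ^ n)) xs) \<subseteq> carrier R" using xs by auto
  let ?K = "Idl (set (map (\<lambda>x. x [^] (p ^ n)) xs))"
  have K: "ideal ?K R" by (rule genideal_ideal[OF c])
  have "Idl (set xs) \<subseteq> {x \<in> carrier R. x [^] (p ^ n) \<in> ?K}"
    by (rule genideal_minimal[OF frobenius_vimage_ideal[OF K]]) (use xs genideal_self[OF c] in auto)
  then show "frobenius_power R (Idl (set xs)) (p ^ n) \<subseteq> ?K" by (intro frobenius_power_least[OF K]) auto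
  show "?K \<subseteq> frobenius_power R (Idl (set xs)) (p ^ n)"
    by (rule genideal_minimal[OF frobenius_power_ideal[OF I]])
      (use frobenius_power_mem[OF I] genideal_self[OF xs] in auto)
qed

lemma frobenius_power_Suc:
  assumes A: "ideal A R"
  shows "frobenius_power R (frobenius_power R A (p ^ n)) p = frobenius_power R A (p ^ Suc n)"
proof
  have c: "(x [^] (p ^ n)) [^] p = x [^] (p ^ Suc n)" if "x \<in> carrier R" for x
    using that by (simp add: nat_pow_pow mult.commute)
  let ?K = "frobenius_power R A (p ^ Suc n)"
  have K: "ideal ?K R" by (rule frobenius_power_ideal[OF A])
  have "frobenius_power R A (p ^ n) \<subseteq> {x \<in> carrier R. x [^] (p ^ 1) \<in> ?K}"
  proof (rule frobenius_power_least[OF frobenius_vimage_ideal[OF K]])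
    fix x assume x: "x \<in> A"
    then have xc: "x \<in> carrier R" using ideal.Icarr[OF A] by blast
    then show "x [^] (p ^ n) \<in> {x \<in> carrier R. x [^] (p ^ 1) \<in> ?K}"
      using frobenius_power_mem[OF A x, of "p ^ Suc n"] c[OF xc] by simp
  qed
  then show "frobenius_power R (frobenius_power R A (p ^ n)) p \<subseteq> ?K"
    by (intro frobenius_power_least[OF K]) auto
  show "?K \<subseteq> frobenius_power R (frobenius_power R A (p ^ n)) p"
  proof (rule frobenius_power_least[OF frobenius_power_ideal[OF frobenius_power_ideal[OF A]]])
    fix x assume x: "x \<in> A"
    then have xc: "x \<in> carrier R" using ideal.Icarr[OF A] by blast
    show "x [^] (p ^ Suc n) \<in> frobenius_power R (frobenius_power R A (p ^ n)) p"
      using frobenius_power_mem[OF frobenius_power_ideal[OF A] frobenius_power_mem[OF A x, of "p ^ n"], of p] c[OF xc] by simp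
  qed
qed

lemma frobenius_power_sum:
  assumes A: "ideal A R" and B: "ideal B R"
  shows "frobenius_power R (A <+>\<^bsub>R\<^esub> B) p \<subseteq> frobenius_power R A p <+>\<^bsub>R\<^esub> frobenius_power R B p"
proof (rule frobenius_power_least[OF ideal_sum(1)[OF frobenius_power_ideal[OF A] frobenius_power_ideal[OF B]]])
  fix x assume "x \<in> A <+>\<^bsub>R\<^esub> B"
  then obtain a b where ab: "a \<in> A" "b \<in> B" "x = a \<oplus> b" unfolding set_add_iff by blast
  have "x [^] p = a [^] p \<oplus> b [^] p"
    unfolding ab(3) using ideal.Icarr[OF A ab(1)] ideal.Icarr[OF B ab(2)] by (rule frob_add)
  then show "x [^] p \<in> frobenius_power R A p <+>\<^bsub>R\<^esub> frobenius_power R B p"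
    unfolding set_add_iff using frobenius_power_mem[OF A ab(1)] frobenius_power_mem[OF B ab(2)] by blast
qed

end

context frob_setting
begin

lemma ideal_gens: "ideal A R \<Longrightarrow> \<exists>xs. set xs \<subseteq> carrier R \<and> A = Idl (set xs)"
  using finetely_gen finite_list by metis

text \<open>m is finitely generated and each generator has a power in Q, so some power of m lies in
  Q; that power already has finite colength.\<close>

lemma primary_to_facts:
  assumes "primary_to R m Q"
  shows "ideal Q R" "Q \<subseteq> m" "\<exists>k. ideal_power R m k \<subseteq> Q" "colen Q \<noteq> \<infinity>"
proof -
  show Q: "ideal Q R" using assms by (simp add: primary_to_def primary_ideal_def)
  have rad: "radical R Q = m" using assms by (simp add: primary_to_def)
  show "Q \<subseteq> m"
  proof
    fix x assume x: "x \<in> Q"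
    then have "x \<in> carrier R" "x [^] (1::nat) \<in> Q" using ideal.Icarr[OF Q] by auto
    then show "x \<in> m" using rad unfolding radical_def by blast
  qed
  obtain ms where ms: "set ms \<subseteq> carrier R" "m = Idl (set ms)" using ideal_gens[OF ideal_m] by blast
  have "set ms \<subseteq> m" using genideal_self[OF ms(1)] ms(2) by simp
  then have "\<forall>x\<in>set ms. \<exists>n::nat. x [^] n \<in> Q" using rad unfolding radical_def by blast
  from bchoice[OF this] obtain n :: "'a \<Rightarrow> nat" where n: "\<And>x. x \<in> set ms \<Longrightarrow> x [^] n x \<in> Q" by blast
  define N where "N = sum_list (map n ms)"
  have N: "x [^] N \<in> Q" if x: "x \<in> set ms" for x
  proof -
    have "n x \<le> N" unfolding N_def using x by (intro member_le_sum_list) auto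
    then have "x [^] N = x [^] n x \<otimes> x [^] (N - n x)" using x ms(1) by (simp add: nat_pow_mult subset_iff)
    then show ?thesis using ideal.I_r_closed[OF Q n[OF x]] x ms(1) by (simp add: subset_iff)
  qed
  have sub: "ideal_power R m (length ms * N + 1) \<subseteq> Q"
    unfolding ms(2) by (rule ideal_power_subset_of_gens[OF ms(1) Q N])
  then show "\<exists>k. ideal_power R m k \<subseteq> Q" by blast
  have "colen m \<noteq> \<infinity>" using colen_maximal[OF maximal_m] by simp
  then have "colen (ideal_power R m (length ms * N + 1)) \<noteq> \<infinity>"
    using colen_power_finite'[OF ms(1), folded ms(2)] by blast
  then show "colen Q \<noteq> \<infinity>" using sub colen_finite_mono by blast
qed

end

section \<open>Parameter ideals, multiplicity and the common support\<close>

locale parameter_setting = frob_setting +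
  fixes d and I J and xs ys :: "'a list"
  assumes dim: "krull_dim R = enat d" and d1: "d \<ge> 1"
    and param: "system_of_parameters R m xs" and J: "J = Idl\<^bsub>R\<^esub> (set xs)"
    and Iprim: "primary_to R m I" and ys: "set ys \<subseteq> carrier R" and I: "I = Idl\<^bsub>R\<^esub> (set ys)"
begin

lemma length_xs: "length xs = d"
  using param dim by (simp add: system_of_parameters_def)

lemma xs: "set xs \<subseteq> carrier R"
  using param ideal_subset_carrier[OF ideal_m] by (auto simp: system_of_parameters_def)

lemma Jprim: "primary_to R m J"
  using param J by (simp add: system_of_parameters_def)

lemmas ideal_I = primary_to_facts(1)[OF Iprim] and ideal_J = primary_to_facts(1)[OF Jprim]
lemmas fin_I = primary_to_facts(4)[OF Iprim] and fin_J = primary_to_facts(4)[OF Jprim]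

abbreviation Jq :: "nat \<Rightarrow> 'a set" where "Jq n \<equiv> frobenius_power R J (p ^ n)"

lemma p2: "p \<ge> 2"
  using prime_ge_2_nat[OF prime_p] .

lemma ideal_Jq: "ideal (Jq n) R"
  by (rule frobenius_power_ideal[OF ideal_J])

lemma gens_Jq: "x \<in> set xs \<Longrightarrow> x [^] (p ^ n) \<in> Jq n"
  by (rule frobenius_power_mem[OF ideal_J]) (use genideal_self[OF xs] J in auto)

lemma fin_Jq: "colen (Jq n) \<noteq> \<infinity>"
  using nlen_of_gens_in(2)[OF xs fin_J[unfolded J] ideal_Jq gens_Jq] .

lemma filterlim_pn: "filterlim (\<lambda>n. real (p ^ n)) at_top sequentially"
proof (rule filterlim_at_top_mono[OF filterlim_real_sequentially], rule always_eventually, rule allI)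
  fix n
  have "n < 2 ^ n" by (rule less_exp)
  also have "(2::nat) ^ n \<le> p ^ n" using p2 by (rule power_mono) simp
  finally show "real n \<le> real (p ^ n)" by simp
qed

text \<open>The upper bound is the box sum of \<open>decr_asymp\<close>. For the lower bound,
  (J^[q])^k lies in J^(qk), and R/(J^[q])^k has length at most l(R/J^[q]) times the number of
  monomials of degree below k. Letting k tend to infinity leaves e q^d \<le> l(R/J^[q]).\<close>

lemma multiplicity_J:
  "(\<lambda>n. real (nlen (Jq n)) / real (p ^ n) ^ d) \<longlonglongrightarrow> multiplicity R J"
proof -
  let ?B = "nlen (Idl (set xs))" and ?f = "phi xs {\<zero>}"
  note fin = fin_J[unfolded J]
  have dec: "decr d ?f" and le: "\<And>u. length u = d \<Longrightarrow> ?f u \<le> ?B"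
    using phi_decr[OF xs fin zeroideal] phi_le[OF xs fin zeroideal] length_xs by auto
  obtain e s where e: "\<And>n. e * card (expsl d n) \<le> (\<Sum>u\<in>expsl d n. ?f u)"
    "(\<lambda>n. real (\<Sum>u\<in>expsl d n. ?f u) / real n ^ d) \<longlonglongrightarrow> real e / fact d"
    "\<And>q. s \<le> q \<Longrightarrow> (\<Sum>u\<in>box d q. ?f u) \<le> e * q ^ d + ?B * (q ^ d - (q - s) ^ d)"
    by (rule decr_asymp[OF dec le]) (assumption, rule that, assumption+)
  have Jn: "nlen (ideal_power R J n) = (\<Sum>u\<in>expsl d n. ?f u)" for n
    using nlen_power[OF xs fin, of n] length_xs J by simp
  have "(\<lambda>n. fact d * (real (\<Sum>u\<in>expsl d n. ?f u) / real n ^ d)) \<longlonglongrightarrow> fact d * (real e / fact d)"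
    by (intro tendsto_intros e(2))
  then have "(\<lambda>n. fact d * quot_length R (ideal_power R J n) / real n ^ d) \<longlonglongrightarrow> real e"
    by (simp add: quot_length_nlen[OF ideal_power_ideal[OF ideal_J]] Jn)
  then have mult: "multiplicity R J = real e"
    unfolding multiplicity_def by (simp add: dim limI)
  have lower: "e * (p ^ n) ^ d \<le> nlen (Jq n)" for n
  proof -
    let ?q = "p ^ n"
    define zs where "zs = map (\<lambda>x. x [^] ?q) xs"
    have zs: "set zs \<subseteq> carrier R" "length zs = d" "Jq n = Idl (set zs)"
      using xs length_xs frobenius_power_Idl[OF xs, of n] J by (auto simp: zs_def)
    have finz: "colen (Idl (set zs)) \<noteq> \<infinity>" using fin_Jq[of n] unfolding zs(3) .
    have k: "e * card (expsl d (?q * k)) \<le> nlen (Jq n) * card (expsl d k)" for k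
    proof -
      have "ideal_power R (Jq n) k \<subseteq> ideal_power R (ideal_power R J ?q) k"
        by (rule ideal_power_mono[OF ideal_Jq ideal_power_ideal[OF ideal_J] frobenius_power_sub_power[OF ideal_J]])
      then have sub: "ideal_power R (Jq n) k \<subseteq> ideal_power R J (?q * k)"
        using ideal_power_mult[OF ideal_J] by simp
      have "e * card (expsl d (?q * k)) \<le> nlen (ideal_power R J (?q * k))" using e(1) Jn by simp
      also have "\<dots> \<le> nlen (ideal_power R (Jq n) k)"
        using nlen_antimono[OF sub] colen_power_finite'[OF zs(1) finz] zs(3) by simp
      also have "\<dots> = (\<Sum>u\<in>expsl d k. phi zs {\<zero>} u)"
        using nlen_power[OF zs(1) finz, of k] zs by simp
      also have "\<dots> \<le> (\<Sum>u\<in>expsl d k. nlen (Jq n))"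
        by (rule sum_mono) (use phi_le[OF zs(1) finz zeroideal] zs in \<open>auto simp: expsl_def\<close>)
      also have "\<dots> = nlen (Jq n) * card (expsl d k)" by simp
      finally show ?thesis .
    qed
    have "?q > 0" using p_pos by simp
    then have sm: "strict_mono (\<lambda>k. ?q * k)" by (simp add: strict_mono_def)
    have l1: "(\<lambda>k. real e * real ?q ^ d * (real (card (expsl d (?q * k))) / real (?q * k) ^ d))
        \<longlonglongrightarrow> real e * real ?q ^ d * (1 / fact d)"
      using LIMSEQ_subseq_LIMSEQ[OF card_expsl_asymp[of d] sm, unfolded o_def] by (rule tendsto_mult_left)
    have l2: "(\<lambda>k. real (nlen (Jq n)) * (real (card (expsl d k)) / real k ^ d)) \<longlonglongrightarrow> real (nlen (Jq n)) * (1 / fact d)"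
      by (intro tendsto_intros card_expsl_asymp)
    have "real e * real ?q ^ d * (1 / fact d) \<le> real (nlen (Jq n)) * (1 / fact d)"
    proof (rule LIMSEQ_le[OF l1 l2], rule exI[of _ 1], intro allI impI)
      fix k :: nat assume "1 \<le> k"
      have "real e * real (card (expsl d (?q * k))) \<le> real (nlen (Jq n)) * real (card (expsl d k))"
        using k[of k] by (metis of_nat_le_iff of_nat_mult)
      then have "real e * real (card (expsl d (?q * k))) / real k ^ d \<le> real (nlen (Jq n)) * real (card (expsl d k)) / real k ^ d"
        by (intro divide_right_mono) auto
      then show "real e * real ?q ^ d * (real (card (expsl d (?q * k))) / real (?q * k) ^ d) \<le>
          real (nlen (Jq n)) * (real (card (expsl d k)) / real k ^ d)"
        using \<open>?q > 0\<close> by (simp add: power_mult_distrib)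
    qed
    then have "real e * real ?q ^ d \<le> real (nlen (Jq n))" by (simp add: divide_le_cancel)
    then show ?thesis by (metis of_nat_le_iff of_nat_mult of_nat_power)
  qed
  have upper: "nlen (Jq n) \<le> e * (p ^ n) ^ d + ?B * ((p ^ n) ^ d - (p ^ n - s) ^ d)" if "s \<le> p ^ n" for n
    using nlen_of_gens_in(1)[OF xs fin ideal_Jq gens_Jq, of n] e(3)[OF that] length_xs by simp
  show ?thesis unfolding mult
  proof (rule tendsto_sandwich)
    have q0: "real (p ^ n) > 0" for n using p_pos by simp
    show "\<forall>\<^sub>F n in sequentially. real e \<le> real (nlen (Jq n)) / real (p ^ n) ^ d"
    proof (rule always_eventually, rule allI)
      fix n
      have "real e * real (p ^ n) ^ d \<le> real (nlen (Jq n))"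
        using lower[of n] by (metis of_nat_le_iff of_nat_mult of_nat_power)
      then show "real e \<le> real (nlen (Jq n)) / real (p ^ n) ^ d" using q0[of n] by (simp add: pos_le_divide_eq)
    qed
    have "(\<lambda>n. real e + real ?B * (1 - (1 - real s * (1 / real (p ^ n))) ^ d)) \<longlonglongrightarrow> real e + real ?B * (1 - (1 - real s * 0) ^ d)"
      by (intro tendsto_intros tendsto_divide_0[OF tendsto_const] filterlim_at_top_imp_at_infinity filterlim_pn)
    then show "(\<lambda>n. real e + real ?B * (1 - (1 - real s * (1 / real (p ^ n))) ^ d)) \<longlonglongrightarrow> real e" by simp
    have "\<forall>\<^sub>F n in sequentially. real s \<le> real (p ^ n)"
      using filterlim_pn unfolding filterlim_at_top by blast
    then show "\<forall>\<^sub>F n in sequentially. real (nlen (Jq n)) / real (p ^ n) ^ d \<le>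
        real e + real ?B * (1 - (1 - real s * (1 / real (p ^ n))) ^ d)"
    proof eventually_elim
      case (elim n)
      let ?q = "p ^ n"
      have alg: "(real e * Q ^ d + real ?B * (Q ^ d - (Q - real s) ^ d)) / Q ^ d =
          real e + real ?B * (1 - ((Q - real s) / Q) ^ d)" if "Q > 0" for Q :: real
        using that by (simp add: power_divide field_simps)
      have sq: "s \<le> ?q" using elim by simp
      then have le: "(?q - s) ^ d \<le> ?q ^ d" by (intro power_mono) auto
      have "real (nlen (Jq n)) \<le> real (e * ?q ^ d + ?B * (?q ^ d - (?q - s) ^ d))"
        using upper[OF sq] by (rule of_nat_mono)
      also have "\<dots> = real e * real ?q ^ d + real ?B * (real ?q ^ d - (real ?q - real s) ^ d)"
        using le sq by (simp only: of_nat_add of_nat_mult of_nat_diff of_nat_power)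
      finally have "real (nlen (Jq n)) / real ?q ^ d \<le>
          (real e * real ?q ^ d + real ?B * (real ?q ^ d - (real ?q - real s) ^ d)) / real ?q ^ d"
        using q0[of n] by (intro divide_right_mono) auto
      also have "\<dots> = real e + real ?B * (1 - ((real ?q - real s) / real ?q) ^ d)"
        using alg[OF q0[of n]] .
      also have "(real ?q - real s) / real ?q = 1 - real s * (1 / real ?q)"
        using q0[of n] by (simp only: diff_divide_distrib) simp
      finally show ?case .
    qed
  qed simp
qed

lemma Jq_bound: "nlen (Jq n) \<le> nlen J * (p ^ n) ^ d"
proof -
  note fin = fin_J[unfolded J]
  have "nlen (Jq n) \<le> (\<Sum>u\<in>box d (p ^ n). phi xs {\<zero>} u)"
    using nlen_of_gens_in(1)[OF xs fin ideal_Jq gens_Jq, of n] length_xs by simp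
  also have "\<dots> \<le> (\<Sum>u\<in>box d (p ^ n). nlen J)"
    by (rule sum_mono) (use phi_le[OF xs fin zeroideal] length_xs J in \<open>auto simp: box_def\<close>)
  finally show ?thesis by (simp add: card_box mult.commute)
qed

lemma J_power_bound: "nlen (ideal_power R J n) \<le> nlen J * n ^ d"
proof -
  note fin = fin_J[unfolded J]
  have "nlen (ideal_power R J n) = (\<Sum>u\<in>expsl d n. phi xs {\<zero>} u)"
    using nlen_power[OF xs fin, of n] length_xs J by simp
  also have "\<dots> \<le> (\<Sum>u\<in>expsl d n. nlen J)"
    by (rule sum_mono) (use phi_le[OF xs fin zeroideal] length_xs J in \<open>auto simp: expsl_def\<close>)
  also have "\<dots> \<le> nlen J * n ^ d" using card_expsl_le[of d n] by (simp add: mult.commute)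
  finally show ?thesis .
qed

lemma power_J_sub_I: "\<exists>k. ideal_power R J k \<subseteq> I"
proof -
  obtain k where k: "ideal_power R m k \<subseteq> I" using primary_to_facts(3)[OF Iprim] by blast
  have "ideal_power R J k \<subseteq> ideal_power R m k"
    by (rule ideal_power_mono[OF ideal_J ideal_m primary_to_facts(2)[OF Jprim]])
  then show ?thesis using k by blast
qed

lemma power_I_sub_J: "\<exists>k. ideal_power R I k \<subseteq> J"
proof -
  obtain k where k: "ideal_power R m k \<subseteq> J" using primary_to_facts(3)[OF Jprim] by blast
  have "ideal_power R I k \<subseteq> ideal_power R m k"
    by (rule ideal_power_mono[OF ideal_I ideal_m primary_to_facts(2)[OF Iprim]])
  then show ?thesis using k by blast
qed

text \<open>The support for A = 0 contains the support for every ideal A, in particular for all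
  J^[q].\<close>

definition supp :: "nat list set"
  where "supp = {u. length u = length ys \<and> phi ys {\<zero>} u > 0}"

text \<open>Each point of the support contributes at least 1 to l(R/I^n), and J^k \<subseteq> I
  bounds this length by l(R/J^(kn)) = O(n^d), J having d generators.\<close>

lemma thin_supp: "\<exists>C. thin_downset (length ys) d supp C"
proof -
  note fin = fin_I[unfolded I]
  obtain k where k: "ideal_power R J k \<subseteq> I" using power_J_sub_I by blast
  have "card {u\<in>supp. sum_list u < n} \<le> nlen J * k ^ d * (n + 1) ^ d" for n
  proof -
    have "ideal_power R (ideal_power R J k) n \<subseteq> ideal_power R I n"
      by (rule ideal_power_mono[OF ideal_power_ideal[OF ideal_J] ideal_I k])
    then have sub: "ideal_power R J (k * n) \<subseteq> ideal_power R I n" by (simp add: ideal_power_mult[OF ideal_J])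
    have "card {u\<in>supp. sum_list u < n} = (\<Sum>u\<in>{u\<in>supp. sum_list u < n}. 1)" by simp
    also have "\<dots> \<le> (\<Sum>u\<in>{u\<in>supp. sum_list u < n}. phi ys {\<zero>} u)"
      by (rule sum_mono) (auto simp: supp_def)
    also have "\<dots> \<le> (\<Sum>u\<in>expsl (length ys) n. phi ys {\<zero>} u)"
      by (rule sum_mono2[OF finite_expsl]) (auto simp: supp_def expsl_def)
    also have "\<dots> = nlen (ideal_power R I n)" using nlen_power[OF ys fin, of n] I by simp
    also have "\<dots> \<le> nlen (ideal_power R J (k * n))"
      by (rule nlen_antimono[OF sub]) (use colen_power_finite'[OF xs fin_J[unfolded J]] J in simp)
    also have "\<dots> \<le> nlen J * (k * n) ^ d" by (rule J_power_bound)
    also have "\<dots> \<le> nlen J * (k * (n + 1)) ^ d" by (intro mult_left_mono power_mono) auto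
    finally show ?thesis by (simp only: power_mult_distrib mult.assoc)
  qed
  moreover have "downset (length ys) supp"
    unfolding downset_def
  proof (intro conjI ballI allI impI)
    show "length v = length ys" if "v \<in> supp" for v using that by (simp add: supp_def)
    show "u \<in> supp" if v: "v \<in> supp" and uv: "lle u v" for u v
    proof -
      have "length u = length ys" using v list_all2_lengthD[OF uv] by (simp add: supp_def)
      then have "phi ys {\<zero>} v \<le> phi ys {\<zero>} u"
        using phi_decr[OF ys fin zeroideal] uv unfolding decr_def by blast
      then show ?thesis using v \<open>length u = length ys\<close> by (simp add: supp_def)
    qed
  qed
  ultimately show ?thesis unfolding thin_downset_def by blast
qed

end

section \<open>The h-function and the F-threshold\<close>

context parameter_setting
begin

lemma supported_phi:
  assumes thin: "thin_downset (length ys) d supp C" and A: "ideal A R"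
  shows "thin_downset.supported (length ys) supp (phi ys A) (nlen I)"
  unfolding thin_downset.supported_def[OF thin]
proof (intro conjI allI impI)
  note fin = fin_I[unfolded I]
  show "decr (length ys) (phi ys A)" by (rule phi_decr[OF ys fin A])
  fix u :: "nat list" assume u: "length u = length ys"
  show "phi ys A u \<le> nlen I" using phi_le[OF ys fin A u] I by simp
  have "{\<zero>} \<subseteq> A" using smodD(2)[OF A[unfolded ideal_iff_smod]] by simp
  then have "phi ys A u \<le> phi ys {\<zero>} u" by (rule phi_antimono[OF ys fin zeroideal A _ u])
  then show "phi ys A u = 0" if "u \<notin> supp" using that u by (simp add: supp_def)
qed

lemma nlen_I_power_add:
  "ideal A R \<Longrightarrow> nlen (ideal_power R I n <+>\<^bsub>R\<^esub> A) = (\<Sum>u\<in>expsl (length ys) n. phi ys A u)"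
  using nlen_power_add[OF ys fin_I[unfolded I]] I by simp

lemma fin_I_power_add: "ideal A R \<Longrightarrow> colen (ideal_power R I n <+>\<^bsub>R\<^esub> A) \<noteq> \<infinity>"
  using colen_power_finite[OF ys fin_I[unfolded I]] I by simp

text \<open>Raising the exponent of I by one adds a single degree layer, which is O(N^(d-1))
  uniformly in A.\<close>

lemma I_power_step:
  "\<exists>K. \<forall>N j A. ideal A R \<longrightarrow>
    nlen (ideal_power R I (N + j) <+>\<^bsub>R\<^esub> A) \<le> nlen (ideal_power R I N <+>\<^bsub>R\<^esub> A) + j * (K * (N + j) ^ (d - 1))"
proof -
  obtain C where thin: "thin_downset (length ys) d supp C" using thin_supp by blast
  obtain K where K: "\<And>\<psi> B N. thin_downset.supported (length ys) supp \<psi> B \<Longrightarrow>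
      (\<Sum>u\<in>exps (length ys) N. \<psi> u) \<le> B * K * (N + 1) ^ (d - 1)"
    using thin_downset.layer_bound[OF thin] by blast
  have "nlen (ideal_power R I (N + j) <+>\<^bsub>R\<^esub> A) \<le>
      nlen (ideal_power R I N <+>\<^bsub>R\<^esub> A) + j * (nlen I * K * (N + j) ^ (d - 1))" if A: "ideal A R" for N j A
  proof (induction j)
    case (Suc j)
    have "nlen (ideal_power R I (N + Suc j) <+>\<^bsub>R\<^esub> A) =
        nlen (ideal_power R I (N + j) <+>\<^bsub>R\<^esub> A) + (\<Sum>u\<in>exps (length ys) (N + j). phi ys A u)"
      unfolding nlen_I_power_add[OF A] by (simp add: sum_expsl)
    also have "(\<Sum>u\<in>exps (length ys) (N + j). phi ys A u) \<le> nlen I * K * (N + j + 1) ^ (d - 1)"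
      by (rule K[OF supported_phi[OF thin A]])
    also have "nlen (ideal_power R I (N + j) <+>\<^bsub>R\<^esub> A) \<le>
        nlen (ideal_power R I N <+>\<^bsub>R\<^esub> A) + j * (nlen I * K * (N + Suc j) ^ (d - 1))"
    proof -
      have "(N + j) ^ (d - 1) \<le> (N + Suc j) ^ (d - 1)" by (rule power_mono) auto
      then have "j * (nlen I * K * (N + j) ^ (d - 1)) \<le> j * (nlen I * K * (N + Suc j) ^ (d - 1))"
        by (intro mult_left_mono) auto
      then show ?thesis using Suc by linarith
    qed
    finally show ?case by simp
  qed simp
  then show ?thesis by blast
qed

lemma J_power_sub_Jq: "ideal_power R J (d * p ^ n + 1) \<subseteq> Jq n"
  using ideal_power_subset_of_gens[OF xs ideal_Jq gens_Jq, of n] length_xs J by simp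

text \<open>J^(dq+1) lies in J^[q] and so in B, hence the growth of R/c along powers of J applies.
  The constant comes from dq + 2 \<le> (d + 2) q.\<close>

lemma principal_bound:
  assumes c: "c \<in> carrier R" "c \<noteq> \<zero>"
  shows "\<exists>C. \<forall>n B. ideal B R \<longrightarrow> Jq n \<subseteq> B \<longrightarrow> nlen (Idl {c} <+>\<^bsub>R\<^esub> B) \<le> C * (p ^ n) ^ (d - 1)"
proof -
  obtain C :: nat where C: "\<And>n. colen (Idl {c} <+>\<^bsub>R\<^esub> ideal_power R J n) \<le> enat (C * (n + 1) ^ (d - 1))"
    using colen_principal_growth[OF ideal_J fin_J dim d1 c] by blast
  have Ic: "ideal (Idl {c}) R" by (rule genideal_ideal) (use c in auto)
  have "nlen (Idl {c} <+>\<^bsub>R\<^esub> B) \<le> C * (d + 2) ^ (d - 1) * (p ^ n) ^ (d - 1)"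
    if B: "ideal B R" "Jq n \<subseteq> B" for n B
  proof -
    let ?N = "d * p ^ n + 1"
    have "ideal_power R J ?N \<subseteq> B" using J_power_sub_Jq B(2) by blast
    then have "Idl {c} <+>\<^bsub>R\<^esub> ideal_power R J ?N \<subseteq> Idl {c} <+>\<^bsub>R\<^esub> B"
      by (intro ideal_sum_mono[OF Ic B(1)]) auto
    then have "colen (Idl {c} <+>\<^bsub>R\<^esub> B) \<le> enat (C * (?N + 1) ^ (d - 1))"
      using colen_antimono C[of ?N] order_trans by blast
    then have "nlen (Idl {c} <+>\<^bsub>R\<^esub> B) \<le> C * (?N + 1) ^ (d - 1)"
      unfolding nlen_def by (cases "colen (Idl {c} <+>\<^bsub>R\<^esub> B)") auto
    also have "\<dots> \<le> C * ((d + 2) * p ^ n) ^ (d - 1)"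
    proof (intro mult_left_mono power_mono)
      have "1 \<le> p ^ n" using p_pos by simp
      moreover have "(d + 2) * p ^ n = d * p ^ n + 2 * p ^ n" by (simp add: add_mult_distrib)
      ultimately show "?N + 1 \<le> (d + 2) * p ^ n" by linarith
    qed auto
    finally show ?thesis by (simp only: power_mult_distrib mult.assoc)
  qed
  then show ?thesis by blast
qed

section \<open>Existence of the limit defining h\<close>

definition rnd :: "real \<Rightarrow> nat \<Rightarrow> nat"
  where "rnd x n = nat \<lceil>x * real (p ^ n)\<rceil>"

definition hid :: "real \<Rightarrow> nat \<Rightarrow> 'a set"
  where "hid x n = ideal_power R I (rnd x n) <+>\<^bsub>R\<^esub> Jq n"

lemma rnd_bounds:
  assumes "x > 0"
  shows "x * real (p ^ n) \<le> real (rnd x n)" "real (rnd x n) < x * real (p ^ n) + 1"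
proof -
  have pos: "0 < x * real (p ^ n)" using assms p_pos by simp
  then have "0 < \<lceil>x * real (p ^ n)\<rceil>" by simp
  then have "real (rnd x n) = of_int \<lceil>x * real (p ^ n)\<rceil>" by (simp add: rnd_def)
  then show "x * real (p ^ n) \<le> real (rnd x n)" "real (rnd x n) < x * real (p ^ n) + 1"
    using ceiling_correct[of "x * real (p ^ n)"] by linarith+
qed

lemma rnd_least: "x * real (p ^ n) \<le> real k \<Longrightarrow> rnd x n \<le> k"
  unfolding rnd_def by (simp add: ceiling_le_iff nat_le_iff)

lemma rnd_Suc:
  assumes "x > 0"
  shows "rnd x (Suc n) \<le> p * rnd x n" "p * rnd x n \<le> rnd x (Suc n) + p"
proof -
  have "x * real (p ^ Suc n) = real p * (x * real (p ^ n))" by simp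
  also have "\<dots> \<le> real p * real (rnd x n)" using rnd_bounds(1)[OF assms] by (intro mult_left_mono) auto
  finally show "rnd x (Suc n) \<le> p * rnd x n" by (intro rnd_least) simp
  have "real p * real (rnd x n) \<le> real p * (x * real (p ^ n) + 1)"
    using rnd_bounds(2)[OF assms, of n] by (intro mult_left_mono) auto
  also have "\<dots> = x * real (p ^ Suc n) + real p" by (simp add: algebra_simps)
  also have "\<dots> \<le> real (rnd x (Suc n)) + real p" using rnd_bounds(1)[OF assms, of "Suc n"] by linarith
  finally show "p * rnd x n \<le> rnd x (Suc n) + p" by (metis of_nat_add of_nat_le_iff of_nat_mult)
qed

lemma rnd_asymp:
  assumes "x > 0"
  shows "(\<lambda>n. real (rnd x n) / real (p ^ n)) \<longlonglongrightarrow> x"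
proof (rule tendsto_sandwich)
  have q0: "real (p ^ n) > 0" for n using p_pos by simp
  show "\<forall>\<^sub>F n in sequentially. x \<le> real (rnd x n) / real (p ^ n)"
    using rnd_bounds(1)[OF assms] q0 by (simp add: pos_le_divide_eq)
  show "\<forall>\<^sub>F n in sequentially. real (rnd x n) / real (p ^ n) \<le> x + 1 / real (p ^ n)"
  proof (rule always_eventually, rule allI)
    fix n
    have "real (rnd x n) / real (p ^ n) \<le> (x * real (p ^ n) + 1) / real (p ^ n)"
      using rnd_bounds(2)[OF assms, of n] q0[of n] by (intro divide_right_mono) auto
    also have "\<dots> = x + 1 / real (p ^ n)" using q0[of n] by (simp add: add_divide_distrib)
    finally show "real (rnd x n) / real (p ^ n) \<le> x + 1 / real (p ^ n)" .
  qed
  have "(\<lambda>n. x + 1 / real (p ^ n)) \<longlonglongrightarrow> x + 0"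
    by (intro tendsto_intros tendsto_divide_0[OF tendsto_const] filterlim_at_top_imp_at_infinity filterlim_pn)
  then show "(\<lambda>n. x + 1 / real (p ^ n)) \<longlonglongrightarrow> x" by simp
qed simp

lemma hid_facts:
  shows ideal_hid: "ideal (hid x n) R" and Jq_sub_hid: "Jq n \<subseteq> hid x n"
    and fin_hid: "colen (hid x n) \<noteq> \<infinity>"
  unfolding hid_def using ideal_sum[OF ideal_power_ideal[OF ideal_I] ideal_Jq] fin_I_power_add[OF ideal_Jq] by auto

text \<open>Up to a bounded number of extra factors of I, passing from n to n + 1 amounts to the
  Frobenius power. The summand p compensates the rounding in \<open>rnd\<close>, and p * length ys
  the remainders of exponents.\<close>

lemma frobenius_hid:
  assumes "x > 0"
  shows "frobenius_power R (hid x n) p \<subseteq> hid x (Suc n)"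
    and "ideal_power R I (rnd x (Suc n) + (p + p * length ys)) <+>\<^bsub>R\<^esub> Jq (Suc n) \<subseteq> frobenius_power R (hid x n) p"
proof -
  let ?t = "rnd x n" and ?t' = "rnd x (Suc n)"
  have It: "ideal (ideal_power R I k) R" for k by (rule ideal_power_ideal[OF ideal_I])
  have "frobenius_power R (hid x n) p \<subseteq> frobenius_power R (ideal_power R I ?t) p <+>\<^bsub>R\<^esub> frobenius_power R (Jq n) p"
    unfolding hid_def by (rule frobenius_power_sum[OF It ideal_Jq])
  also have "\<dots> \<subseteq> hid x (Suc n)"
    unfolding hid_def frobenius_power_Suc[OF ideal_J]
  proof (rule ideal_sum_mono[OF It ideal_Jq _ order_refl])
    have "frobenius_power R (ideal_power R I ?t) p \<subseteq> ideal_power R I (?t * p)"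
      by (rule frobenius_power_ideal_power[OF ideal_I])
    also have "\<dots> \<subseteq> ideal_power R I ?t'"
      by (rule ideal_power_antimono[OF ideal_I]) (use rnd_Suc(1)[OF assms, of n] in \<open>simp add: mult.commute\<close>)
    finally show "frobenius_power R (ideal_power R I ?t) p \<subseteq> ideal_power R I ?t'" .
  qed
  finally show "frobenius_power R (hid x n) p \<subseteq> hid x (Suc n)" .
  have F: "ideal (frobenius_power R (hid x n) p) R" by (rule frobenius_power_ideal[OF ideal_hid])
  show "ideal_power R I (?t' + (p + p * length ys)) <+>\<^bsub>R\<^esub> Jq (Suc n) \<subseteq> frobenius_power R (hid x n) p"
  proof (rule ideal_sum_least[OF F])
    have "ideal_power R I (?t' + (p + p * length ys)) \<subseteq> ideal_power R I (p * ?t + p * length ys)"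
      by (rule ideal_power_antimono[OF ideal_I]) (use rnd_Suc(2)[OF assms, of n] in simp)
    also have "\<dots> \<subseteq> frobenius_power R (ideal_power R I ?t) p"
      unfolding I by (rule power_sub_frobenius_power[OF ys p_pos])
    also have "\<dots> \<subseteq> frobenius_power R (hid x n) p"
      by (rule frobenius_power_mono[OF ideal_hid]) (use ideal_sum(2)[OF It ideal_Jq] in \<open>simp add: hid_def\<close>)
    finally show "ideal_power R I (?t' + (p + p * length ys)) \<subseteq> frobenius_power R (hid x n) p" .
    show "Jq (Suc n) \<subseteq> frobenius_power R (hid x n) p"
      unfolding frobenius_power_Suc[OF ideal_J, symmetric]
      by (rule frobenius_power_mono[OF ideal_hid Jq_sub_hid])
  qed
qed

text \<open>The ideal at n + 1 differs from the Frobenius power of the ideal at n by boundedly many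
  layers of I, and \<open>frobenius_comparison\<close> relates the colength of that Frobenius power
  to the colength at n.\<close>

lemma hid_recursion:
  assumes x: "x > 0"
  shows "\<exists>f r M. f > (0::nat) \<and> (\<forall>n. f * nlen (hid x (Suc n)) \<le> r * nlen (hid x n) + M * (p ^ n) ^ (d - 1) \<and>
    r * nlen (hid x n) \<le> f * nlen (hid x (Suc n)) + M * (p ^ n) ^ (d - 1))"
proof -
  obtain f r c where f: "f > (0::nat)" and c: "c \<in> carrier R" "c \<noteq> \<zero>" and
    cmp: "\<And>A. ideal A R \<Longrightarrow> colen (frobenius_power R A p) \<noteq> \<infinity> \<Longrightarrow>
    enat f * colen (frobenius_power R A p) \<le>
      enat r * colen A + enat f * colen (Idl {c [^] p} <+>\<^bsub>R\<^esub> frobenius_power R A p) \<and>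
    enat r * colen A \<le>
      enat f * colen (frobenius_power R A p) + enat r * colen (Idl {c} <+>\<^bsub>R\<^esub> A)"
    using frobenius_comparison by blast
  have cp: "c [^] p \<in> carrier R" "c [^] p \<noteq> \<zero>" using c pow_eq_zero_iff p_pos by auto
  obtain C1 where C1: "\<And>n B. ideal B R \<Longrightarrow> Jq n \<subseteq> B \<Longrightarrow> nlen (Idl {c [^] p} <+>\<^bsub>R\<^esub> B) \<le> C1 * (p ^ n) ^ (d - 1)"
    using principal_bound[OF cp] by blast
  obtain C2 where C2: "\<And>n B. ideal B R \<Longrightarrow> Jq n \<subseteq> B \<Longrightarrow> nlen (Idl {c} <+>\<^bsub>R\<^esub> B) \<le> C2 * (p ^ n) ^ (d - 1)"
    using principal_bound[OF c] by blast
  obtain K where K: "\<And>N j A. ideal A R \<Longrightarrow>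
    nlen (ideal_power R I (N + j) <+>\<^bsub>R\<^esub> A) \<le> nlen (ideal_power R I N <+>\<^bsub>R\<^esub> A) + j * (K * (N + j) ^ (d - 1))"
    using I_power_step by blast
  define j where "j = p + p * length ys"
  \<comment> \<open>An integer not below x, so that \<open>rnd x (Suc n)\<close> is at most X
    p^(n+1).\<close>
  define X where "X = nat \<lceil>x\<rceil>"
  \<comment> \<open>One summand for each source of error: ideals containing c^p, where p^(d-1) comes
    from passing to n + 1; the j extra layers of I; ideals containing c.\<close>
  define M where "M = f * C1 * p ^ (d - 1) + f * (j * (K * (X * p + j) ^ (d - 1))) + r * C2"
  have "f * nlen (hid x (Suc n)) \<le> r * nlen (hid x n) + M * (p ^ n) ^ (d - 1) \<and>
    r * nlen (hid x n) \<le> f * nlen (hid x (Suc n)) + M * (p ^ n) ^ (d - 1)" for n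
  proof -
    let ?F = "frobenius_power R (hid x n) p" and ?Q = "(p ^ n) ^ (d - 1)"
    have F: "ideal ?F R" by (rule frobenius_power_ideal[OF ideal_hid])
    have JF: "Jq (Suc n) \<subseteq> ?F"
      unfolding frobenius_power_Suc[OF ideal_J, symmetric] by (rule frobenius_power_mono[OF ideal_hid Jq_sub_hid])
    have finF: "colen ?F \<noteq> \<infinity>" using colen_finite_mono[OF JF fin_Jq] .
    have Ic: "ideal (Idl {c}) R" "ideal (Idl {c [^] p}) R" by (rule genideal_ideal; use c cp in auto)+
    have finc: "colen (Idl {c} <+>\<^bsub>R\<^esub> hid x n) \<noteq> \<infinity>" "colen (Idl {c [^] p} <+>\<^bsub>R\<^esub> ?F) \<noteq> \<infinity>"
      using colen_finite_mono[OF ideal_sum(3)[OF Ic(1) ideal_hid] fin_hid]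
        colen_finite_mono[OF ideal_sum(3)[OF Ic(2) F] finF] by auto
    have cmp': "f * nlen ?F \<le> r * nlen (hid x n) + f * nlen (Idl {c [^] p} <+>\<^bsub>R\<^esub> ?F)"
      "r * nlen (hid x n) \<le> f * nlen ?F + r * nlen (Idl {c} <+>\<^bsub>R\<^esub> hid x n)"
      using cmp[OF ideal_hid finF] nlen_enat[OF finF] nlen_enat[OF fin_hid, of x n] nlen_enat[OF finc(1)] nlen_enat[OF finc(2)]
      by simp_all
    have "nlen (Idl {c [^] p} <+>\<^bsub>R\<^esub> ?F) \<le> C1 * (p ^ Suc n) ^ (d - 1)" by (rule C1[OF F JF])
    then have e1: "nlen (Idl {c [^] p} <+>\<^bsub>R\<^esub> ?F) \<le> C1 * p ^ (d - 1) * ?Q" by (simp add: power_mult_distrib mult.assoc)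
    have e2: "nlen (Idl {c} <+>\<^bsub>R\<^esub> hid x n) \<le> C2 * ?Q" by (rule C2[OF ideal_hid Jq_sub_hid])
    have up: "nlen (hid x (Suc n)) \<le> nlen ?F" by (rule nlen_antimono[OF frobenius_hid(1)[OF x] finF])
    have low: "nlen ?F \<le> nlen (hid x (Suc n)) + j * (K * (X * p + j) ^ (d - 1)) * ?Q"
    proof -
      let ?t = "rnd x (Suc n)"
      have "x * real (p ^ Suc n) \<le> real X * real (p ^ Suc n)"
        unfolding X_def by (intro mult_right_mono) (auto simp: real_nat_ceiling_ge)
      then have "?t \<le> X * p ^ Suc n" by (intro rnd_least) simp
      moreover have "j * 1 \<le> j * p ^ n" using p_pos by (intro mult_left_mono) auto
      moreover have "(X * p + j) * p ^ n = X * p ^ Suc n + j * p ^ n" by (simp add: add_mult_distrib)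
      ultimately have tj: "?t + j \<le> (X * p + j) * p ^ n" by linarith
      have "nlen ?F \<le> nlen (ideal_power R I (?t + j) <+>\<^bsub>R\<^esub> Jq (Suc n))"
        by (rule nlen_antimono[OF frobenius_hid(2)[OF x, folded j_def] fin_I_power_add[OF ideal_Jq]])
      also have "\<dots> \<le> nlen (hid x (Suc n)) + j * (K * (?t + j) ^ (d - 1))"
        unfolding hid_def by (rule K[OF ideal_Jq])
      also have "j * (K * (?t + j) ^ (d - 1)) \<le> j * (K * ((X * p + j) * p ^ n) ^ (d - 1))"
        by (intro mult_left_mono power_mono tj) auto
      also have "\<dots> = j * (K * (X * p + j) ^ (d - 1)) * ?Q" by (simp only: power_mult_distrib mult.assoc)
      finally show ?thesis by simp
    qed
    have "f * nlen (hid x (Suc n)) \<le> f * nlen ?F" using up by (rule mult_left_mono) simp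
    also have "\<dots> \<le> r * nlen (hid x n) + f * (C1 * p ^ (d - 1) * ?Q)"
      using cmp'(1) mult_left_mono[OF e1, of f] by linarith
    also have "f * (C1 * p ^ (d - 1) * ?Q) \<le> M * ?Q"
      unfolding M_def by (simp add: add_mult_distrib mult.assoc)
    finally have 1: "f * nlen (hid x (Suc n)) \<le> r * nlen (hid x n) + M * ?Q" by simp
    have "r * nlen (hid x n) \<le> f * nlen ?F + r * (C2 * ?Q)"
      using cmp'(2) mult_left_mono[OF e2, of r] by linarith
    also have "f * nlen ?F \<le> f * nlen (hid x (Suc n)) + f * (j * (K * (X * p + j) ^ (d - 1)) * ?Q)"
      using mult_left_mono[OF low, of f] by (simp add: distrib_left)
    also have "f * nlen (hid x (Suc n)) + f * (j * (K * (X * p + j) ^ (d - 1)) * ?Q) + r * (C2 * ?Q) \<le>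
        f * nlen (hid x (Suc n)) + M * ?Q"
      unfolding M_def by (simp add: add_mult_distrib mult.assoc)
    finally show ?thesis using 1 by simp
  qed
  then show ?thesis using f by blast
qed

text \<open>Dividing the recursion by f p^d q^d gives a perturbed geometric recursion with factor
  r/(f p^d) and an error of order p^(-n). Its convergence makes the \<open>lim\<close> in
  \<open>h_function\<close> a genuine limit.\<close>

lemma h_limit:
  assumes x: "x > 0"
  shows "(\<lambda>n. real (nlen (hid x n)) / real (p ^ n) ^ d) \<longlonglongrightarrow> h_function R p I J x"
proof -
  define b where "b n = real (nlen (hid x n)) / real (p ^ n) ^ d" for n
  have q0: "real (p ^ n) > 0" for n using p_pos by simp
  obtain f r M where f: "f > (0::nat)" and
    rec: "\<And>n. f * nlen (hid x (Suc n)) \<le> r * nlen (hid x n) + M * (p ^ n) ^ (d - 1)"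
      "\<And>n. r * nlen (hid x n) \<le> f * nlen (hid x (Suc n)) + M * (p ^ n) ^ (d - 1)"
    using hid_recursion[OF x] by blast
  have "convergent b"
  proof (rule perturbed_geometric_convergent)
    show "0 \<le> b n" for n by (simp add: b_def)
    show "b n \<le> real (nlen J)" for n
    proof -
      have "nlen (hid x n) \<le> nlen J * (p ^ n) ^ d"
        using nlen_antimono[OF Jq_sub_hid[of n x] fin_Jq] Jq_bound[of n] by linarith
      then have "real (nlen (hid x n)) \<le> real (nlen J) * real (p ^ n) ^ d"
        by (metis of_nat_le_iff of_nat_mult of_nat_power)
      then show ?thesis unfolding b_def using q0[of n] by (simp add: pos_divide_le_eq)
    qed
    show "0 < 1 / real p" "1 / real p < 1" using p2 by auto
    show "0 \<le> real r / (real f * real p ^ d)" by simp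
    show "\<bar>b (Suc n) - real r / (real f * real p ^ d) * b n\<bar> \<le> real M / (real f * real p ^ d) * (1 / real p) ^ n" for n
    proof -
      let ?q = "real (p ^ n)"
      have pd: "real p ^ d > 0" and fp: "real f > 0" using p_pos f by auto
      have alg: "u / (P * Q) - r' / (F * P) * (v / Q) = (F * u - r' * v) / (F * P * Q)"
        if "F > 0" "P > 0" "Q > 0" for F P Q u v r' :: real
        using that by (simp add: field_simps)
      have "real (p ^ Suc n) ^ d = real p ^ d * ?q ^ d" by (simp add: power_mult_distrib)
      then have eq: "b (Suc n) - real r / (real f * real p ^ d) * b n =
          (real f * real (nlen (hid x (Suc n))) - real r * real (nlen (hid x n))) / (real f * real p ^ d * ?q ^ d)"
        using alg[of "real f" "real p ^ d" "?q ^ d"] pd fp q0[of n] unfolding b_def by simp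
      have "real (f * nlen (hid x (Suc n))) \<le> real (r * nlen (hid x n) + M * (p ^ n) ^ (d - 1))"
        "real (r * nlen (hid x n)) \<le> real (f * nlen (hid x (Suc n)) + M * (p ^ n) ^ (d - 1))"
        by (rule of_nat_mono, rule rec)+
      then have "\<bar>real f * real (nlen (hid x (Suc n))) - real r * real (nlen (hid x n))\<bar> \<le> real M * ?q ^ (d - 1)"
        by (simp add: abs_le_iff)
      then have "\<bar>b (Suc n) - real r / (real f * real p ^ d) * b n\<bar> \<le> real M * ?q ^ (d - 1) / (real f * real p ^ d * ?q ^ d)"
        unfolding eq abs_divide using pd fp q0[of n] by (simp add: divide_right_mono abs_mult)
      also have "?q ^ d = ?q * ?q ^ (d - 1)" using d1 by (simp add: power_eq_if)
      also have "real M * ?q ^ (d - 1) / (real f * real p ^ d * (?q * ?q ^ (d - 1))) = real M / (real f * real p ^ d) * (1 / real p) ^ n"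
        using q0[of n] by (simp add: power_divide)
      finally show ?thesis .
    qed
  qed
  moreover have "h_function R p I J x = lim b"
  proof -
    have "quot_length R (ideal_power R I (nat \<lceil>x * real (p ^ n)\<rceil>) <+>\<^bsub>R\<^esub> Jq n) / real (p ^ (n * d)) = b n" for n
      using quot_length_nlen[OF ideal_hid, of x n] unfolding b_def hid_def rnd_def
      by (simp add: power_mult)
    then show ?thesis unfolding h_function_def by (simp add: dim)
  qed
  ultimately have "b \<longlonglongrightarrow> h_function R p I J x" by (simp add: convergent_LIMSEQ_iff)
  then show ?thesis unfolding b_def .
qed

lemma I_power_sub_Jq: "\<exists>t. ideal_power R I t \<subseteq> Jq n"
proof -
  obtain k where k: "ideal_power R I k \<subseteq> J" using power_I_sub_J by blast
  have "ideal_power R (ideal_power R I k) (d * p ^ n + 1) \<subseteq> ideal_power R J (d * p ^ n + 1)"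
    by (rule ideal_power_mono[OF ideal_power_ideal[OF ideal_I] ideal_J k])
  then have "ideal_power R I (k * (d * p ^ n + 1)) \<subseteq> Jq n"
    unfolding ideal_power_mult[OF ideal_I] using J_power_sub_Jq by (rule order_trans)
  then show ?thesis by blast
qed

text \<open>The first exponent not counted in the threshold; as the powers of I decrease, the
  supremum there is \<open>thr n - 1\<close>.\<close>

definition thr :: "nat \<Rightarrow> nat"
  where "thr n = (LEAST t. ideal_power R I t \<subseteq> Jq n)"

lemma thr_sub: "ideal_power R I (thr n) \<subseteq> Jq n"
  unfolding thr_def using I_power_sub_Jq by (rule LeastI_ex)

lemma thr_le_iff: "ideal_power R I t \<subseteq> Jq n \<longleftrightarrow> thr n \<le> t"
proof
  show "ideal_power R I t \<subseteq> Jq n \<Longrightarrow> thr n \<le> t" unfolding thr_def by (rule Least_le)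
  show "thr n \<le> t \<Longrightarrow> ideal_power R I t \<subseteq> Jq n"
    using ideal_power_antimono[OF ideal_I] thr_sub by blast
qed

text \<open>If J were 0, then m would consist of nilpotents and be 0; a field has no two primes in a
  strict chain, against d \<ge> 1.\<close>

lemma J_nonzero: "\<exists>x\<in>J. x \<noteq> \<zero>"
proof (rule ccontr)
  assume n: "\<not> ?thesis"
  have rad: "radical R J = m" using Jprim by (simp add: primary_to_def)
  have "m \<subseteq> {\<zero>}"
  proof
    fix x assume "x \<in> m"
    then obtain k :: nat where xk: "x \<in> carrier R" "x [^] k \<in> J" using rad unfolding radical_def by blast
    then have z: "x [^] k = \<zero>" using n by blast
    then have "k > 0" by (cases k) auto
    then show "x \<in> {\<zero>}" using z pow_eq_zero_iff[OF xk(1)] by simp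
  qed
  then have m0: "m = {\<zero>}" using smodD(2)[OF ideal_m[unfolded ideal_iff_smod]] by auto
  have "\<exists>P :: nat \<Rightarrow> 'a set. primeideal (P 0) R \<and> primeideal (P 1) R \<and> P 0 \<subset> P 1"
  proof (rule ccontr)
    assume no: "\<not> ?thesis"
    have "krull_dim R \<le> 0"
      unfolding krull_dim_def
    proof (rule Sup_least, clarify)
      fix k and P :: "nat \<Rightarrow> 'a set"
      assume P: "\<forall>i\<le>k. primeideal (P i) R" "\<forall>i<k. P i \<subset> P (Suc i)"
      show "enat k \<le> 0"
      proof (cases k)
        case (Suc k')
        then have "primeideal (P 0) R \<and> primeideal (P 1) R \<and> P 0 \<subset> P 1" using P by auto
        then show ?thesis using no by blast
      qed (simp add: zero_enat_def)
    qed
    then show False using dim d1 by (simp add: zero_enat_def)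
  qed
  then obtain P :: "nat \<Rightarrow> 'a set" where P: "primeideal (P 0) R" "primeideal (P 1) R" "P 0 \<subset> P 1" by blast
  have i1: "ideal (P 1) R" "ideal (P 0) R" using P(1,2) primeideal.axioms(1) by blast+
  have "m \<subseteq> P 1" "m \<subseteq> P 0" using m0 i1 smodD(2) ideal_iff_smod by blast+
  then have "P 1 = m \<or> P 1 = carrier R"
    using maximalideal.I_maximal[OF maximal_m i1(1)] ideal_subset_carrier[OF i1(1)] by blast
  moreover have "P 1 \<noteq> carrier R" using primeideal.I_notcarr[OF P(2)] by blast
  ultimately have "P 1 = m" by blast
  then show False using P(3) \<open>m \<subseteq> P 0\<close> by blast
qed

lemma J_power_strict: "\<not> ideal_power R J a \<subseteq> ideal_power R J (Suc a)"
proof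
  assume sub: "ideal_power R J a \<subseteq> ideal_power R J (Suc a)"
  obtain x where x: "x \<in> J" "x \<noteq> \<zero>" using J_nonzero by blast
  have xc: "x \<in> carrier R" by (rule ideal.Icarr[OF ideal_J x(1)])
  have "x [^] a \<in> ideal_power R J a"
    using pow_mem_ideal_power[OF ideal_J, of x 1 a] ideal_power_1[OF ideal_J] x(1) by simp
  moreover have "x [^] a \<noteq> \<zero>"
    using pow_eq_zero_iff[OF xc, of a] x(2) by (cases "a = 0") auto
  ultimately have nz: "ideal_power R J a \<noteq> {\<zero>}" by blast
  have "ideal_power R J (Suc a) = J \<cdot> ideal_power R J a"
    unfolding ideal_power_Suc[OF ideal_J] by (rule ideal_prod_commute[OF ideal_power_ideal[OF ideal_J] ideal_J])
  then show False
    using nakayama[OF ideal_power_ideal[OF ideal_J] nz ideal_J primary_to_facts(2)[OF Jprim]] sub by simp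
qed

text \<open>For J^k \<subseteq> I and t = \<open>thr n\<close> one has J^(kt) \<subseteq> I^t
  \<subseteq> J^[q] \<subseteq> J^q, and the powers of J decrease strictly. This makes the threshold
  positive and every \<open>thr n\<close> nonzero.\<close>

lemma thr_lower: "\<exists>k>0. \<forall>n. p ^ n \<le> k * thr n"
proof -
  obtain k where k: "ideal_power R J k \<subseteq> I" using power_J_sub_I by blast
  have *: "p ^ n \<le> k * thr n" for n
  proof (rule ccontr)
    assume "\<not> p ^ n \<le> k * thr n"
    then have lt: "Suc (k * thr n) \<le> p ^ n" by simp
    have "ideal_power R (ideal_power R J k) (thr n) \<subseteq> ideal_power R I (thr n)"
      by (rule ideal_power_mono[OF ideal_power_ideal[OF ideal_J] ideal_I k])
    then have "ideal_power R J (k * thr n) \<subseteq> ideal_power R I (thr n)" by (simp add: ideal_power_mult[OF ideal_J])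
    also have "\<dots> \<subseteq> Jq n" by (rule thr_sub)
    also have "\<dots> \<subseteq> ideal_power R J (p ^ n)" by (rule frobenius_power_sub_power[OF ideal_J])
    also have "\<dots> \<subseteq> ideal_power R J (Suc (k * thr n))" by (rule ideal_power_antimono[OF ideal_J lt])
    finally show False using J_power_strict by blast
  qed
  moreover have "k > 0" using *[of 0] by (cases k) auto
  ultimately show ?thesis by blast
qed

text \<open>Taking Frobenius powers gives thr(n + 1) \<le> p thr(n) + p \<mu> with \<mu> generators
  of I, so after a bounded correction thr(n)/q is a decreasing sequence.\<close>

lemma thr_limit: "(\<lambda>n. real (thr n) / real (p ^ n)) \<longlonglongrightarrow> F_threshold R p J I"
proof -
  let ?\<mu> = "length ys"
  have q0: "real (p ^ n) > 0" for n using p_pos by simp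
  have lim0: "(\<lambda>n. a / real (p ^ n)) \<longlonglongrightarrow> 0" for a
    by (intro tendsto_divide_0[OF tendsto_const] filterlim_at_top_imp_at_infinity filterlim_pn)
  have step: "thr (Suc n) \<le> p * thr n + p * ?\<mu>" for n
  proof -
    have "ideal_power R I (p * thr n + p * ?\<mu>) \<subseteq> frobenius_power R (ideal_power R I (thr n)) p"
      unfolding I by (rule power_sub_frobenius_power[OF ys p_pos])
    also have "\<dots> \<subseteq> frobenius_power R (Jq n) p" by (rule frobenius_power_mono[OF ideal_Jq thr_sub])
    also have "\<dots> = Jq (Suc n)" by (rule frobenius_power_Suc[OF ideal_J])
    finally show ?thesis by (simp only: thr_le_iff)
  qed
  \<comment> \<open>The shift 2 \<mu> absorbs the additive term p \<mu>, because p \<mu> + 2 \<mu>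
    \<le> 2 p \<mu> for p \<ge> 2.\<close>
  define g where "g n = real (thr n + 2 * ?\<mu>) / real (p ^ n)" for n
  have "g (Suc n) \<le> g n" for n
  proof -
    have e: "p * (thr n + 2 * ?\<mu>) = p * thr n + 2 * (p * ?\<mu>)" by (simp add: distrib_left)
    have "2 * ?\<mu> \<le> p * ?\<mu>" using p2 by (rule mult_right_mono) simp
    then have "thr (Suc n) + 2 * ?\<mu> \<le> p * (thr n + 2 * ?\<mu>)" using step[of n] unfolding e by linarith
    then have "real (thr (Suc n) + 2 * ?\<mu>) \<le> real p * real (thr n + 2 * ?\<mu>)" by (metis of_nat_le_iff of_nat_mult)
    then have "g (Suc n) \<le> real p * real (thr n + 2 * ?\<mu>) / real (p ^ Suc n)"
      unfolding g_def by (intro divide_right_mono) auto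
    also have "\<dots> = g n" using p_pos by (simp add: g_def)
    finally show ?thesis .
  qed
  then have "decseq g" by (rule decseq_SucI)
  moreover have "\<forall>n. 0 \<le> g n" by (simp add: g_def)
  ultimately obtain c where c: "g \<longlonglongrightarrow> c" using decseq_convergent[of g 0] by blast
  have "(\<lambda>n. g n - real (2 * ?\<mu>) / real (p ^ n)) \<longlonglongrightarrow> c - 0" by (intro tendsto_diff c lim0)
  moreover have "g n - real (2 * ?\<mu>) / real (p ^ n) = real (thr n) / real (p ^ n)" for n
    unfolding g_def of_nat_add add_divide_distrib by simp
  ultimately have l: "(\<lambda>n. real (thr n) / real (p ^ n)) \<longlonglongrightarrow> c" by simp
  \<comment> \<open>\<open>thr n \<ge> 1\<close> keeps the set nonempty, so \<open>Sup\<close> on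
    the naturals is its maximum and the subtraction is not truncated.\<close>
  have Sup: "Sup {t::nat. \<not> ideal_power R I t \<subseteq> Jq n} = thr n - 1" and pos: "thr n \<ge> 1" for n
  proof -
    obtain k where "k > 0" "\<forall>n. p ^ n \<le> k * thr n" using thr_lower by blast
    then have "0 < k * thr n" using p_pos by (metis less_le_trans zero_less_power)
    then show pos: "thr n \<ge> 1" by simp
    have "{t::nat. \<not> ideal_power R I t \<subseteq> Jq n} = {t. t < thr n}" by (auto simp: thr_le_iff)
    then show "Sup {t::nat. \<not> ideal_power R I t \<subseteq> Jq n} = thr n - 1"
      using pos by (intro cSup_eq_maximum) auto
  qed
  have "(\<lambda>n. real (thr n) / real (p ^ n) - 1 / real (p ^ n)) \<longlonglongrightarrow> c - 0" by (intro tendsto_diff l lim0)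
  then have "(\<lambda>n. real (thr n - 1) / real (p ^ n)) \<longlonglongrightarrow> c" using pos by (simp add: of_nat_diff diff_divide_distrib)
  then have "F_threshold R p J I = c" unfolding F_threshold_def Sup by (rule limI)
  then show ?thesis using l by simp
qed

lemma F_threshold_pos: "F_threshold R p J I > 0"
proof -
  obtain k where k: "k > 0" "\<And>n. p ^ n \<le> k * thr n" using thr_lower by blast
  have "1 / real k \<le> real (thr n) / real (p ^ n)" for n
  proof -
    have "real (p ^ n) \<le> real k * real (thr n)" using k(2)[of n] by (metis of_nat_le_iff of_nat_mult)
    then show ?thesis using k(1) p_pos by (simp add: field_simps)
  qed
  then have "1 / real k \<le> F_threshold R p J I" by (intro LIMSEQ_le_const[OF thr_limit]) auto
  then show ?thesis using k(1) by (metis divide_pos_pos less_le_trans of_nat_0_less_iff zero_less_one)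
qed

text \<open>The strict inequality yields \<open>thr n \<le> rnd y n\<close> for all large n, and
  then the ideal is J^[q] itself.\<close>

lemma h_beyond_threshold:
  assumes y: "y > F_threshold R p J I"
  shows "(\<lambda>n. real (nlen (hid y n)) / real (p ^ n) ^ d) \<longlonglongrightarrow> multiplicity R J"
proof -
  have y0: "y > 0" using F_threshold_pos y by simp
  have "\<forall>\<^sub>F n in sequentially. real (thr n) / real (p ^ n) < y" using thr_limit y by (rule order_tendstoD(2))
  then have "\<forall>\<^sub>F n in sequentially. real (nlen (Jq n)) / real (p ^ n) ^ d = real (nlen (hid y n)) / real (p ^ n) ^ d"
  proof eventually_elim
    case (elim n)
    have "real (thr n) < y * real (p ^ n)" using elim p_pos by (simp add: pos_divide_less_eq)
    then have "thr n \<le> rnd y n" using rnd_bounds(1)[OF y0, of n] by linarith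
    then have "ideal_power R I (rnd y n) \<subseteq> Jq n" by (simp add: thr_le_iff)
    then have "hid y n = Jq n"
      unfolding hid_def using ideal_sum_least[OF ideal_Jq _ order_refl] ideal_sum(3)[OF ideal_power_ideal[OF ideal_I] ideal_Jq] by blast
    then show ?case by simp
  qed
  then show ?thesis by (rule Lim_transform_eventually[OF multiplicity_J])
qed

lemma h_le_multiplicity: "x > 0 \<Longrightarrow> h_function R p I J x \<le> multiplicity R J"
proof (rule LIMSEQ_le[OF h_limit multiplicity_J])
  have "real (nlen (hid x n)) / real (p ^ n) ^ d \<le> real (nlen (Jq n)) / real (p ^ n) ^ d" for n
    using nlen_antimono[OF Jq_sub_hid fin_Jq] by (intro divide_right_mono) auto
  then show "\<exists>N. \<forall>n\<ge>N. real (nlen (hid x n)) / real (p ^ n) ^ d \<le> real (nlen (Jq n)) / real (p ^ n) ^ d" by blast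
qed

text \<open>\<open>growth_limit\<close> is applied between x and a point y beyond the threshold,
  where the limit is known to be e(J,R).\<close>

lemma h_growth:
  assumes x: "0 < x" "x \<le> F_threshold R p J I"
  shows "multiplicity R J \<le> (F_threshold R p J I / x) ^ d * h_function R p I J x"
proof -
  obtain C where thin: "thin_downset (length ys) d supp C" using thin_supp by blast
  let ?c = "F_threshold R p J I"
  have le: "multiplicity R J \<le> (y / x) ^ d * h_function R p I J x" if y: "y > ?c" for y
  proof (rule thin_downset.growth_limit[OF thin supported_phi[OF thin ideal_Jq] filterlim_pn])
    have y0: "y > 0" using F_threshold_pos y by simp
    show "rnd x n \<le> rnd y n" for n
    proof (rule rnd_least)
      have "x * real (p ^ n) \<le> y * real (p ^ n)" using x y by (intro mult_right_mono) auto
      then show "x * real (p ^ n) \<le> real (rnd y n)" using rnd_bounds(1)[OF y0, of n] by linarith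
    qed
    show "(\<lambda>n. real (rnd x n) / real (p ^ n)) \<longlonglongrightarrow> x" by (rule rnd_asymp[OF x(1)])
    show "0 < x" by (rule x(1))
    show "(\<lambda>n. real (rnd y n) / real (p ^ n)) \<longlonglongrightarrow> y" by (rule rnd_asymp[OF y0])
    show "(\<lambda>n. real (\<Sum>u\<in>expsl (length ys) (rnd x n). phi ys (Jq n) u) / real (p ^ n) ^ d) \<longlonglongrightarrow> h_function R p I J x"
      using h_limit[OF x(1)] unfolding hid_def nlen_I_power_add[OF ideal_Jq] .
    show "(\<lambda>n. real (\<Sum>u\<in>expsl (length ys) (rnd y n). phi ys (Jq n) u) / real (p ^ n) ^ d) \<longlonglongrightarrow> multiplicity R J"
      using h_beyond_threshold[OF y] unfolding hid_def nlen_I_power_add[OF ideal_Jq] .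
  qed
  \<comment> \<open>On the right only the factor (y/x)^d depends on y, so y can tend to the
    threshold without any appeal to continuity of h.\<close>
  have "(\<lambda>k. ((?c + 1 / real (Suc k)) / x) ^ d * h_function R p I J x) \<longlonglongrightarrow> ((?c + 0) / x) ^ d * h_function R p I J x"
    using x by (intro tendsto_intros LIMSEQ_inverse_real_of_nat[unfolded inverse_eq_divide]) auto
  then have "multiplicity R J \<le> ((?c + 0) / x) ^ d * h_function R p I J x"
    by (rule LIMSEQ_le_const) (use le in auto)
  then show ?thesis by simp
qed

end

theorem proposition8p21:
  fixes R :: "('a, 'b) ring_scheme" and m I J :: "'a set" and p d :: nat
  assumes "noetherian_domain R"
    and "local_ring R m"
    and "p > 0" and "has_characteristic R p"
    and "F_finite R p"
    and "krull_dim R = enat d" and "d \<ge> 1"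
    and "\<exists>xs. system_of_parameters R m xs \<and> J = Idl\<^bsub>R\<^esub> (set xs)"
    and "primary_to R m I"
  shows "multiplicity R I \<ge> real d ^ d / F_threshold R p J I ^ d * multiplicity R J
    \<longleftrightarrow> (\<exists>x\<^sub>0. 0 < x\<^sub>0 \<and> x\<^sub>0 \<le> F_threshold R p J I \<and>
          multiplicity R I / real d ^ d \<ge> h_function R p I J x\<^sub>0 / x\<^sub>0 ^ d)"
proof -
  interpret noetherian_domain R by fact
  obtain xs where xs: "system_of_parameters R m xs" "J = Idl\<^bsub>R\<^esub> (set xs)" using assms(8) by blast
  have "ideal I R" using assms(9) by (simp add: primary_to_def primary_ideal_def)
  then obtain Y where "Y \<subseteq> carrier R" "finite Y" "I = Idl\<^bsub>R\<^esub> Y" using finetely_gen by blast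
  then obtain ys where ys: "set ys \<subseteq> carrier R" "I = Idl\<^bsub>R\<^esub> (set ys)" using finite_list by blast
  interpret parameter_setting R p m d I J xs ys
    by unfold_locales (use assms xs ys in auto)
  let ?c = "F_threshold R p J I" and ?e = "multiplicity R J" and ?h = "h_function R p I J"
  have c: "?c > 0" by (rule F_threshold_pos)
  have d: "real d ^ d > 0" using assms(7) by simp
  \<comment> \<open>Divided by d^d, condition (1) compares e(I,R)/d^d with e(J,R)/c^d, the same
    quantity e(I,R)/d^d that occurs in (2).\<close>
  have iff: "multiplicity R I \<ge> real d ^ d / ?c ^ d * ?e \<longleftrightarrow> multiplicity R I / real d ^ d \<ge> ?e / ?c ^ d"
    using d by (simp add: pos_le_divide_eq mult.commute)
  show ?thesis
    unfolding iff
  proof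
    assume "?e / ?c ^ d \<le> multiplicity R I / real d ^ d"
    \<comment> \<open>The witness is the threshold itself.\<close>
    moreover have "?h ?c / ?c ^ d \<le> ?e / ?c ^ d"
      using h_le_multiplicity[OF c] c by (intro divide_right_mono) auto
    ultimately have "?h ?c / ?c ^ d \<le> multiplicity R I / real d ^ d" by linarith
    then show "\<exists>x\<^sub>0. 0 < x\<^sub>0 \<and> x\<^sub>0 \<le> ?c \<and> ?h x\<^sub>0 / x\<^sub>0 ^ d \<le> multiplicity R I / real d ^ d"
      using c by blast
  next
    assume "\<exists>x\<^sub>0. 0 < x\<^sub>0 \<and> x\<^sub>0 \<le> ?c \<and> ?h x\<^sub>0 / x\<^sub>0 ^ d \<le> multiplicity R I / real d ^ d"
    then obtain x where x: "0 < x" "x \<le> ?c" "?h x / x ^ d \<le> multiplicity R I / real d ^ d" by blast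
    have "?e / ?c ^ d \<le> (?c / x) ^ d * ?h x / ?c ^ d"
      using h_growth[OF x(1,2)] c by (intro divide_right_mono) auto
    also have "\<dots> = ?h x / x ^ d" using c x(1) by (simp add: power_divide)
    also note x(3)
    finally show "?e / ?c ^ d \<le> multiplicity R I / real d ^ d" .
  qed
qed

end
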